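(* Let $q_0,q_1$ be two real-valued potentials in $L^1_{\mathrm{loc}}(a,b)$, with associated self-adjoint operators $H_0,H_1$, each satisfying: $a$ is finite, and for a reference point $x_0\in(a,b)$ the spectra $\{\mu_j\}_{j\in\mathbb{N}}$ of $H^D_{(a,x_0)}$ and $\{\nu_j\}_{j\in\mathbb{N}_0}$ of $H^N_{(a,x_0)}$ are purely discrete and bounded below, and (i) $\sum_{j\in\mathbb{N}}\frac{1}{1+|\mu_j|^\sigma}<\infty$ for all $\sigma>\frac12$; (ii) for some $r>0$ and all sufficiently large $j$, $\mu_j-\nu_{j-1}\ge\nu_{j-1}^{-r}+\mu_j^{-r}$ and $\nu_j-\mu_j\ge\nu_j^{-r}+\mu_j^{-r}$. Let $c\in(a,b)$, and for some $s\ge\frac12$ let $\phi_j(\cdot,x),\theta_j(\cdot,x)\in R_s(\mathbb{C})$, $j=0,1$, be systems of real entire solutions for $H_j$ with $\phi_j(z,\cdot)$ in the domain of $H_j$ near $a$ and $W(\theta_j(z),\phi_j(z))=1$; let $M_j(z)$ be the corresponding singular Weyl $m$-functions. Suppose that, as $z\to\infty$ along some nonreal rays dissecting the complex plane into sectors of opening angle less than $\pi/s$, one has $\frac{\phi_1(z,x)}{\phi_0(z,x)}=1+o(1)$ for one (and hence for all) $x\in(a,c)$, and, for some $f\in R_s(\mathbb{C})$ and for every $\varepsilon>0$, $$M_1(z)-M_0(z)=f(z)+O\big(\phi_0(z,c-\varepsilon)^{-2}\big).$$ Then $q_0(x)=q_1(x)$ for (almost every) $x\in(a,c)$.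
   Context: For a real-valued $q\in L^1_{\mathrm{loc}}(a,b)$, $-\infty<a<b\le\infty$, put $\tau=-\frac{d^2}{dx^2}+q$ and let $H$ be a self-adjoint operator in $L^2(a,b)$ associated with $\tau$ with separated boundary conditions at $a$ and/or $b$. A solution lies in the domain of $H$ near an endpoint if it is square integrable near it and satisfies the boundary condition of $H$ there in case $\tau$ is limit circle at that endpoint. $H^D_{(a,x_0)}$, $H^N_{(a,x_0)}$ are the restrictions of $H$ to $(a,x_0)$ with Dirichlet, respectively Neumann, boundary condition at $x_0$; eigenvalues are listed increasingly, $\nu_0<\mu_1<\nu_1<\mu_2<\cdots$. $W(u,v)=uv'-u'v$. A system of real entire solutions $\phi(z,x)$, $\theta(z,x)$ means solutions of $\tau u=zu$ entire in $z$ and real for real $z$. The singular Weyl $m$-function $M(z)$, analytic in $\mathbb{C}\setminus\mathbb{R}$, is defined by requiring that $\theta(z,x)+M(z)\phi(z,x)$ lie in the domain of $H$ near $b$. For $s>0$, $R_s(\mathbb{C})$ is the ring of all entire functions $f$ with $|f(z)|\le B\exp(A|z|^s)$ for some constants $A,B>0$; $\phi_j(\cdot,x)\in R_s(\mathbb{C})$ is understood for every $x\in(a,b)$. *)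

theory Defs
  imports "HOL-Complex_Analysis.Complex_Analysis" "HOL-Library.Landau_Symbols"
begin

text \<open>
  Functions on an interval $(a,b)$ are total functions on the reals; only their values on
  \<^term>\<open>einterval a b\<close> matter.  An operator (or linear relation) in $L^2(a,b)$ is represented
  by its graph, a set of pairs of functions, and identities between elements of
  $L^2(a,b)$ are read almost everywhere.
\<close>

definition left_end :: "ereal \<Rightarrow> real filter" where
  "left_end a = filtermap real_of_ereal (at_right a)"

definition right_end :: "ereal \<Rightarrow> real filter" where
  "right_end b = filtermap real_of_ereal (at_left b)"

lemma left_end_ereal: "left_end (ereal a) = at_right a"
  by (simp add: left_end_def at_right_ereal filtermap_filtermap)

lemma right_end_ereal: "right_end (ereal b) = at_left b"
  by (simp add: right_end_def at_left_ereal filtermap_filtermap)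

lemma right_end_PInf: "right_end \<infinity> = at_top"
  by (simp add: right_end_def at_left_PInf filtermap_filtermap)


definition L1_loc :: "ereal \<Rightarrow> ereal \<Rightarrow> (real \<Rightarrow> 'b::{banach, second_countable_topology}) \<Rightarrow> bool" where
  "L1_loc a b f \<longleftrightarrow> (\<forall>x y. {x..y} \<subseteq> einterval a b \<longrightarrow> set_integrable lebesgue {x..y} f)"

definition L2 :: "ereal \<Rightarrow> ereal \<Rightarrow> (real \<Rightarrow> complex) set" where
  "L2 a b = {f. set_borel_measurable lebesgue (einterval a b) f \<and>
                set_integrable lebesgue (einterval a b) (\<lambda>x. (cmod (f x))\<^sup>2)}"

definition L2_inner :: "ereal \<Rightarrow> ereal \<Rightarrow> (real \<Rightarrow> complex) \<Rightarrow> (real \<Rightarrow> complex) \<Rightarrow> complex" where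
  "L2_inner a b f g = set_lebesgue_integral lebesgue (einterval a b) (\<lambda>x. cnj (f x) * g x)"

definition L2_norm :: "ereal \<Rightarrow> ereal \<Rightarrow> (real \<Rightarrow> complex) \<Rightarrow> real" where
  "L2_norm a b f = sqrt (set_lebesgue_integral lebesgue (einterval a b) (\<lambda>x. (cmod (f x))\<^sup>2))"

definition L2_near_left :: "ereal \<Rightarrow> ereal \<Rightarrow> (real \<Rightarrow> complex) \<Rightarrow> bool" where
  "L2_near_left a b f \<longleftrightarrow> (\<exists>y\<in>einterval a b. f \<in> L2 a (ereal y))"

definition L2_near_right :: "ereal \<Rightarrow> ereal \<Rightarrow> (real \<Rightarrow> complex) \<Rightarrow> bool" where
  "L2_near_right a b f \<longleftrightarrow> (\<exists>y\<in>einterval a b. f \<in> L2 (ereal y) b)"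


type_synonym L2_graph = "((real \<Rightarrow> complex) \<times> (real \<Rightarrow> complex)) set"

definition densely_defined :: "ereal \<Rightarrow> ereal \<Rightarrow> L2_graph \<Rightarrow> bool" where
  "densely_defined a b T \<longleftrightarrow>
     (\<forall>g\<in>L2 a b. (\<forall>(f, k)\<in>T. L2_inner a b f g = 0) \<longrightarrow> (AE x\<in>einterval a b in lebesgue. g x = 0))"

text \<open>The right-hand conjunct says that the graph of the adjoint equals the graph of \<open>T\<close>.\<close>

definition self_adjoint :: "ereal \<Rightarrow> ereal \<Rightarrow> L2_graph \<Rightarrow> bool" where
  "self_adjoint a b T \<longleftrightarrow> T \<subseteq> L2 a b \<times> L2 a b \<and> densely_defined a b T \<and>
     (\<forall>g\<in>L2 a b. \<forall>h\<in>L2 a b.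
        (\<forall>(f, k)\<in>T. L2_inner a b k g = L2_inner a b f h) \<longleftrightarrow>
        (\<exists>(g', h')\<in>T. AE x\<in>einterval a b in lebesgue. g x = g' x \<and> h x = h' x))"

text \<open>The lower bound gives both injectivity of $T - z$ and boundedness of its inverse.\<close>

definition resolvent_set :: "ereal \<Rightarrow> ereal \<Rightarrow> L2_graph \<Rightarrow> complex set" where
  "resolvent_set a b T =
     {z. (\<forall>h\<in>L2 a b. \<exists>(f, k)\<in>T. AE x\<in>einterval a b in lebesgue. k x - z * f x = h x) \<and>
         (\<exists>C. \<forall>(f, k)\<in>T. L2_norm a b f \<le> C * L2_norm a b (\<lambda>x. k x - z * f x))}"

definition spectrum :: "ereal \<Rightarrow> ereal \<Rightarrow> L2_graph \<Rightarrow> complex set" where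
  "spectrum a b T = - resolvent_set a b T"

definition eigenspace :: "ereal \<Rightarrow> ereal \<Rightarrow> L2_graph \<Rightarrow> complex \<Rightarrow> (real \<Rightarrow> complex) set" where
  "eigenspace a b T z = {f. \<exists>k. (f, k) \<in> T \<and> (AE x\<in>einterval a b in lebesgue. k x = z * f x)}"

definition discrete_spectrum :: "ereal \<Rightarrow> ereal \<Rightarrow> L2_graph \<Rightarrow> complex set" where
  "discrete_spectrum a b T =
     {z \<in> spectrum a b T. \<not> z islimpt spectrum a b T \<and>
        (\<exists>f\<in>eigenspace a b T z. \<not> (AE x\<in>einterval a b in lebesgue. f x = 0)) \<and>
        (\<exists>B. finite B \<and> (\<forall>f\<in>eigenspace a b T z. \<exists>c.
               AE x\<in>einterval a b in lebesgue. f x = (\<Sum>g\<in>B. c g * g x)))}"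

definition purely_discrete :: "ereal \<Rightarrow> ereal \<Rightarrow> L2_graph \<Rightarrow> bool" where
  "purely_discrete a b T \<longleftrightarrow> spectrum a b T = discrete_spectrum a b T"

definition spectrum_bounded_below :: "ereal \<Rightarrow> ereal \<Rightarrow> L2_graph \<Rightarrow> bool" where
  "spectrum_bounded_below a b T \<longleftrightarrow> (\<exists>m::real. spectrum a b T \<subseteq> of_real ` {m..})"


abbreviation vderiv :: "(real \<Rightarrow> complex) \<Rightarrow> real \<Rightarrow> complex" where
  "vderiv f x \<equiv> vector_derivative f (at x)"

text \<open>
  \<open>tau_rel a b q f g\<close> means $\tau f = -f'' + q f = g$ on $(a,b)$: \<open>f\<close> is differentiable, \<open>f'\<close> is
  locally absolutely continuous, i.e. the integral of a locally integrable function \<open>f2\<close>, and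
  the differential equation holds almost everywhere with \<open>f2\<close> in the role of $f''$.
\<close>

definition tau_rel ::
  "ereal \<Rightarrow> ereal \<Rightarrow> (real \<Rightarrow> real) \<Rightarrow> (real \<Rightarrow> complex) \<Rightarrow> (real \<Rightarrow> complex) \<Rightarrow> bool" where
  "tau_rel a b q f g \<longleftrightarrow>
     (\<forall>x\<in>einterval a b. f differentiable (at x)) \<and>
     (\<exists>f2. L1_loc a b f2 \<and>
        (\<forall>x\<in>einterval a b. \<forall>y\<in>einterval a b. x \<le> y \<longrightarrow>
           vderiv f y - vderiv f x = set_lebesgue_integral lebesgue {x..y} f2) \<and>
        (AE x\<in>einterval a b in lebesgue. - f2 x + of_real (q x) * f x = g x))"

definition solution ::
  "ereal \<Rightarrow> ereal \<Rightarrow> (real \<Rightarrow> real) \<Rightarrow> complex \<Rightarrow> (real \<Rightarrow> complex) \<Rightarrow> bool" where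
  "solution a b q z u \<longleftrightarrow> tau_rel a b q u (\<lambda>x. z * u x)"

definition wronskian :: "(real \<Rightarrow> complex) \<Rightarrow> (real \<Rightarrow> complex) \<Rightarrow> real \<Rightarrow> complex" where
  "wronskian u v x = u x * vderiv v x - vderiv u x * v x"

definition max_op :: "ereal \<Rightarrow> ereal \<Rightarrow> (real \<Rightarrow> real) \<Rightarrow> L2_graph" where
  "max_op a b q = {(f, g). f \<in> L2 a b \<and> g \<in> L2 a b \<and> tau_rel a b q f g}"

definition limit_circle_left :: "ereal \<Rightarrow> ereal \<Rightarrow> (real \<Rightarrow> real) \<Rightarrow> bool" where
  "limit_circle_left a b q \<longleftrightarrow> (\<forall>z u. solution a b q z u \<longrightarrow> L2_near_left a b u)"

definition limit_circle_right :: "ereal \<Rightarrow> ereal \<Rightarrow> (real \<Rightarrow> real) \<Rightarrow> bool" where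
  "limit_circle_right a b q \<longleftrightarrow> (\<forall>z u. solution a b q z u \<longrightarrow> L2_near_right a b u)"

text \<open>
  A separated boundary condition at a limit circle endpoint is $W(v, f) \to 0$ there, where
  \<open>v\<close> lies in the maximal domain, $W(\overline v, v) \to 0$, and the condition is not void.
  At a limit point endpoint there is no boundary condition and \<open>v\<close> is irrelevant.
\<close>

definition bc_fun_left :: "ereal \<Rightarrow> ereal \<Rightarrow> (real \<Rightarrow> real) \<Rightarrow> (real \<Rightarrow> complex) \<Rightarrow> bool" where
  "bc_fun_left a b q v \<longleftrightarrow> (limit_circle_left a b q \<longrightarrow>
     v \<in> Domain (max_op a b q) \<and>
     (wronskian (\<lambda>x. cnj (v x)) v \<longlongrightarrow> 0) (left_end a) \<and>
     (\<exists>f\<in>Domain (max_op a b q). \<not> (wronskian v f \<longlongrightarrow> 0) (left_end a)))"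

definition bc_fun_right :: "ereal \<Rightarrow> ereal \<Rightarrow> (real \<Rightarrow> real) \<Rightarrow> (real \<Rightarrow> complex) \<Rightarrow> bool" where
  "bc_fun_right a b q w \<longleftrightarrow> (limit_circle_right a b q \<longrightarrow>
     w \<in> Domain (max_op a b q) \<and>
     (wronskian (\<lambda>x. cnj (w x)) w \<longlongrightarrow> 0) (right_end b) \<and>
     (\<exists>f\<in>Domain (max_op a b q). \<not> (wronskian w f \<longlongrightarrow> 0) (right_end b)))"

definition bc_left ::
  "ereal \<Rightarrow> ereal \<Rightarrow> (real \<Rightarrow> real) \<Rightarrow> (real \<Rightarrow> complex) \<Rightarrow> (real \<Rightarrow> complex) \<Rightarrow> bool" where
  "bc_left a b q v f \<longleftrightarrow> (limit_circle_left a b q \<longrightarrow> (wronskian v f \<longlongrightarrow> 0) (left_end a))"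

definition bc_right ::
  "ereal \<Rightarrow> ereal \<Rightarrow> (real \<Rightarrow> real) \<Rightarrow> (real \<Rightarrow> complex) \<Rightarrow> (real \<Rightarrow> complex) \<Rightarrow> bool" where
  "bc_right a b q w f \<longleftrightarrow> (limit_circle_right a b q \<longrightarrow> (wronskian w f \<longlongrightarrow> 0) (right_end b))"

text \<open>\<open>H\<close> is a self-adjoint operator associated with $\tau$ with separated boundary conditions,
  given by \<open>v\<close> at \<open>a\<close> and by \<open>w\<close> at \<open>b\<close>.\<close>

definition separated_realization ::
  "ereal \<Rightarrow> ereal \<Rightarrow> (real \<Rightarrow> real) \<Rightarrow> (real \<Rightarrow> complex) \<Rightarrow> (real \<Rightarrow> complex) \<Rightarrow> L2_graph \<Rightarrow> bool" where
  "separated_realization a b q v w H \<longleftrightarrow>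
     bc_fun_left a b q v \<and> bc_fun_right a b q w \<and>
     H = {(f, g) \<in> max_op a b q. bc_left a b q v f \<and> bc_right a b q w f} \<and>
     self_adjoint a b H"

definition in_domain_near_left ::
  "ereal \<Rightarrow> ereal \<Rightarrow> (real \<Rightarrow> real) \<Rightarrow> (real \<Rightarrow> complex) \<Rightarrow> (real \<Rightarrow> complex) \<Rightarrow> bool" where
  "in_domain_near_left a b q v u \<longleftrightarrow> L2_near_left a b u \<and> bc_left a b q v u"

definition in_domain_near_right ::
  "ereal \<Rightarrow> ereal \<Rightarrow> (real \<Rightarrow> real) \<Rightarrow> (real \<Rightarrow> complex) \<Rightarrow> (real \<Rightarrow> complex) \<Rightarrow> bool" where
  "in_domain_near_right a b q w u \<longleftrightarrow> L2_near_right a b u \<and> bc_right a b q w u"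

text \<open>
  The restrictions of \<open>H\<close> to $(a,x_0)$ keep the boundary condition \<open>v\<close> of \<open>H\<close> at \<open>a\<close>.  Since
  \<open>x0\<close> is interior to $(a,b)$, the one-sided limits of \<open>f\<close> and \<open>f'\<close> at \<open>x0\<close> exist.
\<close>

definition H_dirichlet ::
  "ereal \<Rightarrow> ereal \<Rightarrow> (real \<Rightarrow> real) \<Rightarrow> (real \<Rightarrow> complex) \<Rightarrow> real \<Rightarrow> L2_graph" where
  "H_dirichlet a b q v x0 =
     {(f, g) \<in> max_op a (ereal x0) q. bc_left a b q v f \<and> (f \<longlongrightarrow> 0) (at_left x0)}"

definition H_neumann ::
  "ereal \<Rightarrow> ereal \<Rightarrow> (real \<Rightarrow> real) \<Rightarrow> (real \<Rightarrow> complex) \<Rightarrow> real \<Rightarrow> L2_graph" where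
  "H_neumann a b q v x0 =
     {(f, g) \<in> max_op a (ereal x0) q. bc_left a b q v f \<and> (vderiv f \<longlongrightarrow> 0) (at_left x0)}"

text \<open>\<open>\<mu> 0\<close> is unused: the Dirichlet eigenvalues are numbered from 1, the Neumann ones from 0.\<close>

definition discrete_spectra ::
  "ereal \<Rightarrow> ereal \<Rightarrow> (real \<Rightarrow> real) \<Rightarrow> (real \<Rightarrow> complex) \<Rightarrow> real \<Rightarrow> (nat \<Rightarrow> real) \<Rightarrow> (nat \<Rightarrow> real) \<Rightarrow> bool" where
  "discrete_spectra a b q v x0 \<mu> \<nu> \<longleftrightarrow>
     purely_discrete a (ereal x0) (H_dirichlet a b q v x0) \<and>
     purely_discrete a (ereal x0) (H_neumann a b q v x0) \<and>
     spectrum_bounded_below a (ereal x0) (H_dirichlet a b q v x0) \<and>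
     spectrum_bounded_below a (ereal x0) (H_neumann a b q v x0) \<and>
     spectrum a (ereal x0) (H_dirichlet a b q v x0) = (\<lambda>j. of_real (\<mu> j)) ` {1..} \<and>
     spectrum a (ereal x0) (H_neumann a b q v x0) = range (\<lambda>j. of_real (\<nu> j)) \<and>
     (\<forall>j\<ge>1. \<nu> (j - 1) < \<mu> j \<and> \<mu> j < \<nu> j)"


definition R_ring :: "real \<Rightarrow> (complex \<Rightarrow> complex) set" where
  "R_ring s = {f. f holomorphic_on UNIV \<and>
     (\<exists>A>0. \<exists>B>0. \<forall>z. cmod (f z) \<le> B * exp (A * cmod z powr s))}"

definition real_entire_solution ::
  "ereal \<Rightarrow> ereal \<Rightarrow> (real \<Rightarrow> real) \<Rightarrow> (complex \<Rightarrow> real \<Rightarrow> complex) \<Rightarrow> bool" where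
  "real_entire_solution a b q u \<longleftrightarrow>
     (\<forall>z. solution a b q z (u z)) \<and>
     (\<forall>x\<in>einterval a b. (\<lambda>z. u z x) holomorphic_on UNIV) \<and>
     (\<forall>z\<in>\<real>. \<forall>x\<in>einterval a b. u z x \<in> \<real>)"

definition singular_weyl_m ::
  "ereal \<Rightarrow> ereal \<Rightarrow> (real \<Rightarrow> real) \<Rightarrow> (real \<Rightarrow> complex) \<Rightarrow>
   (complex \<Rightarrow> real \<Rightarrow> complex) \<Rightarrow> (complex \<Rightarrow> real \<Rightarrow> complex) \<Rightarrow> (complex \<Rightarrow> complex) \<Rightarrow> bool" where
  "singular_weyl_m a b q w \<phi> \<theta> M \<longleftrightarrow>
     M holomorphic_on (- \<real>) \<and>
     (\<forall>z. z \<notin> \<real> \<longrightarrow> in_domain_near_right a b q w (\<lambda>x. \<theta> z x + M z * \<phi> z x))"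

text \<open>
  \<open>R\<close> is the union of finitely many nonreal rays from the origin, with arguments
  \<open>\<alpha> 0 < \<dots> < \<alpha> (n - 1)\<close>, such that all sectors between cyclically consecutive rays have opening
  angle less than \<open>\<delta>\<close>.
\<close>

definition nonreal_rays_dissecting :: "real \<Rightarrow> complex set \<Rightarrow> bool" where
  "nonreal_rays_dissecting \<delta> R \<longleftrightarrow>
     (\<exists>n (\<alpha> :: nat \<Rightarrow> real). \<alpha> n = \<alpha> 0 + 2 * pi \<and>
        (\<forall>i<n. \<alpha> i < \<alpha> (Suc i) \<and> \<alpha> (Suc i) - \<alpha> i < \<delta> \<and> sin (\<alpha> i) \<noteq> 0) \<and>
        R = {of_real t * cis (\<alpha> i) | t i. t > 0 \<and> i < n})"

definition at_infinity_along :: "complex set \<Rightarrow> complex filter" where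
  "at_infinity_along R = inf at_infinity (principal R)"

end

theory Submission
  imports Defs
begin

text \<open>
  Write $\psi_j = \theta_j + M_j \phi_j$.  For $x < c$ the function
  $F = \phi_1\theta_0 - \phi_0\theta_1 - f\phi_0\phi_1
     = \phi_1\psi_0 - \phi_0\psi_1 + (M_1 - M_0 - f)\phi_0\phi_1$ is entire in $z$ and lies in
  $R_s(\mathbb{C})$.  If it tends to $0$ along the rays, it vanishes by Phragmen-Lindelof and Liouville.
  Then $\theta_0/\phi_0 - \theta_1/\phi_1$ does not depend on $x$, and differentiating yields
  $\phi_0^2 = \phi_1^2$ on $(a,c)$, so both potentials belong to proportional solutions.

  For the decay put $\kappa = \sqrt{-z}$.  Symmetry of $H_j$, applied to $\phi_j$ and $\psi_j$ cut off near
  one endpoint, determines the signs of $\mathrm{Im}(\phi_j'/\phi_j)$ and $\mathrm{Im}(\psi_j'/\psi_j)$.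
  The Riccati equation then gives $\phi_j'/\phi_j = \kappa + O(1)$ locally uniformly in $x$ along the
  rays.  So $\phi_j\psi_j = (\phi_j'/\phi_j - \psi_j'/\psi_j)^{-1} \to 0$, the ratio $\phi_1/\phi_0$ stays
  bounded above and below at every $x$, and $\phi_0(z,x)/\phi_0(z,y) \to 0$ for $x < y$.
\<close>

subsection \<open>Indefinite integrals of integrable functions\<close>

text \<open>The obstacle is that the potentials are merely locally integrable and nothing explicit
  is known about the solutions near \<open>a\<close>, so there is no high-energy expansion to start
  from. A sign takes the place of an initial condition: if Im(u'/u) and Im \<kappa> agree in sign,
  then u'/u stays at distance at least |Im \<kappa>| from -\<kappa>, the unstable equilibrium of the
  free Riccati equation. Going to the right, u'/u is then attracted to \<kappa> at the rate exp(-2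
  Re \<kappa> x). On nonreal rays Re \<kappa> and |Im \<kappa>| are both comparable with |\<kappa>|,
  which makes distance and attraction quantitative. An error O(1) in u'/u costs only bounded factors
  in u. The common growth cancels in the ratio of the two solutions, and the assumption at one point
  fixes their relative size. The strict inequality x < c leaves room for a point y between x and c
  at which the hypothesis on the Weyl functions is used. Since u' is only absolutely continuous, its
  product and quotient rules are stated through integrals over all subintervals.\<close>

definition indef_integral :: "real \<Rightarrow> real \<Rightarrow> (real \<Rightarrow> complex) \<Rightarrow> (real \<Rightarrow> complex) \<Rightarrow> bool" where
  "indef_integral p r F f \<longleftrightarrow> f absolutely_integrable_on {p..r} \<and>
     (\<forall>x y. p \<le> x \<longrightarrow> x \<le> y \<longrightarrow> y \<le> r \<longrightarrow> (f has_integral (F y - F x)) {x..y})"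

lemma indef_integralD:
  assumes "indef_integral p r F f" "p \<le> x" "x \<le> y" "y \<le> r"
  shows "(f has_integral (F y - F x)) {x..y}"
  using assms by (simp add: indef_integral_def)

lemma indef_integral_continuous:
  assumes "indef_integral p r F f"
  shows "continuous_on {p..r} F"
proof -
  have i: "f integrable_on {p..r}"
    using assms by (simp add: indef_integral_def absolutely_integrable_on_def)
  have "continuous_on {p..r} (\<lambda>x. F p + integral {p..x} f)"
    by (intro continuous_intros indefinite_integral_continuous_1 i)
  moreover have "F p + integral {p..x} f = F x" if "x \<in> {p..r}" for x
    using integral_unique[OF indef_integralD[OF assms, of p x]] that by simp
  ultimately show ?thesis by (metis (no_types, lifting) continuous_on_cong)
qed

lemma absolutely_integrable_on_continuous_mult:
  fixes f g :: "real \<Rightarrow> complex"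
  assumes "continuous_on {p..r} f" "g absolutely_integrable_on {p..r}"
  shows "(\<lambda>x. f x * g x) absolutely_integrable_on {p..r}"
  by (rule absolutely_integrable_bounded_measurable_product[where h="(*)"])
     (use assms in \<open>auto intro!: bilinear_times continuous_imp_measurable_on_sets_lebesgue
        compact_imp_bounded compact_continuous_image\<close>)

text \<open>Local $o(\int g)$ estimates add up over a fine partition.\<close>

lemma indef_integral_local_criterion:
  assumes f: "f absolutely_integrable_on {p..r}"
    and g: "g absolutely_integrable_on {p..r}"
    and loc: "\<And>\<epsilon> t. \<epsilon> > 0 \<Longrightarrow> t \<in> {p..r} \<Longrightarrow> \<exists>d>0. \<forall>x y. p \<le> x \<and> x \<le> t \<and> t \<le> y \<and> y \<le> r \<and> y - x < d \<longrightarrow>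
        cmod (F y - F x - integral {x..y} f) \<le> \<epsilon> * integral {x..y} g"
  shows "indef_integral p r F f"
  unfolding indef_integral_def
proof (intro conjI allI impI f)
  fix x y assume xy: "p \<le> x" "x \<le> y" "y \<le> r"
  have fi: "f integrable_on {u..v}" and gi: "g integrable_on {u..v}" if "p \<le> u" "v \<le> r" for u v
    using f g that
    by (auto simp: absolutely_integrable_on_def intro: integrable_on_subinterval)
  have est: "cmod (F y - F x - integral {x..y} f) \<le> \<epsilon> * integral {x..y} g" if e: "\<epsilon> > 0" for \<epsilon>
  proof -
    have "p \<le> x \<longrightarrow> y \<le> r \<longrightarrow> cmod (F y - F x - integral {x..y} f) \<le> \<epsilon> * integral {x..y} g"
      using \<open>x \<le> y\<close>
    proof (induction x y rule: Bolzano)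
      case (trans u v w)
      show ?case
      proof (intro impI)
        assume "p \<le> u" "w \<le> r"
        have "integral {u..w} f = integral {u..v} f + integral {v..w} f"
          "integral {u..w} g = integral {u..v} g + integral {v..w} g"
          using trans \<open>p \<le> u\<close> \<open>w \<le> r\<close> Henstock_Kurzweil_Integration.integral_combine fi gi by metis+
        moreover have "cmod (F v - F u - integral {u..v} f) \<le> \<epsilon> * integral {u..v} g"
          "cmod (F w - F v - integral {v..w} f) \<le> \<epsilon> * integral {v..w} g"
          using trans \<open>p \<le> u\<close> \<open>w \<le> r\<close> by auto
        moreover have "F w - F u - (integral {u..v} f + integral {v..w} f) =
           (F v - F u - integral {u..v} f) + (F w - F v - integral {v..w} f)" by simp
        ultimately show "cmod (F w - F u - integral {u..w} f) \<le> \<epsilon> * integral {u..w} g"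
          by (smt (verit, best) distrib_left norm_triangle_ineq)
      qed
    next
      case (local t)
      then have "t \<in> {p..r}" using xy by auto
      from loc[OF e this] show ?case by meson
    qed
    then show ?thesis using xy by simp
  qed
  have "cmod (F y - F x - integral {x..y} f) \<le> 0"
  proof (rule field_le_epsilon)
    fix e :: real assume "e > 0"
    \<comment> \<open>The summand 1 keeps \<open>G\<close> positive; the absolute value is taken
      because \<open>g\<close> carries no sign.\<close>
    define G where "G = \<bar>integral {x..y} g\<bar> + 1"
    have "G > 0" by (simp add: G_def)
    have "cmod (F y - F x - integral {x..y} f) \<le> e / G * integral {x..y} g"
      using est[of "e/G"] \<open>G > 0\<close> \<open>e > 0\<close> by simp
    also have "\<dots> \<le> e / G * G"
      using \<open>G > 0\<close> \<open>e > 0\<close> by (intro mult_left_mono) (auto simp: G_def)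
    finally show "cmod (F y - F x - integral {x..y} f) \<le> 0 + e" using \<open>G > 0\<close> by simp
  qed
  then have "F y - F x = integral {x..y} f" by simp
  then show "(f has_integral F y - F x) {x..y}"
    using fi[OF xy(1,3)] by (simp add: integrable_integral)
qed

text \<open>With \<open>G\<close> frozen at the left end and \<open>F\<close> at the right end of a
  short interval, integration yields the increment of the product exactly. The error of freezing is
  at most the oscillation of \<open>F\<close> and \<open>G\<close> times |f| + |g|, which is what
  the local criterion asks for.\<close>

lemma indef_integral_mult:
  assumes F: "indef_integral p r F f" and G: "indef_integral p r G g"
  shows "indef_integral p r (\<lambda>x. F x * G x) (\<lambda>x. f x * G x + F x * g x)"
proof (rule indef_integral_local_criterion[where g="\<lambda>x. cmod (f x) + cmod (g x)"])
  have cF: "continuous_on {p..r} F" and cG: "continuous_on {p..r} G"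
    using F G indef_integral_continuous by auto
  have af: "f absolutely_integrable_on {p..r}" and ag: "g absolutely_integrable_on {p..r}"
    using F G by (auto simp: indef_integral_def)
  have afG: "(\<lambda>x. G x * f x) absolutely_integrable_on {p..r}"
    and aFg: "(\<lambda>x. F x * g x) absolutely_integrable_on {p..r}"
    by (intro absolutely_integrable_on_continuous_mult cF cG af ag)+
  then show *: "(\<lambda>x. f x * G x + F x * g x) absolutely_integrable_on {p..r}"
    using set_integral_add(1)[OF afG aFg] by (simp add: mult.commute)
  show "(\<lambda>x. cmod (f x) + cmod (g x)) absolutely_integrable_on {p..r}"
    using absolutely_integrable_norm[OF af] absolutely_integrable_norm[OF ag]
    by (intro set_integral_add) (auto simp: o_def)
  fix \<epsilon> t :: real assume e: "\<epsilon> > 0" and t: "t \<in> {p..r}"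
  obtain d1 where d1: "d1 > 0" "\<And>x. x \<in> {p..r} \<Longrightarrow> dist x t < d1 \<Longrightarrow> dist (F x) (F t) < \<epsilon>/2"
    using cF e t unfolding continuous_on_iff by (meson half_gt_zero)
  obtain d2 where d2: "d2 > 0" "\<And>x. x \<in> {p..r} \<Longrightarrow> dist x t < d2 \<Longrightarrow> dist (G x) (G t) < \<epsilon>/2"
    using cG e t unfolding continuous_on_iff by (meson half_gt_zero)
  show "\<exists>d>0. \<forall>x y. p \<le> x \<and> x \<le> t \<and> t \<le> y \<and> y \<le> r \<and> y - x < d \<longrightarrow>
        cmod (F y * G y - F x * G x - integral {x..y} (\<lambda>x. f x * G x + F x * g x))
          \<le> \<epsilon> * integral {x..y} (\<lambda>x. cmod (f x) + cmod (g x))"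
  proof (intro exI[of _ "min d1 d2"] conjI allI impI)
    show "min d1 d2 > 0" using d1 d2 by simp
    fix x y assume A: "p \<le> x \<and> x \<le> t \<and> t \<le> y \<and> y \<le> r \<and> y - x < min d1 d2"
    have FF: "cmod (F u - F v) \<le> \<epsilon>" and GG: "cmod (G u - G v) \<le> \<epsilon>"
      if "u \<in> {x..y}" "v \<in> {x..y}" for u v
    proof -
      have "u \<in> {p..r}" "v \<in> {p..r}" "dist u t < d1" "dist v t < d1" "dist u t < d2" "dist v t < d2"
        using that A by (auto simp: dist_real_def)
      then have "dist (F u) (F t) < \<epsilon>/2" "dist (F v) (F t) < \<epsilon>/2" "dist (G u) (G t) < \<epsilon>/2" "dist (G v) (G t) < \<epsilon>/2"
        using d1(2) d2(2) by blast+
      then have "dist (F u) (F v) < \<epsilon>" "dist (G u) (G v) < \<epsilon>"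
        by (blast intro: dist_triangle_half_l)+
      then show "cmod (F u - F v) \<le> \<epsilon>" "cmod (G u - G v) \<le> \<epsilon>"
        by (simp_all add: dist_norm)
    qed
    have sub: "h absolutely_integrable_on {x..y}" if "h absolutely_integrable_on {p..r}" for h :: "real \<Rightarrow> complex"
      using that A by (auto intro: absolutely_integrable_on_subinterval)
    have 1: "((\<lambda>s. f s * G x + F y * g s) has_integral ((F y - F x) * G x + F y * (G y - G x))) {x..y}"
      using indef_integralD[OF F, of x y] indef_integralD[OF G, of x y] A
      by (intro has_integral_add has_integral_mult_left has_integral_mult_right) auto
    have 2: "(\<lambda>x. f x * G x + F x * g x) integrable_on {x..y}"
      using sub[OF *] by (simp add: absolutely_integrable_on_def)
    have "((\<lambda>s. (f s * G x + F y * g s) - (f s * G s + F s * g s)) has_integral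
       ((F y - F x) * G x + F y * (G y - G x) - integral {x..y} (\<lambda>x. f x * G x + F x * g x))) {x..y}"
      by (intro has_integral_diff 1 integrable_integral 2)
    then have 3: "((\<lambda>s. f s * (G x - G s) + (F y - F s) * g s) has_integral
       (F y * G y - F x * G x - integral {x..y} (\<lambda>x. f x * G x + F x * g x))) {x..y}"
      by (simp add: algebra_simps)
    have 4: "(\<lambda>s. cmod (f s) + cmod (g s)) integrable_on {x..y}"
      using sub[OF af] sub[OF ag] by (auto simp: absolutely_integrable_on_def intro: integrable_add)
    have "cmod (integral {x..y} (\<lambda>s. f s * (G x - G s) + (F y - F s) * g s)) \<le>
        integral {x..y} (\<lambda>s. \<epsilon> * (cmod (f s) + cmod (g s)))"
    proof (rule integral_norm_bound_integral)
      show "(\<lambda>s. f s * (G x - G s) + (F y - F s) * g s) integrable_on {x..y}" using 3 by blast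
      show "(\<lambda>s. \<epsilon> * (cmod (f s) + cmod (g s))) integrable_on {x..y}"
        using 4 by (metis integrable_on_mult_right)
      fix s assume s: "s \<in> {x..y}"
      have "cmod (f s * (G x - G s) + (F y - F s) * g s) \<le> cmod (f s) * cmod (G x - G s) + cmod (F y - F s) * cmod (g s)"
        by (metis norm_mult norm_triangle_ineq)
      also have "\<dots> \<le> cmod (f s) * \<epsilon> + \<epsilon> * cmod (g s)"
        using s by (intro add_mono mult_left_mono mult_right_mono FF GG) auto
      finally show "cmod (f s * (G x - G s) + (F y - F s) * g s) \<le> \<epsilon> * (cmod (f s) + cmod (g s))"
        by (simp add: algebra_simps)
    qed
    then show "cmod (F y * G y - F x * G x - integral {x..y} (\<lambda>x. f x * G x + F x * g x))
          \<le> \<epsilon> * integral {x..y} (\<lambda>x. cmod (f x) + cmod (g x))"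
      using integral_unique[OF 3] by simp
  qed
qed

text \<open>The identity 1/F(y) - 1/F(x) = -(F(y) - F(x))/(F(x)F(y)) is exact, so replacing the
  varying factor 1/F^2 by the constant 1/(F(x)F(y)) costs only an oscillation of 1/F, small on short
  intervals.\<close>

lemma indef_integral_inverse:
  assumes F: "indef_integral p r F f" and nz: "\<And>x. x \<in> {p..r} \<Longrightarrow> F x \<noteq> 0"
  shows "indef_integral p r (\<lambda>x. inverse (F x)) (\<lambda>x. - f x / (F x)\<^sup>2)"
proof (rule indef_integral_local_criterion[where g="\<lambda>x. cmod (f x)"])
  have cF: "continuous_on {p..r} F" using F indef_integral_continuous by auto
  define I where "I = (\<lambda>x. inverse (F x))"
  have cI: "continuous_on {p..r} I" unfolding I_def using cF nz by (intro continuous_intros) auto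
  then have cI2: "continuous_on {p..r} (\<lambda>x. - ((I x)\<^sup>2))" by (intro continuous_intros)
  have af: "f absolutely_integrable_on {p..r}"
    using F by (auto simp: indef_integral_def)
  show *: "(\<lambda>x. - f x / (F x)\<^sup>2) absolutely_integrable_on {p..r}"
    using absolutely_integrable_on_continuous_mult[OF cI2 af] by (simp add: I_def field_simps)
  show "(\<lambda>x. cmod (f x)) absolutely_integrable_on {p..r}"
    using absolutely_integrable_norm[OF af] by (simp add: o_def)
  obtain B where B: "B > 0" "\<And>x. x \<in> {p..r} \<Longrightarrow> cmod (I x) \<le> B"
    using compact_imp_bounded[OF compact_continuous_image[OF cI compact_Icc]]
    by (auto simp: bounded_pos)
  fix \<epsilon> t :: real assume e: "\<epsilon> > 0" and t: "t \<in> {p..r}"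
  \<comment> \<open>Two terms, each at most \<open>B * (2 * \<delta>)\<close>, have to add up to
    \<epsilon>.\<close>
  define \<delta> where "\<delta> = \<epsilon> / (4 * B)"
  have "\<delta> > 0" using e B by (simp add: \<delta>_def)
  then obtain d where d: "d > 0" "\<And>x. x \<in> {p..r} \<Longrightarrow> dist x t < d \<Longrightarrow> dist (I x) (I t) < \<delta>"
    using cI t unfolding continuous_on_iff by meson
  show "\<exists>d>0. \<forall>x y. p \<le> x \<and> x \<le> t \<and> t \<le> y \<and> y \<le> r \<and> y - x < d \<longrightarrow>
        cmod (inverse (F y) - inverse (F x) - integral {x..y} (\<lambda>x. - f x / (F x)\<^sup>2))
          \<le> \<epsilon> * integral {x..y} (\<lambda>x. cmod (f x))"
  proof (intro exI[of _ d] conjI allI impI)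
    show "d > 0" using d by simp
    fix x y assume A: "p \<le> x \<and> x \<le> t \<and> t \<le> y \<and> y \<le> r \<and> y - x < d"
    have II: "cmod (I u - I v) \<le> 2 * \<delta>" if "u \<in> {x..y}" "v \<in> {x..y}" for u v
    proof -
      have "dist (I u) (I t) < \<delta>" "dist (I v) (I t) < \<delta>"
        using that A by (auto intro!: d(2) simp: dist_real_def)
      then show "cmod (I u - I v) \<le> 2 * \<delta>"
        using dist_triangle2[of "I u" "I v" "I t"] by (simp add: dist_norm)
    qed
    have sub: "h absolutely_integrable_on {x..y}" if "h absolutely_integrable_on {p..r}" for h :: "real \<Rightarrow> complex"
      using that A by (auto intro: absolutely_integrable_on_subinterval)
    have 1: "((\<lambda>s. - (I x * I y * f s)) has_integral (- (I x * I y * (F y - F x)))) {x..y}"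
      using indef_integralD[OF F, of x y] A
      by (intro has_integral_neg has_integral_mult_right) auto
    have 2: "(\<lambda>x. - f x / (F x)\<^sup>2) integrable_on {x..y}"
      using sub[OF *] by (simp add: absolutely_integrable_on_def)
    have "((\<lambda>s. - (I x * I y * f s) - (- f s / (F s)\<^sup>2)) has_integral
       (- (I x * I y * (F y - F x)) - integral {x..y} (\<lambda>x. - f x / (F x)\<^sup>2))) {x..y}"
      by (intro has_integral_diff 1 integrable_integral 2)
    moreover have "- (I x * I y * (F y - F x)) = inverse (F y) - inverse (F x)"
      using nz[of x] nz[of y] A by (simp add: I_def field_simps)
    moreover have "(\<lambda>s. - (I x * I y * f s) - (- f s / (F s)\<^sup>2)) = (\<lambda>s. f s * ((I s)\<^sup>2 - I x * I y))"
      by (rule ext) (simp add: I_def divide_inverse power_inverse algebra_simps)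
    ultimately have 3: "((\<lambda>s. f s * ((I s)\<^sup>2 - I x * I y)) has_integral
       (inverse (F y) - inverse (F x) - integral {x..y} (\<lambda>x. - f x / (F x)\<^sup>2))) {x..y}"
      by simp
    have 4: "(\<lambda>s. cmod (f s)) integrable_on {x..y}"
      using sub[OF af] by (auto simp: absolutely_integrable_on_def)
    have "cmod (integral {x..y} (\<lambda>s. f s * ((I s)\<^sup>2 - I x * I y))) \<le>
        integral {x..y} (\<lambda>s. \<epsilon> * cmod (f s))"
    proof (rule integral_norm_bound_integral)
      show "(\<lambda>s. f s * ((I s)\<^sup>2 - I x * I y)) integrable_on {x..y}" using 3 by blast
      show "(\<lambda>s. \<epsilon> * cmod (f s)) integrable_on {x..y}"
        using 4 by (metis integrable_on_mult_right)
      fix s assume s: "s \<in> {x..y}"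
      have "(I s)\<^sup>2 - I x * I y = I s * (I s - I x) + I x * (I s - I y)"
        by (simp add: algebra_simps power2_eq_square)
      then have "cmod ((I s)\<^sup>2 - I x * I y) \<le> cmod (I s) * cmod (I s - I x) + cmod (I x) * cmod (I s - I y)"
        by (metis norm_mult norm_triangle_ineq)
      also have "\<dots> \<le> B * (2 * \<delta>) + B * (2 * \<delta>)"
        using s A B(1) by (intro add_mono mult_mono II B(2)) auto
      also have "\<dots> = \<epsilon>" using B(1) by (simp add: \<delta>_def)
      finally show "cmod (f s * ((I s)\<^sup>2 - I x * I y)) \<le> \<epsilon> * cmod (f s)"
        by (metis mult.commute mult_right_mono norm_ge_zero norm_mult)
    qed
    then show "cmod (inverse (F y) - inverse (F x) - integral {x..y} (\<lambda>x. - f x / (F x)\<^sup>2))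
          \<le> \<epsilon> * integral {x..y} (\<lambda>x. cmod (f x))"
      using integral_unique[OF 3] by simp
  qed
qed

lemma indef_integral_add:
  assumes "indef_integral p r F f" "indef_integral p r G g"
  shows "indef_integral p r (\<lambda>x. F x + G x) (\<lambda>x. f x + g x)"
  unfolding indef_integral_def
proof (intro conjI allI impI)
  show "(\<lambda>x. f x + g x) absolutely_integrable_on {p..r}"
    using assms by (intro set_integral_add) (auto simp: indef_integral_def)
  fix x y assume "p \<le> x" "x \<le> y" "y \<le> r"
  then show "((\<lambda>x. f x + g x) has_integral (F y + G y - (F x + G x))) {x..y}"
    using has_integral_add[OF indef_integralD[OF assms(1), of x y] indef_integralD[OF assms(2), of x y]]
    by (simp add: algebra_simps)
qed

lemma indef_integral_vector_derivative:
  assumes "\<And>x. x \<in> {p..r} \<Longrightarrow> (F has_vector_derivative f x) (at x)" and c: "continuous_on {p..r} f"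
  shows "indef_integral p r F f"
  unfolding indef_integral_def
proof (intro conjI allI impI)
  show "f absolutely_integrable_on {p..r}" by (rule absolutely_integrable_continuous_real[OF c])
  fix x y assume xy: "p \<le> x" "x \<le> y" "y \<le> r"
  show "(f has_integral (F y - F x)) {x..y}"
    using xy
    by (intro fundamental_theorem_of_calculus) (auto intro: has_vector_derivative_at_within[OF assms(1)])
qed

lemma indef_integral_const: "indef_integral p r (\<lambda>x. C) (\<lambda>x. 0)"
  by (rule indef_integral_vector_derivative) auto

lemma indef_integral_cmult:
  assumes "indef_integral p r F f"
  shows "indef_integral p r (\<lambda>x. C * F x) (\<lambda>x. C * f x)"
  using indef_integral_mult[OF indef_integral_const[of p r C] assms] by simp

lemma indef_integral_cnj:
  assumes "indef_integral p r F f"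
  shows "indef_integral p r (\<lambda>x. cnj (F x)) (\<lambda>x. cnj (f x))"
  unfolding indef_integral_def
proof (intro conjI allI impI)
  have "f absolutely_integrable_on {p..r}" using assms by (simp add: indef_integral_def)
  from absolutely_integrable_linear[OF this bounded_linear_cnj]
  show "(\<lambda>x. cnj (f x)) absolutely_integrable_on {p..r}" by (simp add: o_def)
  fix x y assume "p \<le> x" "x \<le> y" "y \<le> r"
  then show "((\<lambda>x. cnj (f x)) has_integral (cnj (F y) - cnj (F x))) {x..y}"
    using has_integral_linear[OF indef_integralD[OF assms(1), of x y] bounded_linear_cnj]
    by (simp add: o_def)
qed

section \<open>A twice continuously differentiable cutoff function\<close>

lemma has_real_derivative_times_abs: "((\<lambda>x::real. x * \<bar>x\<bar>) has_real_derivative 2 * \<bar>x\<bar>) (at x)"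
proof (cases "x = 0")
  case True
  have "((\<lambda>h::real. \<bar>h\<bar>) \<longlongrightarrow> 0) (at 0)" by (auto intro!: tendsto_eq_intros)
  moreover have "eventually (\<lambda>h::real. \<bar>h\<bar> = ((0 + h) * \<bar>0 + h\<bar> - 0 * \<bar>0\<bar>) / h) (at 0)"
    by (auto simp: eventually_at_filter)
  ultimately have "((\<lambda>h::real. ((0 + h) * \<bar>0 + h\<bar> - 0 * \<bar>0\<bar>) / h) \<longlongrightarrow> 0) (at 0)"
    by (rule Lim_transform_eventually)
  then show ?thesis using True by (simp add: DERIV_def)
next
  case False
  then consider "x > 0" | "x < 0" by linarith
  then show ?thesis
  proof cases
    case 1
    have "((\<lambda>x::real. x * x) has_real_derivative 2 * x) (at x)"
      by (auto intro!: derivative_eq_intros)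
    then show ?thesis using 1
      by (subst abs_of_pos[OF 1]) (rule has_field_derivative_transform_within_open[of _ _ _ "{0<..}"], auto)
  next
    case 2
    have "((\<lambda>x::real. - (x * x)) has_real_derivative - 2 * x) (at x)"
      by (auto intro!: derivative_eq_intros)
    then show ?thesis using 2
      by (subst abs_of_neg[OF 2]) (rule has_field_derivative_transform_within_open[of _ _ _ "{..<0}"], auto)
  qed
qed

text \<open>The cutoff is N/(N + N') with N and N' the truncated cubes of r - x and x - p. Cubes
  suffice because the differential expression applied to a cutoff times a solution involves two
  derivatives of the cutoff. The functions \<open>h1\<close> and \<open>h2\<close> vanish at
  \<open>p\<close> and \<open>r\<close> themselves, so a cut off solution has the original value and
  derivative at \<open>p\<close>.\<close>

lemma smooth_cutoff:
  fixes p r :: real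
  assumes "p < r"
  obtains h h1 h2 :: "real \<Rightarrow> real" where
    "\<And>x. (h has_real_derivative h1 x) (at x)" "\<And>x. (h1 has_real_derivative h2 x) (at x)"
    "continuous_on UNIV h2"
    "\<And>x. x \<le> p \<Longrightarrow> h x = 1 \<and> h1 x = 0 \<and> h2 x = 0" "\<And>x. x \<ge> r \<Longrightarrow> h x = 0 \<and> h1 x = 0 \<and> h2 x = 0"
proof -
  text \<open>Up to constant factors \<open>K0\<close>, \<open>K1\<close>, \<open>K2\<close> are the powers 3, 2, 1 of the positive part.\<close>
  define K0 K1 K2 :: "real \<Rightarrow> real" where
    "K0 x = x ^ 3 + x * (x * \<bar>x\<bar>)" and "K1 x = 3 * x\<^sup>2 + 3 * (x * \<bar>x\<bar>)" and "K2 x = 6 * x + 6 * \<bar>x\<bar>" for x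
  have K0: "(K0 has_real_derivative K1 x) (at x)" for x
    unfolding K0_def[abs_def] K1_def
    by (rule derivative_eq_intros has_real_derivative_times_abs refl | simp add: power2_eq_square)+
  have K1: "(K1 has_real_derivative K2 x) (at x)" for x
    unfolding K1_def[abs_def] K2_def
    by (rule derivative_eq_intros has_real_derivative_times_abs refl | simp add: power2_eq_square)+
  have K2: "continuous_on UNIV K2" unfolding K2_def[abs_def] by (intro continuous_intros)
  have K0_nonneg: "K0 x \<ge> 0" for x
    by (cases "x \<ge> 0") (auto simp: K0_def power3_eq_cube)
  have K0_pos: "K0 x > 0" if "x > 0" for x
    using that by (auto simp: K0_def power3_eq_cube)
  have K_zero: "K0 x = 0 \<and> K1 x = 0 \<and> K2 x = 0" if "x \<le> 0" for x
    using that by (simp add: K0_def K1_def K2_def power3_eq_cube power2_eq_square)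
  define N0 N1 N2 where "N0 x = K0 (r - x)" and "N1 x = - K1 (r - x)" and "N2 x = K2 (r - x)" for x
  define D0 D1 D2 where "D0 x = K0 (r - x) + K0 (x - p)" and "D1 x = - K1 (r - x) + K1 (x - p)"
    and "D2 x = K2 (r - x) + K2 (x - p)" for x
  note [derivative_intros] = DERIV_chain2[OF K0] DERIV_chain2[OF K1]
  have N0: "(N0 has_real_derivative N1 x) (at x)" and N1: "(N1 has_real_derivative N2 x) (at x)"
    and D0: "(D0 has_real_derivative D1 x) (at x)" and D1: "(D1 has_real_derivative D2 x) (at x)" for x
    unfolding N0_def[abs_def] N1_def[abs_def] N2_def D0_def[abs_def] D1_def[abs_def] D2_def
    by (auto intro!: derivative_eq_intros)
  \<comment> \<open>Since \<open>p < r\<close>, every x lies to the left of \<open>r\<close> or to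
    the right of \<open>p\<close>, so one of the two summands is positive.\<close>
  have D0_nz: "D0 x \<noteq> 0" for x
    using K0_pos[of "r - x"] K0_pos[of "x - p"] K0_nonneg[of "r - x"] K0_nonneg[of "x - p"] assms
    unfolding D0_def by (cases "x < r") auto
  define h h1 h2 where "h x = N0 x / D0 x" and "h1 x = (N1 x * D0 x - N0 x * D1 x) / (D0 x * D0 x)"
    and "h2 x = ((N2 x * D0 x - N0 x * D2 x) * (D0 x * D0 x) - (N1 x * D0 x - N0 x * D1 x) * (D1 x * D0 x + D1 x * D0 x))
          / ((D0 x * D0 x) * (D0 x * D0 x))" for x
  show thesis
  proof (rule that[of h h1 h2])
    show "(h has_real_derivative h1 x) (at x)" for x
      unfolding h_def[abs_def] h1_def by (rule DERIV_divide N0 D0 D0_nz)+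
    show "(h1 has_real_derivative h2 x) (at x)" for x
      unfolding h1_def[abs_def] h2_def
      by (rule DERIV_cong[OF DERIV_divide[OF DERIV_diff[OF DERIV_mult[OF N1 D0] DERIV_mult[OF N0 D1]] DERIV_mult[OF D0 D0]]])
         (use D0_nz in \<open>auto simp: algebra_simps\<close>)
    have c: "continuous_on UNIV N0" "continuous_on UNIV N1" "continuous_on UNIV D0" "continuous_on UNIV D1"
      by (rule DERIV_continuous_on, rule N0 N1 D0 D1)+
    have c2: "continuous_on UNIV N2" "continuous_on UNIV D2"
      unfolding N2_def[abs_def] D2_def[abs_def]
      by (intro continuous_intros continuous_on_compose2[OF K2]; simp)+
    show "continuous_on UNIV h2" unfolding h2_def[abs_def]
      by (intro continuous_intros c c2) (simp add: D0_nz)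
    show "h x = 1 \<and> h1 x = 0 \<and> h2 x = 0" if "x \<le> p" for x
      using K_zero[of "x - p"] D0_nz[of x] that unfolding h_def h1_def h2_def N0_def N1_def N2_def D0_def D1_def D2_def
      by simp
    show "h x = 0 \<and> h1 x = 0 \<and> h2 x = 0" if "x \<ge> r" for x
      using K_zero[of "r - x"] that unfolding h_def h1_def h2_def N0_def N1_def N2_def
      by simp
  qed
qed

subsection \<open>Solutions and cutoffs\<close>

lemma einterval_Icc_subset:
  assumes "p \<in> einterval a b" "r \<in> einterval a b"
  shows "{p..r} \<subseteq> einterval a b"
  using assms by (auto simp: einterval_def) (meson ereal_less_eq(3) less_le_trans le_less_trans)+

lemma tau_rel_vderiv:
  assumes "tau_rel a b q f g" "x \<in> einterval a b"
  shows "(f has_vector_derivative vderiv f x) (at x)"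
  using assms by (simp add: tau_rel_def vector_derivative_works)

text \<open>The witness \<open>f2\<close> for the second derivative agrees with q f - g off a null
  set, which the integral does not see. From here on the explicit expression replaces the unnamed
  witness.\<close>

lemma tau_rel_indef_integral_vderiv:
  assumes f: "tau_rel a b q f g" and pr: "p \<in> einterval a b" "r \<in> einterval a b"
  shows "indef_integral p r (vderiv f) (\<lambda>x. of_real (q x) * f x - g x)"
proof -
  note sub = einterval_Icc_subset[OF pr]
  obtain f2 where f2: "L1_loc a b f2"
    "\<And>x y. x\<in>einterval a b \<Longrightarrow> y\<in>einterval a b \<Longrightarrow> x \<le> y \<Longrightarrow>
           vderiv f y - vderiv f x = set_lebesgue_integral lebesgue {x..y} f2"
    and ae: "AE x\<in>einterval a b in lebesgue. - f2 x + of_real (q x) * f x = g x"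
    using f unfolding tau_rel_def by blast
  obtain N where N: "N \<in> null_sets lebesgue" "{x. \<not> (x \<in> einterval a b \<longrightarrow> - f2 x + of_real (q x) * f x = g x)} \<subseteq> N"
    using ae by (auto simp: eventually_ae_filter)
  have negl: "negligible N" using N by (simp add: negligible_iff_null_sets)
  have eq: "of_real (q x) * f x - g x = f2 x" if "x \<in> {p..r} - N" for x
    using N(2) that sub by (auto simp: algebra_simps)
  have ai: "f2 absolutely_integrable_on {p..r}" using f2(1) sub unfolding L1_loc_def by blast
  show ?thesis unfolding indef_integral_def
  proof (intro conjI allI impI)
    show "(\<lambda>x. of_real (q x) * f x - g x) absolutely_integrable_on {p..r}"
      by (rule absolutely_integrable_spike[OF ai negl eq])
    fix x y assume xy: "p \<le> x" "x \<le> y" "y \<le> r"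
    have ai': "f2 absolutely_integrable_on {x..y}"
      using xy by (intro absolutely_integrable_on_subinterval[OF ai]) auto
    have "x \<in> einterval a b" "y \<in> einterval a b" using sub xy by auto
    from f2(2)[OF this xy(2)] have "vderiv f y - vderiv f x = integral {x..y} f2"
      unfolding set_lebesgue_integral_eq_integral(2)[OF ai'] .
    then have "(f2 has_integral (vderiv f y - vderiv f x)) {x..y}"
      using ai' by (simp add: absolutely_integrable_on_def integrable_integral)
    then show "((\<lambda>x. of_real (q x) * f x - g x) has_integral (vderiv f y - vderiv f x)) {x..y}"
      using xy eq by (elim has_integral_spike[OF negl, rotated]) auto
  qed
qed

lemma continuous_on_einterval_local:
  fixes f :: "real \<Rightarrow> complex"
  assumes "\<And>p r. p \<in> einterval a b \<Longrightarrow> r \<in> einterval a b \<Longrightarrow> continuous_on {p..r} f"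
  shows "continuous_on (einterval a b) f"
proof -
  have "isCont f x" if x: "x \<in> einterval a b" for x
  proof -
    obtain e where e: "e > 0" "cball x e \<subseteq> einterval a b"
      using open_contains_cball[of "einterval a b"] x by (auto simp: open_einterval)
    then have "x - e \<in> einterval a b" "x + e \<in> einterval a b" by (auto simp: subset_eq dist_real_def)
    from assms[OF this] show ?thesis using e by (intro continuous_on_interior) auto
  qed
  then show ?thesis by (simp add: continuous_at_imp_continuous_on)
qed

lemma tau_rel_continuous:
  assumes f: "tau_rel a b q f g"
  shows "continuous_on (einterval a b) f" "continuous_on (einterval a b) (vderiv f)"
proof -
  show "continuous_on (einterval a b) f"
    using f by (auto simp: tau_rel_def intro!: differentiable_imp_continuous_within continuous_at_imp_continuous_on)
  show "continuous_on (einterval a b) (vderiv f)"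
    by (rule continuous_on_einterval_local) (blast intro: indef_integral_continuous tau_rel_indef_integral_vderiv[OF f])
qed

lemma tau_rel_indef_integral:
  assumes f: "tau_rel a b q f g" and pr: "p \<in> einterval a b" "r \<in> einterval a b"
  shows "indef_integral p r f (vderiv f)"
  using einterval_Icc_subset[OF pr] tau_rel_vderiv[OF f] continuous_on_subset[OF tau_rel_continuous(2)[OF f]]
  by (intro indef_integral_vector_derivative) auto

lemma tau_relI:
  assumes d: "\<And>x. x \<in> einterval a b \<Longrightarrow> (f has_vector_derivative f1 x) (at x)"
    and f2: "\<And>p r. p \<in> einterval a b \<Longrightarrow> r \<in> einterval a b \<Longrightarrow> indef_integral p r f1 f2"
    and eq: "\<And>x. x \<in> einterval a b \<Longrightarrow> - f2 x + of_real (q x) * f x = g x"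
  shows "tau_rel a b q f g"
  unfolding tau_rel_def
proof (intro conjI ballI exI[of _ f2] impI)
  show "f differentiable at x" if "x \<in> einterval a b" for x
    using d[OF that] by (auto intro: differentiableI_vector)
  show "AE x\<in>einterval a b in lebesgue. - f2 x + of_real (q x) * f x = g x" using eq by auto
  show "L1_loc a b f2" unfolding L1_loc_def
  proof (intro allI impI)
    fix x y assume sub: "{x..y} \<subseteq> einterval a b"
    show "set_integrable lebesgue {x..y} f2"
    proof (cases "x \<le> y")
      case True
      then have "x \<in> einterval a b" "y \<in> einterval a b" using sub by auto
      from f2[OF this] show ?thesis by (simp add: indef_integral_def)
    qed (simp add: set_integrable_def)
  qed
  fix x y assume xy: "x \<in> einterval a b" "y \<in> einterval a b" "x \<le> y"
  have i: "indef_integral x y f1 f2" using f2 xy by blast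
  have "vderiv f x = f1 x" "vderiv f y = f1 y"
    using d xy by (auto intro: vector_derivative_at)
  moreover have "f1 y - f1 x = integral {x..y} f2"
    using indef_integralD[OF i, of x y] xy by (simp add: integral_unique)
  ultimately show "vderiv f y - vderiv f x = set_lebesgue_integral lebesgue {x..y} f2"
    using set_lebesgue_integral_eq_integral(2)[of "{x..y}" f2] i by (simp add: indef_integral_def)
qed

lemma solution_cmult_add:
  assumes u: "solution a b q z u" and v: "solution a b q z v"
  shows "solution a b q z (\<lambda>x. u x + C * v x)"
  unfolding solution_def
proof (rule tau_relI)
  note u = u[unfolded solution_def] and v = v[unfolded solution_def]
  show "((\<lambda>x. u x + C * v x) has_vector_derivative vderiv u x + C * vderiv v x) (at x)"
    if "x \<in> einterval a b" for x
    by (intro derivative_intros tau_rel_vderiv[OF u that] has_vector_derivative_mult_right tau_rel_vderiv[OF v that])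
  show "indef_integral p r (\<lambda>x. vderiv u x + C * vderiv v x)
      (\<lambda>x. (of_real (q x) * u x - z * u x) + C * (of_real (q x) * v x - z * v x))"
    if "p \<in> einterval a b" "r \<in> einterval a b" for p r
    using that by (intro indef_integral_add indef_integral_cmult
        tau_rel_indef_integral_vderiv[OF u] tau_rel_indef_integral_vderiv[OF v])
qed (simp add: algebra_simps)

subsection \<open>Boundary behaviour from self-adjointness\<close>

lemma einterval_split:
  assumes "p \<in> einterval a b" "r \<in> einterval a b" "p \<le> r"
  shows "einterval a b = (einterval a p \<union> {p..r}) \<union> einterval r b"
proof -
  have "ereal x < b" if "x \<le> r" for x
    using that assms(2) by (auto simp: einterval_def intro: le_less_trans[of _ "ereal r"])
  moreover have "a < ereal x" if "p \<le> x" for x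
    using that assms(1) by (auto simp: einterval_def intro: less_le_trans[of _ "ereal p"])
  ultimately show ?thesis using assms(3) by (auto simp: einterval_def not_le)
qed

text \<open>Continuity provides measurability on the whole interval and integrability on the compact
  middle piece, so only the two ends carry assumptions.\<close>

lemma L2_glue:
  assumes c: "continuous_on (einterval a b) f"
    and pr: "p \<in> einterval a b" "r \<in> einterval a b" "p \<le> r"
    and l: "f \<in> L2 a (ereal p)" and rr: "f \<in> L2 (ereal r) b"
  shows "f \<in> L2 a b"
proof -
  note split = einterval_split[OF pr]
  have "continuous_on {p..r} (\<lambda>x. (cmod (f x))\<^sup>2)"
    using continuous_on_subset[OF c einterval_Icc_subset[OF pr(1,2)]] by (intro continuous_intros)
  then have "set_integrable lebesgue {p..r} (\<lambda>x. (cmod (f x))\<^sup>2)"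
    by (rule absolutely_integrable_continuous_real)
  then have "set_integrable lebesgue (einterval a b) (\<lambda>x. (cmod (f x))\<^sup>2)"
    unfolding split using l rr by (intro set_integrable_Un) (auto simp: L2_def)
  moreover have "set_borel_measurable lebesgue (einterval a b) f"
    using borel_measurable_continuous_on_indicator[OF _ c]
    unfolding set_borel_measurable_def by (simp add: measurable_completion)
  ultimately show ?thesis by (simp add: L2_def)
qed

lemma L2_cong:
  assumes "f \<in> L2 a b" "\<And>x. x \<in> einterval a b \<Longrightarrow> g x = f x"
  shows "g \<in> L2 a b"
proof -
  have "set_borel_measurable lebesgue (einterval a b) g = set_borel_measurable lebesgue (einterval a b) f"
    unfolding set_borel_measurable_def using assms(2)
    by (intro arg_cong[where f="\<lambda>h. h \<in> borel_measurable lebesgue"] ext) (auto simp: indicator_def)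
  moreover have "set_integrable lebesgue (einterval a b) (\<lambda>x. (cmod (g x))\<^sup>2)
      = set_integrable lebesgue (einterval a b) (\<lambda>x. (cmod (f x))\<^sup>2)"
    using assms(2) by (intro set_integrable_cong) auto
  ultimately show ?thesis using assms(1) by (simp add: L2_def)
qed

lemma L2_zero: "(\<lambda>x. 0) \<in> L2 a b"
  by (simp add: L2_def set_borel_measurable_def set_integrable_def)

lemma L2_cmult:
  assumes "f \<in> L2 a b" shows "(\<lambda>x. C * f x) \<in> L2 a b"
proof -
  have "(\<lambda>x. C * (indicator (einterval a b) x *\<^sub>R f x)) \<in> borel_measurable lebesgue"
    using assms unfolding L2_def set_borel_measurable_def by (intro borel_measurable_times) auto
  moreover have "set_integrable lebesgue (einterval a b) (\<lambda>x. (cmod C)\<^sup>2 * (cmod (f x))\<^sup>2)"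
    using assms by (intro set_integrable_mult_right) (simp add: L2_def)
  ultimately show ?thesis
    by (simp add: L2_def set_borel_measurable_def norm_mult power_mult_distrib)
qed

lemma L2_subset:
  assumes f: "f \<in> L2 a b" and "a \<le> a'" "b' \<le> b"
  shows "f \<in> L2 a' b'"
proof -
  have sub: "einterval a' b' \<subseteq> einterval a b"
    using assms(2,3) unfolding einterval_def by (blast intro: le_less_trans less_le_trans)
  have "set_borel_measurable lebesgue (einterval a' b') f"
    by (rule set_borel_measurable_subset[of _ "einterval a b"]) (use f sub in \<open>auto simp: L2_def\<close>)
  moreover have "set_integrable lebesgue (einterval a' b') (\<lambda>x. (cmod (f x))\<^sup>2)"
    by (rule set_integrable_subset[of _ "einterval a b"]) (use f sub in \<open>auto simp: L2_def\<close>)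
  ultimately show ?thesis by (simp add: L2_def)
qed

lemma L2_continuous:
  assumes "continuous_on {p..r} f"
  shows "f \<in> L2 (ereal p) (ereal r)"
proof -
  have sub: "einterval (ereal p) (ereal r) \<subseteq> {p..r}" by (auto simp: einterval_def)
  have "set_borel_measurable lebesgue {p..r} f"
    using borel_measurable_continuous_on_indicator[OF _ assms]
    unfolding set_borel_measurable_def by (simp add: measurable_completion)
  then have "set_borel_measurable lebesgue (einterval (ereal p) (ereal r)) f"
    by (rule set_borel_measurable_subset[of _ "{p..r}"]) (use sub in auto)
  moreover have "set_integrable lebesgue {p..r} (\<lambda>x. (cmod (f x))\<^sup>2)"
    using assms by (intro absolutely_integrable_continuous_real continuous_intros)
  then have "set_integrable lebesgue (einterval (ereal p) (ereal r)) (\<lambda>x. (cmod (f x))\<^sup>2)"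
    by (rule set_integrable_subset[of _ "{p..r}"]) (use sub in auto)
  ultimately show ?thesis by (simp add: L2_def)
qed

text \<open>Being square integrable near the endpoint refers to some unspecified point; continuity
  allows any interior point in its place.\<close>

lemma L2_near_left_imp_L2:
  assumes u: "L2_near_left a b u" and c: "continuous_on (einterval a b) u" and p: "p \<in> einterval a b"
  shows "u \<in> L2 a (ereal p)"
proof -
  obtain y where y: "y \<in> einterval a b" "u \<in> L2 a (ereal y)" using u by (auto simp: L2_near_left_def)
  show ?thesis
  proof (cases "p \<le> y")
    case True
    with y(2) show ?thesis by (auto intro: L2_subset)
  next
    case False
    \<comment> \<open>\<open>L2_glue\<close> wants both gluing points inside (a,p), so
      \<open>p\<close> itself cannot serve as the right one.\<close>
    define m where "m = (y + p) / 2"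
    have m: "y < m" "m < p" using False by (auto simp: m_def)
    have mp: "m \<in> einterval a b" using einterval_Icc_subset[OF y(1) p] m by auto
    show ?thesis
    proof (rule L2_glue[where p=y and r=m])
      show "continuous_on (einterval a p) u"
        using einterval_split[OF p p order_refl] by (intro continuous_on_subset[OF c]) auto
      show "y \<in> einterval a p" "m \<in> einterval a p" "y \<le> m" using m y(1) mp by (auto simp: einterval_def)
      show "u \<in> L2 (ereal m) (ereal p)"
        by (intro L2_continuous continuous_on_subset[OF c einterval_Icc_subset] mp p)
    qed (rule y(2))
  qed
qed

lemma L2_near_right_imp_L2:
  assumes u: "L2_near_right a b u" and c: "continuous_on (einterval a b) u" and p: "p \<in> einterval a b"
  shows "u \<in> L2 (ereal p) b"
proof -
  obtain y where y: "y \<in> einterval a b" "u \<in> L2 (ereal y) b" using u by (auto simp: L2_near_right_def)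
  show ?thesis
  proof (cases "p \<ge> y")
    case True
    with y(2) show ?thesis by (auto intro: L2_subset)
  next
    case False
    define m where "m = (y + p) / 2"
    have m: "p < m" "m < y" using False by (auto simp: m_def)
    have mp: "m \<in> einterval a b" using einterval_Icc_subset[OF p y(1)] m by auto
    show ?thesis
    proof (rule L2_glue[where p=m and r=y])
      show "continuous_on (einterval p b) u"
        using einterval_split[OF p p order_refl] by (intro continuous_on_subset[OF c]) auto
      show "y \<in> einterval p b" "m \<in> einterval p b" "m \<le> y" using m y(1) mp by (auto simp: einterval_def)
      show "u \<in> L2 (ereal p) (ereal m)"
        by (intro L2_continuous continuous_on_subset[OF c einterval_Icc_subset] mp p)
    qed (rule y(2))
  qed
qed

text \<open>Lagrange's identity for f against itself: the derivative of cnj f f' is |f'|^2 + q |f|^2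
  - cnj f g, and the first two terms are real. On [p,r] the imaginary part of the integral of cnj f
  g is therefore a pure boundary term, while on the two ends g = z f contributes Im z times the mass
  of f.\<close>

lemma Im_integral_L2_inner:
  assumes \<tau>: "tau_rel a b q f g" and f: "f \<in> L2 a b"
    and pr: "p \<in> einterval a b" "r \<in> einterval a b" "p \<le> r"
    and cg: "continuous_on {p..r} g"
    and gl: "\<And>x. x \<in> einterval a p \<Longrightarrow> g x = z * f x"
    and gr: "\<And>x. x \<in> einterval r b \<Longrightarrow> g x = z * f x"
  shows "Im (L2_inner a b f g) =
     Im z * (LINT x:einterval a p|lebesgue. (cmod (f x))\<^sup>2) + Im z * (LINT x:einterval r b|lebesgue. (cmod (f x))\<^sup>2)
     + Im (cnj (f p) * vderiv f p) - Im (cnj (f r) * vderiv f r)"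
proof -
  have cf: "continuous_on {p..r} f"
    by (intro continuous_on_subset[OF tau_rel_continuous(1)[OF \<tau>] einterval_Icc_subset] pr)
  have ends: "set_integrable lebesgue S (\<lambda>x. cnj (f x) * g x)"
    "(LINT x:S|lebesgue. cnj (f x) * g x) = z * of_real (LINT x:S|lebesgue. (cmod (f x))\<^sup>2)"
    if S: "S \<in> sets lebesgue" "S \<subseteq> einterval a b" "\<And>x. x \<in> S \<Longrightarrow> g x = z * f x" for S
  proof -
    have eq: "cnj (f x) * g x = z * of_real ((cmod (f x))\<^sup>2)" if "x \<in> S" for x
      using S(3)[OF that] by (simp add: complex_norm_square[unfolded of_real_power] mult_ac)
    have i: "set_integrable lebesgue S (\<lambda>x. (cmod (f x))\<^sup>2)"
      by (rule set_integrable_subset[of _ "einterval a b"]) (use f S in \<open>auto simp: L2_def\<close>)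
    have i2: "set_integrable lebesgue S (\<lambda>x. z * of_real ((cmod (f x))\<^sup>2))"
      using absolutely_integrable_linear[OF i, of of_real] bounded_linear_of_real
      by (intro set_integrable_mult_right) (auto simp: o_def)
    then show "set_integrable lebesgue S (\<lambda>x. cnj (f x) * g x)"
      using eq by (subst set_integrable_cong[OF refl refl, of S _ "\<lambda>x. z * of_real ((cmod (f x))\<^sup>2)"]) auto
    have "(LINT x:S|lebesgue. cnj (f x) * g x) = (LINT x:S|lebesgue. z * of_real ((cmod (f x))\<^sup>2))"
      using eq by (intro set_lebesgue_integral_cong S) auto
    also have "\<dots> = z * of_real (LINT x:S|lebesgue. (cmod (f x))\<^sup>2)"
      unfolding set_integral_mult_right set_integral_complex_of_real ..
    finally show "(LINT x:S|lebesgue. cnj (f x) * g x) = z * of_real (LINT x:S|lebesgue. (cmod (f x))\<^sup>2)" .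
  qed
  have subs: "einterval a p \<subseteq> einterval a b" "einterval r b \<subseteq> einterval a b"
    using einterval_split[OF pr] by auto
  note L = ends[OF _ subs(1) gl, simplified] and R = ends[OF _ subs(2) gr, simplified]
  have M: "set_integrable lebesgue {p..r} (\<lambda>x. cnj (f x) * g x)"
    using cf cg by (intro absolutely_integrable_continuous_real continuous_intros)
  have split: "L2_inner a b f g = (LINT x:einterval a p|lebesgue. cnj (f x) * g x)
     + (LINT x:{p..r}|lebesgue. cnj (f x) * g x) + (LINT x:einterval r b|lebesgue. cnj (f x) * g x)"
  proof -
    have "L2_inner a b f g = (LINT x:(einterval a p \<union> {p..r}) \<union> einterval r b|lebesgue. cnj (f x) * g x)"
      unfolding L2_inner_def by (subst einterval_split[OF pr]) simp
    also have "\<dots> = (LINT x:einterval a p \<union> {p..r}|lebesgue. cnj (f x) * g x) + (LINT x:einterval r b|lebesgue. cnj (f x) * g x)"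
      using pr(3) by (intro set_integral_Un set_integrable_Un L(1) M R(1)) (auto simp: einterval_def)
    also have "(LINT x:einterval a p \<union> {p..r}|lebesgue. cnj (f x) * g x) =
        (LINT x:einterval a p|lebesgue. cnj (f x) * g x) + (LINT x:{p..r}|lebesgue. cnj (f x) * g x)"
      using pr(3) by (intro set_integral_Un L(1) M) (auto simp: einterval_def)
    finally show ?thesis .
  qed
  define I where "I = (LINT x:{p..r}|lebesgue. cnj (f x) * g x)"
  have I: "((\<lambda>x. cnj (f x) * g x) has_integral I) {p..r}"
    unfolding I_def using M by (rule has_integral_set_lebesgue)
  have "indef_integral p r (\<lambda>x. cnj (f x) * vderiv f x)
     (\<lambda>x. cnj (vderiv f x) * vderiv f x + cnj (f x) * (of_real (q x) * f x - g x))"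
    by (intro indef_integral_mult indef_integral_cnj tau_rel_indef_integral[OF \<tau>] tau_rel_indef_integral_vderiv[OF \<tau>] pr)
  from has_integral_add[OF indef_integralD[OF this order_refl pr(3) order_refl] I]
  have "((\<lambda>x. cnj (vderiv f x) * vderiv f x + of_real (q x) * (cnj (f x) * f x)) has_integral
     (cnj (f r) * vderiv f r - cnj (f p) * vderiv f p + I)) {p..r}"
    by (simp add: algebra_simps)
  from has_integral_linear[OF this bounded_linear_Im]
  have "((\<lambda>x. 0) has_integral Im (cnj (f r) * vderiv f r - cnj (f p) * vderiv f p + I)) {p..r}"
    by (simp add: o_def algebra_simps)
  then have "Im (cnj (f r) * vderiv f r - cnj (f p) * vderiv f p + I) = 0"
    using has_integral_unique has_integral_0 by blast
  then have "Im I = Im (cnj (f p) * vderiv f p) - Im (cnj (f r) * vderiv f r)" by simp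
  moreover have "Im (L2_inner a b f g) =
     Im z * (LINT x:einterval a p|lebesgue. (cmod (f x))\<^sup>2) + Im z * (LINT x:einterval r b|lebesgue. (cmod (f x))\<^sup>2) + Im I"
    unfolding split L(2) R(2) I_def by simp
  ultimately show ?thesis by simp
qed

text \<open>A pair in the graph also lies in the graph of the adjoint and may be tested against
  itself, so the inner product equals its own conjugate.\<close>

lemma self_adjoint_imp_Im_L2_inner:
  assumes "self_adjoint a b T" "(f, g) \<in> T"
  shows "Im (L2_inner a b f g) = 0"
proof -
  have "f \<in> L2 a b" "g \<in> L2 a b" using assms by (auto simp: self_adjoint_def)
  then have "\<forall>(f', k)\<in>T. L2_inner a b k f = L2_inner a b f' g"
    using assms unfolding self_adjoint_def by blast
  then have "L2_inner a b g f = L2_inner a b f g" using assms(2) by auto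
  moreover have "L2_inner a b g f = cnj (L2_inner a b f g)"
    unfolding L2_inner_def set_lebesgue_integral_def Bochner_Integration.integral_cnj[symmetric]
    by (intro Bochner_Integration.integral_cong) (simp_all add: mult.commute)
  ultimately show ?thesis by (simp add: complex_eq_iff)
qed

text \<open>The function \<open>g\<close> is the differential expression applied to h u, namely h z
  u - 2 h' u' - h'' u. The potential has cancelled, which makes \<open>g\<close> continuous and
  hence square integrable on compact subintervals although \<open>q\<close> is only locally
  integrable.\<close>

lemma tau_rel_cutoff:
  fixes h h1 h2 :: "real \<Rightarrow> real"
  assumes u: "solution a b q z u"
    and h: "\<And>x. (h has_real_derivative h1 x) (at x)"
    and h1: "\<And>x. (h1 has_real_derivative h2 x) (at x)" and h2: "continuous_on UNIV h2"
  defines "f \<equiv> \<lambda>x. of_real (h x) * u x"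
  defines "g \<equiv> \<lambda>x. of_real (h x) * (z * u x) - 2 * of_real (h1 x) * vderiv u x - of_real (h2 x) * u x"
  shows "tau_rel a b q f g"
    and "continuous_on (einterval a b) g"
    and "\<And>x. x \<in> einterval a b \<Longrightarrow> vderiv f x = of_real (h1 x) * u x + of_real (h x) * vderiv u x"
proof -
  note \<tau> = u[unfolded solution_def]
  have hc: "((\<lambda>x. of_real (h x) :: complex) has_vector_derivative of_real (h1 x)) (at x)" for x
    using h by (intro has_vector_derivative_of_real) (simp add: has_real_derivative_iff_has_vector_derivative)
  have h1c: "((\<lambda>x. of_real (h1 x) :: complex) has_vector_derivative of_real (h2 x)) (at x)" for x
    using h1 by (intro has_vector_derivative_of_real) (simp add: has_real_derivative_iff_has_vector_derivative)
  have d: "(f has_vector_derivative (of_real (h1 x) * u x + of_real (h x) * vderiv u x)) (at x)"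
    if "x \<in> einterval a b" for x
    using has_vector_derivative_mult[OF hc tau_rel_vderiv[OF \<tau> that]] unfolding f_def
    by (simp add: algebra_simps)
  then show "vderiv f x = of_real (h1 x) * u x + of_real (h x) * vderiv u x" if "x \<in> einterval a b" for x
    using that by (intro vector_derivative_at)
  have ch: "continuous_on S (\<lambda>x. of_real (h x) :: complex)" "continuous_on S (\<lambda>x. of_real (h1 x) :: complex)" for S
    by (rule continuous_at_imp_continuous_on,
        use has_vector_derivative_continuous[OF hc] has_vector_derivative_continuous[OF h1c] in blast)+
  have ch2: "continuous_on S (\<lambda>x. of_real (h2 x) :: complex)" for S
    using continuous_on_subset[OF h2] by (intro continuous_intros) auto
  have ih: "indef_integral p r (\<lambda>x. of_real (h x)) (\<lambda>x. of_real (h1 x))"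
    and ih1: "indef_integral p r (\<lambda>x. of_real (h1 x)) (\<lambda>x. of_real (h2 x))" for p r
    by (intro indef_integral_vector_derivative hc h1c ch ch2)+
  show "tau_rel a b q f g"
  proof (rule tau_relI[OF d])
    fix p r assume pr: "p \<in> einterval a b" "r \<in> einterval a b"
    show "indef_integral p r (\<lambda>x. of_real (h1 x) * u x + of_real (h x) * vderiv u x)
      (\<lambda>x. (of_real (h2 x) * u x + of_real (h1 x) * vderiv u x) +
           (of_real (h1 x) * vderiv u x + of_real (h x) * (of_real (q x) * u x - z * u x)))"
      by (intro indef_integral_add indef_integral_mult ih ih1 tau_rel_indef_integral[OF \<tau>]
          tau_rel_indef_integral_vderiv[OF \<tau>] pr)
  qed (simp_all add: f_def g_def algebra_simps)
  show "continuous_on (einterval a b) g"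
    unfolding g_def by (intro continuous_intros ch ch2 tau_rel_continuous[OF \<tau>])
qed

lemma eventually_left_end:
  assumes "p \<in> einterval a b"
  shows "eventually (\<lambda>x. x \<in> einterval a p) (left_end a)"
proof -
  have "eventually (\<lambda>e. a < e \<and> e < ereal p) (at_right a)"
    using assms by (auto simp: eventually_at_right[of a "ereal p"] einterval_def)
  then show ?thesis unfolding left_end_def eventually_filtermap
    by eventually_elim (auto simp: einterval_def ereal_real)
qed

lemma eventually_right_end:
  assumes "p \<in> einterval a b"
  shows "eventually (\<lambda>x. x \<in> einterval p b) (right_end b)"
proof -
  have "eventually (\<lambda>e. ereal p < e \<and> e < b) (at_left b)"
    using assms by (auto simp: eventually_at_left[of "ereal p" b] einterval_def)
  then show ?thesis unfolding right_end_def eventually_filtermap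
    by eventually_elim (auto simp: einterval_def ereal_real)
qed

lemma einterval_dense_right:
  assumes "p \<in> einterval a b"
  obtains r where "r \<in> einterval a b" "p < r"
  using ereal_dense2[of "ereal p" b] assms
  by (auto simp: einterval_def) (meson ereal_less(2) less_trans less_ereal.simps(1))

lemma einterval_dense_left:
  assumes "p \<in> einterval a b"
  obtains r where "r \<in> einterval a b" "r < p"
  using ereal_dense2[of a "ereal p"] assms
  by (auto simp: einterval_def) (meson ereal_less(2) less_trans less_ereal.simps(1))

lemma set_lebesgue_integral_zero_fun:
  assumes "\<And>x. x \<in> S \<Longrightarrow> f x = 0"
  shows "(LINT x:S|M. f x) = (0::real)"
  unfolding set_lebesgue_integral_def using assms
  by (intro integral_eq_zero_AE AE_I2) (simp add: indicator_def)

text \<open>Cutting u off to the right of \<open>p\<close> gives an element of the domain of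
  \<open>H\<close> that coincides with u near \<open>a\<close>. Its quadratic form is real; the tail
  and the boundary term at \<open>r\<close> vanish, and what remains balances the mass on (a,p)
  against the boundary term at \<open>p\<close>.\<close>

lemma Im_cnj_vderiv_left:
  assumes H: "separated_realization a b q v w H" and u: "solution a b q z u"
    and dom: "in_domain_near_left a b q v u" and p: "p \<in> einterval a b"
  shows "Im (cnj (u p) * vderiv u p) = - Im z * (LINT x:einterval a p|lebesgue. (cmod (u x))\<^sup>2)"
proof -
  note \<tau> = u[unfolded solution_def]
  obtain r where r: "r \<in> einterval a b" "p < r" using einterval_dense_right[OF p] .
  obtain h h1 h2 where h: "\<And>x. (h has_real_derivative h1 x) (at x)" "\<And>x. (h1 has_real_derivative h2 x) (at x)"
    "continuous_on UNIV h2" and h_l: "\<And>x. x \<le> p \<Longrightarrow> h x = 1 \<and> h1 x = 0 \<and> h2 x = 0"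
    and h_r: "\<And>x. x \<ge> r \<Longrightarrow> h x = 0 \<and> h1 x = 0 \<and> h2 x = 0"
    using smooth_cutoff[OF r(2)] by blast
  define f where "f = (\<lambda>x. of_real (h x) * u x)"
  define g where "g = (\<lambda>x. of_real (h x) * (z * u x) - 2 * of_real (h1 x) * vderiv u x - of_real (h2 x) * u x)"
  note fg = tau_rel_cutoff[OF u h, folded f_def g_def]
  have fl: "f x = u x" "g x = z * u x" if "x \<le> p" for x using h_l[OF that] by (simp_all add: f_def g_def)
  have fr: "f x = 0" "g x = 0" if "x \<ge> r" for x using h_r[OF that] by (simp_all add: f_def g_def)
  have f'l: "vderiv f x = vderiv u x" if "x \<in> einterval a b" "x \<le> p" for x
    using fg(3)[OF that(1)] h_l[OF that(2)] by simp
  have f'r: "vderiv f x = 0" if "x \<in> einterval a b" "x \<ge> r" for x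
    using fg(3)[OF that(1)] h_r[OF that(2)] by simp
  have uL2: "u \<in> L2 a (ereal p)"
    using dom p tau_rel_continuous(1)[OF \<tau>] by (intro L2_near_left_imp_L2) (auto simp: in_domain_near_left_def)
  have fL2: "f \<in> L2 a b"
    using L2_cong[OF uL2, of f] L2_cong[OF L2_zero, of "ereal r" b f] fl fr p r
    by (intro L2_glue[OF tau_rel_continuous(1)[OF fg(1)] p r(1)]) (auto simp: einterval_def)
  have gL2: "g \<in> L2 a b"
    using L2_cong[OF L2_cmult[OF uL2, of z], of g] L2_cong[OF L2_zero, of "ereal r" b g] fl fr p r
    by (intro L2_glue[OF fg(2) p r(1)]) (auto simp: einterval_def)
  have "bc_left a b q v f"
    unfolding bc_left_def
  proof
    assume "limit_circle_left a b q"
    then have "(wronskian v u \<longlongrightarrow> 0) (left_end a)" using dom by (simp add: in_domain_near_left_def bc_left_def)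
    moreover have "eventually (\<lambda>x. wronskian v u x = wronskian v f x) (left_end a)"
      using eventually_left_end[OF p]
    proof eventually_elim
      case (elim x)
      then have "x \<le> p" "x \<in> einterval a b" using einterval_split[OF p p order_refl] by (auto simp: einterval_def)
      then show ?case using fl f'l by (simp add: wronskian_def)
    qed
    ultimately show "(wronskian v f \<longlongrightarrow> 0) (left_end a)" by (rule Lim_transform_eventually)
  qed
  \<comment> \<open>The cut off function is zero beyond \<open>r\<close>, so it satisfies the
    condition at \<open>b\<close> for every \<open>w\<close>.\<close>
  moreover have "bc_right a b q w f"
    unfolding bc_right_def
  proof
    have "eventually (\<lambda>x. 0 = wronskian w f x) (right_end b)"
      using eventually_right_end[OF r(1)]
    proof eventually_elim
      case (elim x)
      then have "x \<ge> r" "x \<in> einterval a b" using einterval_split[OF r(1) r(1) order_refl] by (auto simp: einterval_def)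
      then show ?case using fr f'r by (simp add: wronskian_def)
    qed
    then show "(wronskian w f \<longlongrightarrow> 0) (right_end b)" by (rule Lim_transform_eventually[OF tendsto_const])
  qed
  ultimately have "(f, g) \<in> H" using H fL2 gL2 fg(1) by (simp add: separated_realization_def max_op_def)
  then have "Im (L2_inner a b f g) = 0"
    using H self_adjoint_imp_Im_L2_inner by (auto simp: separated_realization_def)
  moreover have "continuous_on {p..r} g"
    by (rule continuous_on_subset[OF fg(2) einterval_Icc_subset[OF p r(1)]])
  moreover have "(LINT x:einterval r b|lebesgue. (cmod (f x))\<^sup>2) = 0"
    by (rule set_lebesgue_integral_zero_fun) (use fr in \<open>auto simp: einterval_def\<close>)
  moreover have "(LINT x:einterval a p|lebesgue. (cmod (f x))\<^sup>2) = (LINT x:einterval a p|lebesgue. (cmod (u x))\<^sup>2)"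
    by (rule set_lebesgue_integral_cong) (use fl in \<open>auto simp: einterval_def\<close>)
  ultimately show ?thesis
    using Im_integral_L2_inner[OF fg(1) fL2 p r(1) less_imp_le[OF r(2)], of z] fl fr f'l[OF p] f'r[OF r(1)]
    by (simp add: einterval_def)
qed

text \<open>Mirror image of \<open>Im_cnj_vderiv_left\<close>; the sign changes because the boundary
  term now belongs to the other end of [p,r].\<close>

lemma Im_cnj_vderiv_right:
  assumes H: "separated_realization a b q v w H" and u: "solution a b q z u"
    and dom: "in_domain_near_right a b q w u" and r: "r \<in> einterval a b"
  shows "Im (cnj (u r) * vderiv u r) = Im z * (LINT x:einterval r b|lebesgue. (cmod (u x))\<^sup>2)"
proof -
  note \<tau> = u[unfolded solution_def]
  obtain p where p: "p \<in> einterval a b" "p < r" using einterval_dense_left[OF r] .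
  obtain k k1 k2 where k: "\<And>x. (k has_real_derivative k1 x) (at x)" "\<And>x. (k1 has_real_derivative k2 x) (at x)"
    "continuous_on UNIV k2" and k_l: "\<And>x. x \<le> p \<Longrightarrow> k x = 1 \<and> k1 x = 0 \<and> k2 x = 0"
    and k_r: "\<And>x. x \<ge> r \<Longrightarrow> k x = 0 \<and> k1 x = 0 \<and> k2 x = 0"
    using smooth_cutoff[OF p(2)] by blast
  \<comment> \<open>The complement of the cutoff vanishes near \<open>a\<close> and equals 1 from
    \<open>r\<close> on.\<close>
  define h h1 h2 where "h = (\<lambda>x. 1 - k x)" and "h1 = (\<lambda>x. - k1 x)" and "h2 = (\<lambda>x. - k2 x)"
  have h: "(h has_real_derivative h1 x) (at x)" "(h1 has_real_derivative h2 x) (at x)" "continuous_on UNIV h2" for x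
    unfolding h_def h1_def h2_def
    by (auto intro!: derivative_eq_intros k continuous_intros)
  have h_l: "h x = 0 \<and> h1 x = 0 \<and> h2 x = 0" if "x \<le> p" for x using k_l[OF that] by (simp add: h_def h1_def h2_def)
  have h_r: "h x = 1 \<and> h1 x = 0 \<and> h2 x = 0" if "x \<ge> r" for x using k_r[OF that] by (simp add: h_def h1_def h2_def)
  define f where "f = (\<lambda>x. of_real (h x) * u x)"
  define g where "g = (\<lambda>x. of_real (h x) * (z * u x) - 2 * of_real (h1 x) * vderiv u x - of_real (h2 x) * u x)"
  note fg = tau_rel_cutoff[OF u h, folded f_def g_def]
  have fl: "f x = 0" "g x = 0" if "x \<le> p" for x using h_l[OF that] by (simp_all add: f_def g_def)
  have fr: "f x = u x" "g x = z * u x" if "x \<ge> r" for x using h_r[OF that] by (simp_all add: f_def g_def)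
  have f'l: "vderiv f x = 0" if "x \<in> einterval a b" "x \<le> p" for x
    using fg(3)[OF that(1)] h_l[OF that(2)] by simp
  have f'r: "vderiv f x = vderiv u x" if "x \<in> einterval a b" "x \<ge> r" for x
    using fg(3)[OF that(1)] h_r[OF that(2)] by simp
  have uL2: "u \<in> L2 (ereal r) b"
    using dom r tau_rel_continuous(1)[OF \<tau>] by (intro L2_near_right_imp_L2) (auto simp: in_domain_near_right_def)
  have fL2: "f \<in> L2 a b"
    using L2_cong[OF uL2, of f] L2_cong[OF L2_zero, of a "ereal p" f] fl fr p r
    by (intro L2_glue[OF tau_rel_continuous(1)[OF fg(1)] p(1) r]) (auto simp: einterval_def)
  have gL2: "g \<in> L2 a b"
    using L2_cong[OF L2_cmult[OF uL2, of z], of g] L2_cong[OF L2_zero, of a "ereal p" g] fl fr p r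
    by (intro L2_glue[OF fg(2) p(1) r]) (auto simp: einterval_def)
  have "bc_right a b q w f"
    unfolding bc_right_def
  proof
    assume "limit_circle_right a b q"
    then have "(wronskian w u \<longlongrightarrow> 0) (right_end b)" using dom by (simp add: in_domain_near_right_def bc_right_def)
    moreover have "eventually (\<lambda>x. wronskian w u x = wronskian w f x) (right_end b)"
      using eventually_right_end[OF r]
    proof eventually_elim
      case (elim x)
      then have "x \<ge> r" "x \<in> einterval a b" using einterval_split[OF r r order_refl] by (auto simp: einterval_def)
      then show ?case using fr f'r by (simp add: wronskian_def)
    qed
    ultimately show "(wronskian w f \<longlongrightarrow> 0) (right_end b)" by (rule Lim_transform_eventually)
  qed
  moreover have "bc_left a b q v f"
    unfolding bc_left_def
  proof
    have "eventually (\<lambda>x. 0 = wronskian v f x) (left_end a)"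
      using eventually_left_end[OF p(1)]
    proof eventually_elim
      case (elim x)
      then have "x \<le> p" "x \<in> einterval a b" using einterval_split[OF p(1) p(1) order_refl] by (auto simp: einterval_def)
      then show ?case using fl f'l by (simp add: wronskian_def)
    qed
    then show "(wronskian v f \<longlongrightarrow> 0) (left_end a)" by (rule Lim_transform_eventually[OF tendsto_const])
  qed
  ultimately have "(f, g) \<in> H" using H fL2 gL2 fg(1) by (simp add: separated_realization_def max_op_def)
  then have "Im (L2_inner a b f g) = 0"
    using H self_adjoint_imp_Im_L2_inner by (auto simp: separated_realization_def)
  moreover have "continuous_on {p..r} g"
    by (rule continuous_on_subset[OF fg(2) einterval_Icc_subset[OF p(1) r]])
  moreover have "(LINT x:einterval a p|lebesgue. (cmod (f x))\<^sup>2) = 0"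
    by (rule set_lebesgue_integral_zero_fun) (use fl in \<open>auto simp: einterval_def\<close>)
  moreover have "(LINT x:einterval r b|lebesgue. (cmod (f x))\<^sup>2) = (LINT x:einterval r b|lebesgue. (cmod (u x))\<^sup>2)"
    by (rule set_lebesgue_integral_cong) (use fr in \<open>auto simp: einterval_def\<close>)
  ultimately show ?thesis
    using Im_integral_L2_inner[OF fg(1) fL2 p(1) r less_imp_le[OF p(2)], of z] fl fr f'l[OF p(1)] f'r[OF r]
    by (simp add: einterval_def)
qed

subsection \<open>Asymptotics of solutions at nonreal energies\<close>

text \<open>Here \<open>\<kappa>\<close> plays the role of $\sqrt{-z}$, so that $z = -\kappa^2$.\<close>

definition herglotz_solution ::
  "ereal \<Rightarrow> ereal \<Rightarrow> (real \<Rightarrow> real) \<Rightarrow> complex \<Rightarrow> (real \<Rightarrow> complex) \<Rightarrow> bool" where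
  "herglotz_solution a b q \<kappa> u \<longleftrightarrow> solution a b q (- \<kappa>\<^sup>2) u \<and>
     (\<forall>x\<in>einterval a b. u x \<noteq> 0 \<and> Im (cnj (u x) * vderiv u x) * Im \<kappa> \<ge> 0)"

lemma abs_Im_add_same_sign:
  fixes x y :: real
  assumes "x * y \<ge> 0"
  shows "\<bar>x + y\<bar> \<ge> \<bar>y\<bar>"
  using assms by (cases "x \<ge> 0"; cases "y \<ge> 0") (auto simp: zero_le_mult_iff)

lemma Im_vderiv_quotient:
  "Im (cnj c * d) = Im (d / c) * (cmod c)\<^sup>2" if "c \<noteq> 0"
proof -
  define s :: real where "s = (cmod c)\<^sup>2"
  have "of_real s = c * cnj c" unfolding s_def by (rule complex_norm_square)
  then have "cnj c * d = d / c * of_real s" using that by simp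
  then have "Im (cnj c * d) = Im (d / c) * s"
    by (simp only: times_complex.simps Re_complex_of_real Im_complex_of_real)
  then show ?thesis by (simp add: s_def)
qed

lemma herglotz_solution_Im_quotient:
  assumes "herglotz_solution a b q \<kappa> u" "x \<in> einterval a b"
  shows "Im (vderiv u x / u x) * Im \<kappa> \<ge> 0"
proof -
  have u: "u x \<noteq> 0" "Im (cnj (u x) * vderiv u x) * Im \<kappa> \<ge> 0"
    using assms by (auto simp: herglotz_solution_def)
  then have "(Im (vderiv u x / u x) * Im \<kappa>) * (cmod (u x))\<^sup>2 \<ge> 0"
    using Im_vderiv_quotient[OF u(1), of "vderiv u x"] by (simp add: mult_ac)
  then show ?thesis using u(1) by (simp add: zero_le_mult_iff)
qed

text \<open>The imaginary parts of u'/u and \<kappa> cannot cancel, as they have the same sign. This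
  keeps the denominator of the Cayley transform away from zero.\<close>

lemma herglotz_solution_lower_bound:
  assumes "herglotz_solution a b q \<kappa> u" "x \<in> einterval a b"
  shows "\<bar>Im \<kappa>\<bar> * cmod (u x) \<le> cmod (vderiv u x + \<kappa> * u x)"
proof -
  have u: "u x \<noteq> 0" using assms by (auto simp: herglotz_solution_def)
  have "\<bar>Im \<kappa>\<bar> \<le> \<bar>Im (vderiv u x / u x) + Im \<kappa>\<bar>"
    by (rule abs_Im_add_same_sign[OF herglotz_solution_Im_quotient[OF assms]])
  also have "\<dots> = \<bar>Im (vderiv u x / u x + \<kappa>)\<bar>" by simp
  also have "\<dots> \<le> cmod (vderiv u x / u x + \<kappa>)" by (rule abs_Im_le_cmod)
  also have "vderiv u x / u x + \<kappa> = (vderiv u x + \<kappa> * u x) / u x" using u by (simp add: field_simps)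
  finally show ?thesis using u by (simp add: norm_divide field_simps)
qed

text \<open>The Cayley transform $w = (u' - \kappa u)/(u' + \kappa u)$ of the Riccati variable $u'/u$
  satisfies $(e^{2\kappa x} w)' = 2\kappa q e^{2\kappa x} u^2/(u' + \kappa u)^2$.\<close>

lemma herglotz_solution_cayley_bound:
  assumes q: "L1_loc a b q" and u: "herglotz_solution a b q \<kappa> u" and k: "Im \<kappa> \<noteq> 0" "Re \<kappa> \<ge> 0"
    and xs: "x0 \<in> einterval a b" "x \<in> einterval a b" "x0 \<le> x"
  shows "cmod ((vderiv u x - \<kappa> * u x) / (vderiv u x + \<kappa> * u x)) \<le>
     exp (- 2 * Re \<kappa> * (x - x0)) * (1 + 2 * cmod \<kappa> / \<bar>Im \<kappa>\<bar>)
     + 2 * cmod \<kappa> / \<bar>Im \<kappa>\<bar>\<^sup>2 * integral {x0..x} (\<lambda>t. \<bar>q t\<bar>)"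
proof -
  define D E where "D = (\<lambda>x. vderiv u x + \<kappa> * u x)" and "E = (\<lambda>x. vderiv u x + (- \<kappa>) * u x)"
  have u': "tau_rel a b q u (\<lambda>x. - \<kappa>\<^sup>2 * u x)" using u by (simp add: herglotz_solution_def solution_def)
  note i0 = tau_rel_indef_integral[OF u' xs(1,2)] and i1 = tau_rel_indef_integral_vderiv[OF u' xs(1,2)]
  have sub: "{x0..x} \<subseteq> einterval a b" by (rule einterval_Icc_subset[OF xs(1,2)])
  have D_low: "\<bar>Im \<kappa>\<bar> * cmod (u t) \<le> cmod (D t)" if "t \<in> einterval a b" for t
    using herglotz_solution_lower_bound[OF u that] by (simp add: D_def)
  have u_nz: "u t \<noteq> 0" if "t \<in> einterval a b" for t using u that by (auto simp: herglotz_solution_def)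
  have D_nz: "D t \<noteq> 0" if "t \<in> einterval a b" for t
    using D_low[OF that] u_nz[OF that] k(1) by (auto simp: mult_le_0_iff)
  have uD: "cmod (u t / D t) \<le> 1 / \<bar>Im \<kappa>\<bar>" if "t \<in> einterval a b" for t
    using D_low[OF that] D_nz[OF that] k(1) by (simp add: norm_divide field_simps)
  have iD: "indef_integral x0 x D (\<lambda>t. (of_real (q t) * u t - - \<kappa>\<^sup>2 * u t) + \<kappa> * vderiv u t)"
    unfolding D_def by (intro indef_integral_add indef_integral_cmult i0 i1)
  have iE: "indef_integral x0 x E (\<lambda>t. (of_real (q t) * u t - - \<kappa>\<^sup>2 * u t) + (- \<kappa>) * vderiv u t)"
    unfolding E_def by (intro indef_integral_add indef_integral_cmult i0 i1)
  have iI: "indef_integral x0 x (\<lambda>t. inverse (D t)) (\<lambda>t. - ((of_real (q t) * u t - - \<kappa>\<^sup>2 * u t) + \<kappa> * vderiv u t) / (D t)\<^sup>2)"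
    by (rule indef_integral_inverse[OF iD]) (use D_nz sub in auto)
  have ex: "((\<lambda>t. exp (2 * \<kappa> * of_real t)) has_vector_derivative (2 * \<kappa> * exp (2 * \<kappa> * of_real t))) (at t)" for t :: real
    by (rule has_vector_derivative_real_field) (auto intro!: derivative_eq_intros)
  have iX: "indef_integral x0 x (\<lambda>t. exp (2 * \<kappa> * of_real t)) (\<lambda>t. 2 * \<kappa> * exp (2 * \<kappa> * of_real t))"
    by (intro indef_integral_vector_derivative ex continuous_intros)
  define W where "W = (\<lambda>t. (E t * inverse (D t)) * exp (2 * \<kappa> * of_real t))"
  define d where "d = (\<lambda>t. 2 * \<kappa> * of_real (q t) * (u t / D t)\<^sup>2 * exp (2 * \<kappa> * of_real t))"
  have "(d has_integral (W x - W x0)) {x0..x}"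
  proof (rule has_integral_eq)
    show "((\<lambda>t. (((of_real (q t) * u t - - \<kappa>\<^sup>2 * u t) + (- \<kappa>) * vderiv u t) * inverse (D t)
          + E t * (- ((of_real (q t) * u t - - \<kappa>\<^sup>2 * u t) + \<kappa> * vderiv u t) / (D t)\<^sup>2)) * exp (2 * \<kappa> * of_real t)
          + E t * inverse (D t) * (2 * \<kappa> * exp (2 * \<kappa> * of_real t))) has_integral (W x - W x0)) {x0..x}"
      using indef_integralD[OF indef_integral_mult[OF indef_integral_mult[OF iE iI] iX] order_refl xs(3) order_refl]
      by (simp add: W_def)
    fix t assume t: "t \<in> {x0..x}"
    then have nz: "D t \<noteq> 0" using D_nz sub by auto
    have e: "E t = vderiv u t - \<kappa> * u t" and dd: "vderiv u t = D t - \<kappa> * u t" by (simp_all add: E_def D_def)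
    show "(((of_real (q t) * u t - - \<kappa>\<^sup>2 * u t) + (- \<kappa>) * vderiv u t) * inverse (D t)
          + E t * (- ((of_real (q t) * u t - - \<kappa>\<^sup>2 * u t) + \<kappa> * vderiv u t) / (D t)\<^sup>2)) * exp (2 * \<kappa> * of_real t)
          + E t * inverse (D t) * (2 * \<kappa> * exp (2 * \<kappa> * of_real t)) = d t"
      unfolding e d_def dd using nz by (simp add: field_simps power2_eq_square)
  qed
  then have W: "W x = W x0 + integral {x0..x} d" and di: "d integrable_on {x0..x}"
    by (auto simp: integral_unique)
  have qi: "(\<lambda>t. \<bar>q t\<bar>) integrable_on {x0..x}"
  proof -
    have "q absolutely_integrable_on {x0..x}" using q sub unfolding L1_loc_def by blast
    then show ?thesis by (simp add: absolutely_integrable_on_def)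
  qed
  \<comment> \<open>The weight exp(2 Re \<kappa> t) is replaced by its maximum at t = x, which
    cancels when the factor |exp(2 \<kappa> x)| is divided out of \<open>W x\<close>.\<close>
  have "cmod (integral {x0..x} d) \<le> integral {x0..x} (\<lambda>t. (2 * cmod \<kappa> / \<bar>Im \<kappa>\<bar>\<^sup>2 * exp (2 * Re \<kappa> * x)) * \<bar>q t\<bar>)"
  proof (rule integral_norm_bound_integral[OF di])
    show "(\<lambda>t. (2 * cmod \<kappa> / \<bar>Im \<kappa>\<bar>\<^sup>2 * exp (2 * Re \<kappa> * x)) * \<bar>q t\<bar>) integrable_on {x0..x}"
      using qi by (rule integrable_on_mult_right)
    fix t assume t: "t \<in> {x0..x}"
    have "cmod (d t) = (2 * cmod \<kappa> * \<bar>q t\<bar>) * ((cmod (u t / D t))\<^sup>2 * exp (2 * Re \<kappa> * t))"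
      by (simp add: d_def norm_mult norm_power)
    also have "\<dots> \<le> (2 * cmod \<kappa> * \<bar>q t\<bar>) * ((1 / \<bar>Im \<kappa>\<bar>)\<^sup>2 * exp (2 * Re \<kappa> * x))"
      using t sub k(2) by (intro mult_left_mono mult_mono power_mono uD) (auto intro: mult_left_mono)
    also have "\<dots> = (2 * cmod \<kappa> / \<bar>Im \<kappa>\<bar>\<^sup>2 * exp (2 * Re \<kappa> * x)) * \<bar>q t\<bar>"
      by (simp add: power_divide)
    finally show "cmod (d t) \<le> \<dots>" .
  qed
  then have I: "cmod (integral {x0..x} d) \<le> 2 * cmod \<kappa> / \<bar>Im \<kappa>\<bar>\<^sup>2 * exp (2 * Re \<kappa> * x) * integral {x0..x} (\<lambda>t. \<bar>q t\<bar>)"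
    by simp
  have w0: "cmod (E x0 * inverse (D x0)) \<le> 1 + 2 * cmod \<kappa> / \<bar>Im \<kappa>\<bar>"
  proof -
    have "E x0 * inverse (D x0) = 1 - 2 * \<kappa> * (u x0 / D x0)"
      using D_nz[OF xs(1)] by (simp add: E_def D_def field_simps)
    then have "cmod (E x0 * inverse (D x0)) \<le> 1 + cmod (2 * \<kappa> * (u x0 / D x0))"
      using norm_triangle_ineq4[of 1 "2 * \<kappa> * (u x0 / D x0)"] by simp
    also have "\<dots> = 1 + 2 * cmod \<kappa> * cmod (u x0 / D x0)" by (simp add: norm_mult norm_divide)
    also have "\<dots> \<le> 1 + 2 * cmod \<kappa> * (1 / \<bar>Im \<kappa>\<bar>)"
      by (intro add_left_mono mult_left_mono uD xs) auto
    finally show ?thesis by simp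
  qed
  have "cmod (E x * inverse (D x)) * exp (2 * Re \<kappa> * x) = cmod (W x)"
    by (simp add: W_def norm_mult)
  also have "\<dots> \<le> cmod (W x0) + cmod (integral {x0..x} d)"
    unfolding W by (rule norm_triangle_ineq)
  also have "\<dots> \<le> (1 + 2 * cmod \<kappa> / \<bar>Im \<kappa>\<bar>) * exp (2 * Re \<kappa> * x0) +
      2 * cmod \<kappa> / \<bar>Im \<kappa>\<bar>\<^sup>2 * exp (2 * Re \<kappa> * x) * integral {x0..x} (\<lambda>t. \<bar>q t\<bar>)"
    using mult_right_mono[OF w0, of "exp (2 * Re \<kappa> * x0)"] by (intro add_mono I) (simp add: W_def norm_mult)
  also have "exp (2 * Re \<kappa> * x0) = exp (- 2 * Re \<kappa> * (x - x0)) * exp (2 * Re \<kappa> * x)"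
    by (simp add: exp_add[symmetric] algebra_simps)
  finally have "cmod (E x * inverse (D x)) * exp (2 * Re \<kappa> * x) \<le>
     (exp (- 2 * Re \<kappa> * (x - x0)) * (1 + 2 * cmod \<kappa> / \<bar>Im \<kappa>\<bar>)
     + 2 * cmod \<kappa> / \<bar>Im \<kappa>\<bar>\<^sup>2 * integral {x0..x} (\<lambda>t. \<bar>q t\<bar>)) * exp (2 * Re \<kappa> * x)"
    by (simp add: algebra_simps)
  then show ?thesis by (simp add: E_def D_def divide_inverse)
qed

text \<open>The Cayley bound gives w = O(1/|\<kappa>|), and solving for u'/u = \<kappa> (1 + w)/(1 -
  w) turns this into \<kappa> + O(1). The order of quantifiers matters: \<open>K\<close> and
  \<open>r\<close> serve all solutions and all admissible \<kappa> at once, hence a whole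
  ray.\<close>

lemma herglotz_solution_asymptotics:
  assumes q: "L1_loc a b q" and x: "x1 \<in> einterval a b" "x2 \<in> einterval a b" and \<eta>: "\<eta> > 0"
  obtains K r where "K \<ge> 0"
    "\<And>\<kappa> u x. herglotz_solution a b q \<kappa> u \<Longrightarrow> cmod \<kappa> \<ge> r \<Longrightarrow> Re \<kappa> \<ge> \<eta> * cmod \<kappa> \<Longrightarrow> \<bar>Im \<kappa>\<bar> \<ge> \<eta> * cmod \<kappa> \<Longrightarrow>
       x \<in> {x1..x2} \<Longrightarrow> cmod (vderiv u x - \<kappa> * u x) \<le> K * cmod (u x)"
proof -
  \<comment> \<open>Starting strictly to the left of \<open>x1\<close> lets the unknown initial
    value decay before the interval is reached.\<close>
  obtain x0 where x0: "x0 \<in> einterval a b" "x0 < x1" using einterval_dense_left[OF x(1)] .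
  define Q where "Q = integral {x0..x2} (\<lambda>t. \<bar>q t\<bar>)"
  have qi: "(\<lambda>t. \<bar>q t\<bar>) integrable_on {x0..x2}"
  proof -
    have "q absolutely_integrable_on {x0..x2}"
      using q einterval_Icc_subset[OF x0(1) x(2)] unfolding L1_loc_def by blast
    then show ?thesis by (simp add: absolutely_integrable_on_def)
  qed
  have Q0: "Q \<ge> 0" unfolding Q_def by (intro integral_nonneg qi) auto
  \<comment> \<open>The first summand comes from exp(-m) \<le> 1/m with m = 2 \<eta> |\<kappa>| (x1
    - x0), the second from the integral of |q|; both are multiplied by |\<kappa>|.\<close>
  define C where "C = (1 + 2 / \<eta>) / (2 * \<eta> * (x1 - x0)) + 2 * Q / \<eta>\<^sup>2"
  have C0: "C \<ge> 0" using \<eta> x0 Q0 by (simp add: C_def)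
  show thesis
  \<comment> \<open>The radius forces |w| \<le> 1/2, and absorbing half of the error on the left
    then doubles the bound 2 C to 4 C.\<close>
  proof (rule that[of "4 * C" "2 * C + 1"])
    show "4 * C \<ge> 0" using C0 by simp
    fix \<kappa> u x
    assume u: "herglotz_solution a b q \<kappa> u" and k: "cmod \<kappa> \<ge> 2 * C + 1" "Re \<kappa> \<ge> \<eta> * cmod \<kappa>" "\<bar>Im \<kappa>\<bar> \<ge> \<eta> * cmod \<kappa>"
      and xx: "x \<in> {x1..x2}"
    have kp: "cmod \<kappa> > 0" using k(1) C0 by linarith
    have Imp: "\<bar>Im \<kappa>\<bar> > 0" and Rep: "Re \<kappa> > 0" using kp \<eta> k(2,3) by (smt (verit) mult_pos_pos)+
    have xin: "x \<in> einterval a b" using einterval_Icc_subset[OF x] xx by auto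
    define w where "w = (vderiv u x - \<kappa> * u x) / (vderiv u x + \<kappa> * u x)"
    have "cmod w \<le> exp (- 2 * Re \<kappa> * (x - x0)) * (1 + 2 * cmod \<kappa> / \<bar>Im \<kappa>\<bar>)
       + 2 * cmod \<kappa> / \<bar>Im \<kappa>\<bar>\<^sup>2 * integral {x0..x} (\<lambda>t. \<bar>q t\<bar>)"
      unfolding w_def using Imp Rep x0 xx by (intro herglotz_solution_cayley_bound[OF q u _ _ x0(1) xin]) auto
    also have "\<dots> \<le> 1 / (2 * (\<eta> * cmod \<kappa>) * (x1 - x0)) * (1 + 2 / \<eta>) + 2 / (\<eta>\<^sup>2 * cmod \<kappa>) * Q"
    proof (intro add_mono mult_mono)
      have "2 * (\<eta> * cmod \<kappa>) * (x1 - x0) \<le> 2 * Re \<kappa> * (x - x0)"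
        using k(2) xx x0 Rep kp \<eta> by (intro mult_mono) auto
      then have "exp (- 2 * Re \<kappa> * (x - x0)) \<le> exp (- (2 * (\<eta> * cmod \<kappa>) * (x1 - x0)))" by simp
      also have "\<dots> \<le> 1 / (2 * (\<eta> * cmod \<kappa>) * (x1 - x0))"
      proof -
        have p: "2 * (\<eta> * cmod \<kappa>) * (x1 - x0) > 0" using kp \<eta> x0 by simp
        have "2 * (\<eta> * cmod \<kappa>) * (x1 - x0) \<le> exp (2 * (\<eta> * cmod \<kappa>) * (x1 - x0))"
          using exp_ge_add_one_self[of "2 * (\<eta> * cmod \<kappa>) * (x1 - x0)"] by linarith
        then show ?thesis using p by (simp only: exp_minus inverse_eq_divide) (intro divide_left_mono, auto)
      qed
      finally show "exp (- 2 * Re \<kappa> * (x - x0)) \<le> 1 / (2 * (\<eta> * cmod \<kappa>) * (x1 - x0))" .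
      show "2 * cmod \<kappa> / \<bar>Im \<kappa>\<bar> \<le> 2 / \<eta>" using k(3) Imp \<eta> by (simp add: field_simps)
      have "(\<eta> * cmod \<kappa>)\<^sup>2 \<le> \<bar>Im \<kappa>\<bar>\<^sup>2" using k(3) \<eta> by (intro power_mono) auto
      then have "2 * cmod \<kappa> / \<bar>Im \<kappa>\<bar>\<^sup>2 \<le> 2 * cmod \<kappa> / (\<eta> * cmod \<kappa>)\<^sup>2"
        using kp \<eta> Imp by (intro divide_left_mono mult_pos_pos) auto
      also have "\<dots> = 2 / (\<eta>\<^sup>2 * cmod \<kappa>)" using kp by (simp add: power2_eq_square field_simps)
      finally show "2 * cmod \<kappa> / \<bar>Im \<kappa>\<bar>\<^sup>2 \<le> 2 / (\<eta>\<^sup>2 * cmod \<kappa>)" .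
      show "integral {x0..x} (\<lambda>t. \<bar>q t\<bar>) \<le> Q" unfolding Q_def
        using xx by (intro integral_subset_le integrable_on_subinterval[OF qi] qi) auto
      show "0 \<le> integral {x0..x} (\<lambda>t. \<bar>q t\<bar>)"
        using xx by (intro integral_nonneg integrable_on_subinterval[OF qi]) auto
    qed (use kp \<eta> x0 in auto)
    also have "\<dots> = C / cmod \<kappa>" using kp \<eta> x0 by (simp add: C_def field_simps)
    finally have w: "cmod w \<le> C / cmod \<kappa>" .
    also have "\<dots> \<le> 1 / 2" using k(1) kp by (simp add: field_simps)
    finally have w2: "cmod w \<le> 1 / 2" .
    have nz: "vderiv u x + \<kappa> * u x \<noteq> 0"
      using herglotz_solution_lower_bound[OF u xin] Imp u xin by (auto simp: herglotz_solution_def mult_le_0_iff)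
    define e where "e = vderiv u x - \<kappa> * u x"
    have e1: "e + 2 * \<kappa> * u x = vderiv u x + \<kappa> * u x" by (simp add: e_def)
    \<comment> \<open>Inverting the Cayley transform without dividing by u: the unknown
      \<open>e\<close> occurs on both sides and is absorbed.\<close>
    have "e = w * (e + 2 * \<kappa> * u x)" unfolding e1 using nz by (simp add: w_def e_def)
    then have "cmod e \<le> cmod w * (cmod e + 2 * cmod \<kappa> * cmod (u x))"
      by (metis norm_mult norm_triangle_ineq mult_left_mono norm_ge_zero norm_numeral)
    also have "\<dots> = cmod w * cmod e + cmod w * (2 * cmod \<kappa> * cmod (u x))" by (simp add: algebra_simps)
    also have "\<dots> \<le> 1/2 * cmod e + C / cmod \<kappa> * (2 * cmod \<kappa> * cmod (u x))"
      by (intro add_mono mult_right_mono w w2) auto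
    also have "\<dots> = 1/2 * cmod e + 2 * C * cmod (u x)" using kp by simp
    finally show "cmod (vderiv u x - \<kappa> * u x) \<le> 4 * C * cmod (u x)" by (simp add: e_def)
  qed
qed

text \<open>The derivative of |u|^2 is 2 Re(cnj u u'), which differs from 2 Re \<kappa> |u|^2 by at
  most 2 K |u|^2. Hence |u|^2 exp(-2 m t) decreases for m = Re \<kappa> + K and increases for m = Re
  \<kappa> - K.\<close>

lemma solution_growth:
  assumes u: "solution a b q z u" and xs: "y1 \<in> einterval a b" "y2 \<in> einterval a b" "y1 \<le> y2"
    and K: "\<And>x. x \<in> {y1..y2} \<Longrightarrow> cmod (vderiv u x - \<kappa> * u x) \<le> K * cmod (u x)"
  shows "cmod (u y2) \<le> exp ((Re \<kappa> + K) * (y2 - y1)) * cmod (u y1)"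
    and "exp ((Re \<kappa> - K) * (y2 - y1)) * cmod (u y1) \<le> cmod (u y2)"
proof -
  note \<tau> = u[unfolded solution_def]
  have sub: "{y1..y2} \<subseteq> einterval a b" by (rule einterval_Icc_subset[OF xs(1,2)])
  have d: "((\<lambda>t. (cmod (u t))\<^sup>2 * exp (- 2 * m * t)) has_real_derivative
      (2 * (u t \<bullet> vderiv u t) - 2 * m * (cmod (u t))\<^sup>2) * exp (- 2 * m * t)) (at t)"
    if "t \<in> {y1..y2}" for t m
  proof -
    have "(u has_vector_derivative vderiv u t) (at t)" using tau_rel_vderiv[OF \<tau>] that sub by auto
    from bounded_bilinear.has_vector_derivative[OF bounded_bilinear_inner this this]
    have 1: "((\<lambda>t. (cmod (u t))\<^sup>2) has_real_derivative 2 * (u t \<bullet> vderiv u t)) (at t)"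
      by (simp add: has_real_derivative_iff_has_vector_derivative power2_norm_eq_inner inner_commute)
    show ?thesis by (rule derivative_eq_intros 1 refl | simp add: algebra_simps)+
  qed
  have est: "\<bar>u t \<bullet> vderiv u t - Re \<kappa> * (cmod (u t))\<^sup>2\<bar> \<le> K * (cmod (u t))\<^sup>2" if t: "t \<in> {y1..y2}" for t
  proof -
    have "u t \<bullet> (\<kappa> * u t) = Re \<kappa> * (cmod (u t))\<^sup>2"
      by (simp add: inner_complex_def cmod_power2) (simp add: algebra_simps power2_eq_square)
    then have "u t \<bullet> vderiv u t - Re \<kappa> * (cmod (u t))\<^sup>2 = u t \<bullet> (vderiv u t - \<kappa> * u t)"
      by (simp add: inner_diff_right)
    also have "\<bar>\<dots>\<bar> \<le> cmod (u t) * cmod (vderiv u t - \<kappa> * u t)" by (rule Cauchy_Schwarz_ineq2)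
    also have "\<dots> \<le> cmod (u t) * (K * cmod (u t))" by (intro mult_left_mono K t) auto
    finally show ?thesis by (simp add: power2_eq_square mult_ac)
  qed
  have sq: "(exp (m * (y2 - y1)) * s)\<^sup>2 = s\<^sup>2 * exp (- 2 * m * y1) * exp (2 * m * y2)" for s m :: real
    by (simp add: power_mult_distrib exp_double[symmetric] exp_add[symmetric] algebra_simps)
  have sq2: "s\<^sup>2 * exp (- 2 * m * y2) * exp (2 * m * y2) = s\<^sup>2" for s m :: real
    by (simp add: mult.assoc exp_add[symmetric])
  show "cmod (u y2) \<le> exp ((Re \<kappa> + K) * (y2 - y1)) * cmod (u y1)"
  proof -
    have "(cmod (u y2))\<^sup>2 * exp (- 2 * (Re \<kappa> + K) * y2) \<le> (cmod (u y1))\<^sup>2 * exp (- 2 * (Re \<kappa> + K) * y1)"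
    proof (rule DERIV_nonpos_imp_nonincreasing[OF xs(3)])
      fix t assume t: "y1 \<le> t" "t \<le> y2"
      have "2 * (u t \<bullet> vderiv u t) - 2 * (Re \<kappa> + K) * (cmod (u t))\<^sup>2 \<le> 0"
        using est[of t] t by (simp add: algebra_simps)
      then show "\<exists>y. ((\<lambda>t. (cmod (u t))\<^sup>2 * exp (- 2 * (Re \<kappa> + K) * t)) has_real_derivative y) (at t) \<and> y \<le> 0"
        using d[of t "Re \<kappa> + K"] t by (intro exI conjI) (auto simp: mult_le_0_iff)
    qed
    from mult_right_mono[OF this, of "exp (2 * (Re \<kappa> + K) * y2)"]
    have "(cmod (u y2))\<^sup>2 \<le> (exp ((Re \<kappa> + K) * (y2 - y1)) * cmod (u y1))\<^sup>2"
      unfolding sq sq2 by simp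
    then show ?thesis by (rule power2_le_imp_le) simp
  qed
  show "exp ((Re \<kappa> - K) * (y2 - y1)) * cmod (u y1) \<le> cmod (u y2)"
  proof -
    have "(cmod (u y1))\<^sup>2 * exp (- 2 * (Re \<kappa> - K) * y1) \<le> (cmod (u y2))\<^sup>2 * exp (- 2 * (Re \<kappa> - K) * y2)"
    proof (rule DERIV_nonneg_imp_nondecreasing[OF xs(3)])
      fix t assume t: "y1 \<le> t" "t \<le> y2"
      have "2 * (u t \<bullet> vderiv u t) - 2 * (Re \<kappa> - K) * (cmod (u t))\<^sup>2 \<ge> 0"
        using est[of t] t by (simp add: algebra_simps)
      then show "\<exists>y. ((\<lambda>t. (cmod (u t))\<^sup>2 * exp (- 2 * (Re \<kappa> - K) * t)) has_real_derivative y) (at t) \<and> 0 \<le> y"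
        using d[of t "Re \<kappa> - K"] t by (intro exI conjI) (auto simp: zero_le_mult_iff)
    qed
    from mult_right_mono[OF this, of "exp (2 * (Re \<kappa> - K) * y2)"]
    have "(exp ((Re \<kappa> - K) * (y2 - y1)) * cmod (u y1))\<^sup>2 \<le> (cmod (u y2))\<^sup>2"
      unfolding sq sq2 by simp
    then show ?thesis by (rule power2_le_imp_le) simp
  qed
qed

text \<open>The product u v is the diagonal Green function. Because Im(u'/u) and Im(v'/v) have
  opposite signs, their difference is at least |Im(u'/u)| in modulus. Asymptotics are used for u
  only, a sign is all that enters for v.\<close>

lemma green_function_bound:
  assumes u: "herglotz_solution a b q \<kappa> u" and x: "x \<in> einterval a b"
    and K: "cmod (vderiv u x - \<kappa> * u x) \<le> K * cmod (u x)" "K < \<bar>Im \<kappa>\<bar>"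
    and v: "Im (cnj (v x) * vderiv v x) * Im \<kappa> \<le> 0" and W: "wronskian v u x = 1"
  shows "cmod (u x * v x) \<le> 1 / (\<bar>Im \<kappa>\<bar> - K)"
proof (cases "v x = 0")
  \<comment> \<open>The sign condition on v does not exclude zeros of v, where no quotient can be
    formed.\<close>
  case True
  then show ?thesis using K(2) by simp
next
  case False
  have nz: "u x \<noteq> 0" using u x by (auto simp: herglotz_solution_def)
  define n p where "n = vderiv u x / u x" and "p = vderiv v x / v x"
  have "n - \<kappa> = (vderiv u x - \<kappa> * u x) / u x" using nz by (simp add: n_def field_simps)
  then have "cmod (n - \<kappa>) \<le> K" using K(1) nz by (simp only: norm_divide) (simp add: field_simps)
  then have n: "\<bar>Im n\<bar> \<ge> \<bar>Im \<kappa>\<bar> - K" using abs_Im_le_cmod[of "n - \<kappa>"] by simp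
  have n1: "Im n * Im \<kappa> \<ge> 0" unfolding n_def by (rule herglotz_solution_Im_quotient[OF u x])
  have "(Im p * Im \<kappa>) * (cmod (v x))\<^sup>2 \<le> 0"
    using v Im_vderiv_quotient[OF False, of "vderiv v x"] by (simp add: p_def mult_ac)
  then have p1: "Im p * Im \<kappa> \<le> 0" using False by (simp add: mult_le_0_iff)
  \<comment> \<open>The first bound in \<open>K\<close> forces \<open>K\<close> to be nonnegative,
    and |Im \<kappa>| exceeds it.\<close>
  have "Im \<kappa> \<noteq> 0" using K order_trans[OF norm_ge_zero K(1)] nz by (auto simp: zero_le_mult_iff)
  then have "(- Im p) * Im n \<ge> 0"
    using n1 p1 by (auto simp: zero_le_mult_iff mult_le_0_iff)
  then have "\<bar>Im n\<bar> \<le> \<bar>- Im p + Im n\<bar>" by (rule abs_Im_add_same_sign)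
  also have "\<dots> = \<bar>Im (n - p)\<bar>" by simp
  also have "\<dots> \<le> cmod (n - p)" by (rule abs_Im_le_cmod)
  also have "n - p = 1 / (u x * v x)"
    using W nz False by (simp add: n_def p_def wronskian_def field_simps)
  finally have "\<bar>Im \<kappa>\<bar> - K \<le> 1 / cmod (u x * v x)" using n by (simp add: norm_divide)
  then show ?thesis using K(2) nz False by (simp add: field_simps norm_mult)
qed

subsection \<open>Phragmen-Lindelof on sectors\<close>

lemma filterlim_exp_cmult_at_top:
  fixes c :: real assumes "c > 0"
  shows "filterlim (\<lambda>L. exp (c * L)) at_top at_top"
  by (rule filterlim_compose[OF exp_at_top])
     (rule filterlim_tendsto_pos_mult_at_top[OF tendsto_const assms filterlim_ident])

text \<open>With $z = e^{\zeta}$ the sector becomes a horizontal strip, on which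
  $F(e^\zeta)\exp(-\varepsilon e^{\rho\zeta})$ with $s < \rho$ is holomorphic and decays to the right.\<close>

lemma phragmen_lindelof_sector:
  fixes F :: "complex \<Rightarrow> complex"
  assumes F: "F holomorphic_on UNIV" and growth: "\<And>z. cmod (F z) \<le> B * exp (A * cmod z powr s)"
    and s: "s > 0" and \<beta>: "\<beta> > 0" "s * \<beta> < pi / 2" and C: "C > 0"
    and disc: "\<And>z. cmod z \<le> 1 \<Longrightarrow> cmod (F z) \<le> C"
    and rays: "\<And>t. t > 0 \<Longrightarrow> cmod (F (of_real t * cis (\<gamma> - \<beta>))) \<le> C"
      "\<And>t. t > 0 \<Longrightarrow> cmod (F (of_real t * cis (\<gamma> + \<beta>))) \<le> C"
    and t: "t > 0" and \<alpha>: "\<bar>\<alpha>\<bar> \<le> \<beta>"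
  shows "cmod (F (of_real t * cis (\<gamma> + \<alpha>))) \<le> C"
proof -
  \<comment> \<open>An exponent above \<open>s\<close> makes the damping beat the growth of F, and
    \<rho> \<beta> < pi/2 keeps cos(\<rho> y) bounded below by a positive constant for |y| \<le>
    \<beta>.\<close>
  obtain \<rho> where \<rho>: "s < \<rho>" "\<rho> * \<beta> < pi / 2"
  proof -
    have "s < pi / (2 * \<beta>)" using \<beta> by (simp add: field_simps)
    then obtain \<rho> where "s < \<rho>" "\<rho> < pi / (2 * \<beta>)" using dense by blast
    then show thesis using that[of \<rho>] \<beta> by (simp add: field_simps)
  qed
  have B: "B \<ge> 0" using growth[of 0] s order_trans[OF norm_ge_zero] by fastforce
  define c where "c = cos (\<rho> * \<beta>)"
  have c: "c > 0" unfolding c_def using \<rho> s \<beta> by (intro cos_gt_zero_pi) (auto intro: less_trans[of _ 0])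
  have cos_ge: "cos (\<rho> * y) \<ge> c" if "\<bar>y\<bar> \<le> \<beta>" for y
  proof -
    have "\<rho> * \<beta> \<le> pi" using \<rho>(2) pi_gt_zero by linarith
    then have "cos (\<rho> * \<bar>y\<bar>) \<ge> cos (\<rho> * \<beta>)"
      using that \<rho> s \<beta> by (intro cos_monotone_0_pi_le) (auto intro: mult_left_mono)
    moreover have "cos (\<rho> * \<bar>y\<bar>) = cos (\<rho> * y)" by (cases "y \<ge> 0") auto
    ultimately show ?thesis by (simp add: c_def)
  qed
  define \<zeta> where "\<zeta> = Complex (ln t) \<alpha>"
  have pol: "exp (\<zeta>' + \<i> * of_real \<gamma>) = of_real (exp (Re \<zeta>')) * cis (\<gamma> + Im \<zeta>')" for \<zeta>'
    by (simp add: exp_eq_polar cis_mult add.commute exp_of_real)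
  have main: "cmod (F (of_real t * cis (\<gamma> + \<alpha>))) \<le> C * exp (\<epsilon> * exp (\<rho> * ln t))" if e: "\<epsilon> > 0" for \<epsilon>
  proof -
    define G where "G = (\<lambda>\<zeta>. F (exp (\<zeta> + \<i> * of_real \<gamma>)) * exp (- of_real \<epsilon> * exp (of_real \<rho> * \<zeta>)))"
    have damp: "cmod (exp (- of_real \<epsilon> * exp (of_real \<rho> * \<zeta>'))) = exp (- \<epsilon> * exp (\<rho> * Re \<zeta>') * cos (\<rho> * Im \<zeta>'))" for \<zeta>'
      by (simp add: Re_exp Im_exp)
    have damp1: "cmod (exp (- of_real \<epsilon> * exp (of_real \<rho> * \<zeta>'))) \<le> 1" if "\<bar>Im \<zeta>'\<bar> \<le> \<beta>" for \<zeta>'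
      unfolding damp using cos_ge[OF that] c e by simp
    have "\<forall>\<^sub>F L in at_top. exp (s * L) \<ge> ln ((B + 1) / C) \<and> exp ((\<rho> - s) * L) \<ge> (A + 1) / (\<epsilon> * c) \<and> L \<ge> \<bar>ln t\<bar> + 1"
      using s \<rho> by (intro eventually_conj filterlim_at_top[THEN iffD1, rule_format] filterlim_exp_cmult_at_top eventually_ge_at_top) auto
    \<comment> \<open>\<open>L2\<close> makes the exponent on the right edge at most -exp(s L), and
      \<open>L1\<close> turns this into a factor C/(B + 1); with B + 1 instead of B the logarithm
      also makes sense for B = 0. \<open>L3\<close> puts \<zeta> into the rectangle and the image of
      the left edge into the unit disc.\<close>
    then obtain L where L1: "exp (s * L) \<ge> ln ((B + 1) / C)" and L2: "exp ((\<rho> - s) * L) \<ge> (A + 1) / (\<epsilon> * c)" and L3: "L \<ge> \<bar>ln t\<bar> + 1"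
      by (metis (mono_tags, lifting) eventually_happens trivial_limit_at_top_linorder)
    define S where "S = cbox (Complex (-L) (-\<beta>)) (Complex L \<beta>)"
    have Smem: "z \<in> S \<longleftrightarrow> -L \<le> Re z \<and> Re z \<le> L \<and> -\<beta> \<le> Im z \<and> Im z \<le> \<beta>" for z
      by (auto simp: S_def in_cbox_complex_iff)
    have hol: "G holomorphic_on UNIV" unfolding G_def
      by (intro holomorphic_intros holomorphic_on_compose_gen[OF _ F, unfolded o_def]) auto
    have "cmod (G \<zeta>) \<le> C"
    proof (rule maximum_modulus_frontier[where S=S and f=G and \<xi>=\<zeta>])
      show "G holomorphic_on interior S" using hol by (rule holomorphic_on_subset) auto
      show "continuous_on (closure S) G"
        using hol by (meson holomorphic_on_imp_continuous_on continuous_on_subset subset_UNIV)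
      show "bounded S" by (simp add: S_def)
      show "\<zeta> \<in> S" using L3 \<alpha> by (auto simp: Smem \<zeta>_def)
      fix z assume "z \<in> frontier S"
      then have zS: "z \<in> S" and "z \<notin> box (Complex (-L) (-\<beta>)) (Complex L \<beta>)"
        by (auto simp: S_def frontier_cbox)
      then have cases: "Re z = -L \<or> Re z = L \<or> Im z = -\<beta> \<or> Im z = \<beta>"
        using zS unfolding Smem in_box_complex_iff by auto
      have Imz: "\<bar>Im z\<bar> \<le> \<beta>" using zS by (auto simp: Smem)
      have Gle: "cmod (G z) \<le> cmod (F (exp (z + \<i> * of_real \<gamma>)))"
        unfolding G_def norm_mult using damp1[OF Imz] by (simp add: mult_left_le)
      consider "Re z = -L" | "Im z = -\<beta>" | "Im z = \<beta>" | "Re z = L" using cases by blast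
      then show "cmod (G z) \<le> C"
      proof cases
        case 1
        have "cmod (exp (z + \<i> * of_real \<gamma>)) \<le> 1" using 1 L3 by simp
        from disc[OF this] Gle show ?thesis by simp
      next
        case 2
        then show ?thesis using Gle rays(1)[of "exp (Re z)"] unfolding pol by simp
      next
        case 3
        then show ?thesis using Gle rays(2)[of "exp (Re z)"] unfolding pol by simp
      next
        case 4
        have "cmod (exp (z + \<i> * of_real \<gamma>)) = exp L" using 4 by simp
        then have F1: "cmod (F (exp (z + \<i> * of_real \<gamma>))) \<le> B * exp (A * exp (s * L))"
          using growth[of "exp (z + \<i> * of_real \<gamma>)"] by (simp add: powr_def)
        have "cmod (G z) \<le> (B * exp (A * exp (s * L))) * exp (- \<epsilon> * exp (\<rho> * L) * c)"
          unfolding G_def norm_mult damp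
          using 4 cos_ge[OF Imz] e B by (intro mult_mono F1) auto
        also have "\<dots> = B * exp (A * exp (s * L) - \<epsilon> * c * exp (\<rho> * L))"
          by (simp add: mult_exp_exp algebra_simps)
        also have "\<dots> \<le> B * exp (- ln ((B + 1) / C))"
        proof (intro mult_left_mono B)
          have "exp (\<rho> * L) = exp (s * L) * exp ((\<rho> - s) * L)" by (simp add: exp_add[symmetric] algebra_simps)
          then have "A * exp (s * L) - \<epsilon> * c * exp (\<rho> * L) = exp (s * L) * (A - \<epsilon> * c * exp ((\<rho> - s) * L))"
            by (simp add: algebra_simps)
          also have "\<dots> \<le> exp (s * L) * (-1)"
            using L2 e c by (intro mult_left_mono) (simp_all add: field_simps)
          also have "\<dots> \<le> - ln ((B + 1) / C)" using L1 by simp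
          finally show "exp (A * exp (s * L) - \<epsilon> * c * exp (\<rho> * L)) \<le> exp (- ln ((B + 1) / C))" by simp
        qed
        also have "\<dots> = C * (B / (B + 1))" using B C by (simp add: exp_minus)
        also have "\<dots> \<le> C * 1" using B C by (intro mult_left_mono) auto
        finally show ?thesis by simp
      qed
    qed
    moreover have "G \<zeta> = F (of_real t * cis (\<gamma> + \<alpha>)) * exp (- of_real \<epsilon> * exp (of_real \<rho> * \<zeta>))"
      unfolding G_def pol using t by (simp add: \<zeta>_def)
    ultimately have "cmod (F (of_real t * cis (\<gamma> + \<alpha>))) * exp (- \<epsilon> * exp (\<rho> * ln t) * cos (\<rho> * \<alpha>)) \<le> C"
      by (simp add: norm_mult damp[unfolded norm_exp_eq_Re] \<zeta>_def Re_exp mult.assoc)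
    then have "cmod (F (of_real t * cis (\<gamma> + \<alpha>))) \<le> C * exp (\<epsilon> * exp (\<rho> * ln t) * cos (\<rho> * \<alpha>))"
      by (simp add: exp_minus field_simps)
    also have "\<dots> \<le> C * exp (\<epsilon> * exp (\<rho> * ln t) * 1)"
      using C e by (intro mult_left_mono exp_le_cancel_iff[THEN iffD2] mult_left_mono cos_le_one) auto
    finally show ?thesis by simp
  qed
  \<comment> \<open>The rectangle depends on \<epsilon> but the point does not, so the damping can
    be removed by letting \<epsilon> tend to 0.\<close>
  have "((\<lambda>\<epsilon>. C * exp (\<epsilon> * exp (\<rho> * ln t))) \<longlongrightarrow> C * exp (0 * exp (\<rho> * ln t))) (at_right 0)"
    by (intro tendsto_intros)
  moreover have "eventually (\<lambda>\<epsilon>. cmod (F (of_real t * cis (\<gamma> + \<alpha>))) \<le> C * exp (\<epsilon> * exp (\<rho> * ln t))) (at_right 0)"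
    using eventually_at_right_less[of "0::real"] by eventually_elim (rule main)
  ultimately show ?thesis
    by (auto dest: tendsto_lowerbound)
qed

lemma nat_interval_cover:
  fixes \<alpha> :: "nat \<Rightarrow> real"
  assumes "\<alpha> 0 \<le> x" "x < \<alpha> n"
  obtains i where "i < n" "\<alpha> i \<le> x" "x \<le> \<alpha> (Suc i)"
proof -
  have "\<exists>i<n. \<alpha> i \<le> x \<and> x \<le> \<alpha> (Suc i)" using assms
  proof (induction n)
    case (Suc n)
    show ?case
    proof (cases "x < \<alpha> n")
      case True
      with Suc show ?thesis by (metis less_Suc_eq)
    next
      case False
      with Suc.prems show ?thesis by (intro exI[of _ n]) auto
    qed
  qed simp
  then show thesis using that by blast
qed

text \<open>Each sector has half-opening less than pi/(2 s), so the sector bound applies in all of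
  them and F is bounded on the plane. The unit disc is bounded separately by compactness.\<close>

lemma phragmen_lindelof_rays:
  assumes F: "F \<in> R_ring s" and s: "s > 0" and R: "nonreal_rays_dissecting (pi / s) R"
    and C: "\<And>z. z \<in> R \<Longrightarrow> cmod (F z) \<le> C"
  shows "F constant_on UNIV"
proof (rule Liouville_theorem)
  show hol: "F holomorphic_on UNIV" using F by (simp add: R_ring_def)
  obtain A B where growth: "\<And>z. cmod (F z) \<le> B * exp (A * cmod z powr s)" using F by (auto simp: R_ring_def)
  obtain n and \<alpha> :: "nat \<Rightarrow> real" where \<alpha>: "\<alpha> n = \<alpha> 0 + 2 * pi"
    "\<And>i. i < n \<Longrightarrow> \<alpha> i < \<alpha> (Suc i)" "\<And>i. i < n \<Longrightarrow> \<alpha> (Suc i) - \<alpha> i < pi / s"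
    and Req: "R = {of_real t * cis (\<alpha> i) | t i. t > 0 \<and> i < n}"
    using R unfolding nonreal_rays_dissecting_def by blast
  have n: "n > 0" using \<alpha>(1) by (cases n) auto
  \<comment> \<open>The index \<open>n\<close> is included: it denotes the first ray again and
    closes the last sector.\<close>
  have ray: "of_real t * cis (\<alpha> i) \<in> R" if "t > 0" "i \<le> n" for t i
  proof (cases "i = n")
    case True
    have "cis (\<alpha> n) = cis (\<alpha> 0)" by (simp add: \<alpha>(1) cis_mult[symmetric])
    then show ?thesis using that n True by (auto simp: Req)
  next
    case False
    then have "i < n" using that by simp
    then show ?thesis using that unfolding Req by blast
  qed
  have "compact (F ` cball 0 1)"
    using hol by (intro compact_continuous_image) (auto intro: holomorphic_on_imp_continuous_on holomorphic_on_subset)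
  then obtain C' where C': "C' > 0" "\<And>z. cmod z \<le> 1 \<Longrightarrow> cmod (F z) \<le> C'"
    by (auto dest!: compact_imp_bounded simp: bounded_pos)
  define C'' where "C'' = max C C'"
  have "cmod (F z) \<le> C''" for z
  proof (cases "z = 0")
    case True
    then show ?thesis using C'(2)[of 0] by (simp add: C''_def)
  next
    case False
    \<comment> \<open>Subtracting 2 pi k moves the argument of z into the period that starts at
      \<open>\<alpha> 0\<close>.\<close>
    define k where "k = \<lfloor>(Arg z - \<alpha> 0) / (2 * pi)\<rfloor>"
    define \<theta> where "\<theta> = Arg z - 2 * pi * of_int k"
    have "of_int k \<le> (Arg z - \<alpha> 0) / (2 * pi)" "(Arg z - \<alpha> 0) / (2 * pi) < of_int k + 1"
      unfolding k_def by linarith+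
    then have "\<alpha> 0 \<le> \<theta>" "\<theta> < \<alpha> n" by (auto simp: \<theta>_def \<alpha>(1) field_simps)
    then obtain i where i: "i < n" "\<alpha> i \<le> \<theta>" "\<theta> \<le> \<alpha> (Suc i)" by (rule nat_interval_cover)
    have "cis \<theta> = cis (Arg z)"
      unfolding \<theta>_def by (simp add: cis_divide[symmetric] cis_multiple_2pi)
    then have z: "z = of_real (cmod z) * cis \<theta>" using rcis_cmod_Arg[of z] by (simp add: rcis_def)
    define \<gamma> \<beta> where "\<gamma> = (\<alpha> i + \<alpha> (Suc i)) / 2" and "\<beta> = (\<alpha> (Suc i) - \<alpha> i) / 2"
    have g: "\<gamma> - \<beta> = \<alpha> i" "\<gamma> + \<beta> = \<alpha> (Suc i)" "\<gamma> + (\<theta> - \<gamma>) = \<theta>" by (simp_all add: \<gamma>_def \<beta>_def field_simps)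
    have "cmod (F (of_real (cmod z) * cis (\<gamma> + (\<theta> - \<gamma>)))) \<le> C''"
    proof (rule phragmen_lindelof_sector[OF hol growth s])
      show "\<beta> > 0" using \<alpha>(2)[OF i(1)] by (simp add: \<beta>_def)
      show "s * \<beta> < pi / 2" using \<alpha>(3)[OF i(1)] s by (simp add: \<beta>_def field_simps)
      show "C'' > 0" using C' by (simp add: C''_def)
      show "cmod (F w) \<le> C''" if "cmod w \<le> 1" for w using C'(2)[OF that] by (simp add: C''_def)
      show "cmod (F (of_real t * cis (\<gamma> - \<beta>))) \<le> C''" "cmod (F (of_real t * cis (\<gamma> + \<beta>))) \<le> C''" if "t > 0" for t
        using C[OF ray[OF that, of i]] C[OF ray[OF that, of "Suc i"]] i(1) by (auto simp: g C''_def)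
      show "cmod z > 0" using False by simp
      show "\<bar>\<theta> - \<gamma>\<bar> \<le> \<beta>" using i by (auto simp: \<gamma>_def \<beta>_def field_simps abs_le_iff)
    qed
    then show ?thesis using z g by metis
  qed
  then show "bounded (range F)" by (auto simp: bounded_iff)
qed

lemma eventually_at_infinity_along:
  "eventually P (at_infinity_along R) \<longleftrightarrow> (\<exists>r. \<forall>z\<in>R. cmod z \<ge> r \<longrightarrow> P z)"
  by (auto simp: at_infinity_along_def eventually_inf_principal eventually_at_infinity)

text \<open>Convergence bounds F on the far part of the rays and compactness on the near part. Then
  F is constant, and its value is the limit.\<close>

lemma R_ring_vanishing_on_rays:
  assumes F: "F \<in> R_ring s" and s: "s > 0" and R: "nonreal_rays_dissecting (pi / s) R"
    and lim: "(F \<longlongrightarrow> 0) (at_infinity_along R)"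
  shows "F z = 0"
proof -
  have hol: "F holomorphic_on UNIV" using F by (simp add: R_ring_def)
  have "eventually (\<lambda>z. cmod (F z) < 1) (at_infinity_along R)"
    using tendstoD[OF lim, of 1] by simp
  then obtain r where r: "\<And>z. z \<in> R \<Longrightarrow> cmod z \<ge> r \<Longrightarrow> cmod (F z) < 1"
    by (auto simp: eventually_at_infinity_along)
  have "compact (F ` cball 0 r)"
    using hol by (intro compact_continuous_image) (auto intro: holomorphic_on_imp_continuous_on holomorphic_on_subset)
  then have "bounded (F ` cball 0 r)" by (rule compact_imp_bounded)
  then obtain C' where C': "\<And>z. cmod z \<le> r \<Longrightarrow> cmod (F z) \<le> C'"
    unfolding bounded_iff by (metis image_eqI mem_cball_0)
  have "cmod (F z) \<le> max C' 1" if "z \<in> R" for z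
    using r[OF that] C'[of z] by (cases "cmod z \<le> r") auto
  then have "F constant_on UNIV" by (rule phragmen_lindelof_rays[OF F s R])
  then obtain c where c: "\<And>z. F z = c" by (auto simp: constant_on_def)
  \<comment> \<open>Along the trivial filter every limit holds, so the constant is identified only
    once \<open>R\<close> is known to be unbounded.\<close>
  have "at_infinity_along R \<noteq> bot"
  proof -
    obtain n and \<alpha> :: "nat \<Rightarrow> real" where \<alpha>: "\<alpha> n = \<alpha> 0 + 2 * pi"
      and Req: "R = {of_real t * cis (\<alpha> i) | t i. t > 0 \<and> i < n}"
      using R unfolding nonreal_rays_dissecting_def by blast
    have n: "n > 0" using \<alpha>(1) by (cases n) auto
    have "\<exists>z\<in>R. cmod z \<ge> r" for r
    proof
      have "\<bar>r\<bar> + 1 > 0" by simp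
      then show "of_real (\<bar>r\<bar> + 1) * cis (\<alpha> 0) \<in> R" using n unfolding Req by blast
      show "r \<le> cmod (of_real (\<bar>r\<bar> + 1) * cis (\<alpha> 0))" by (simp only: norm_mult norm_of_real norm_cis) simp
    qed
    then show ?thesis
      by (auto simp: trivial_limit_def eventually_at_infinity_along)
  qed
  moreover have "F = (\<lambda>z. c)" using c by auto
  ultimately show ?thesis using lim c by (simp add: tendsto_const_iff)
qed

lemma R_ring_mult:
  assumes "f \<in> R_ring s" "g \<in> R_ring s"
  shows "(\<lambda>z. f z * g z) \<in> R_ring s"
proof -
  obtain A B A' B' where *: "A > 0" "B > 0" "A' > 0" "B' > 0"
    "\<And>z. cmod (f z) \<le> B * exp (A * cmod z powr s)" "\<And>z. cmod (g z) \<le> B' * exp (A' * cmod z powr s)"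
    using assms by (auto simp: R_ring_def)
  have "cmod (f z * g z) \<le> (B * B') * exp ((A + A') * cmod z powr s)" for z
  proof -
    have "cmod (f z * g z) \<le> (B * exp (A * cmod z powr s)) * (B' * exp (A' * cmod z powr s))"
      unfolding norm_mult using * by (intro mult_mono) auto
    then show ?thesis by (simp add: algebra_simps exp_add)
  qed
  moreover have "(\<lambda>z. f z * g z) holomorphic_on UNIV" using assms by (auto simp: R_ring_def intro: holomorphic_intros)
  ultimately show ?thesis using * unfolding R_ring_def
    by (intro CollectI conjI exI[of _ "A + A'"] exI[of _ "B * B'"]) auto
qed

lemma R_ring_diff:
  assumes "f \<in> R_ring s" "g \<in> R_ring s"
  shows "(\<lambda>z. f z - g z) \<in> R_ring s"
proof -
  obtain A B A' B' where *: "A > 0" "B > 0" "A' > 0" "B' > 0"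
    "\<And>z. cmod (f z) \<le> B * exp (A * cmod z powr s)" "\<And>z. cmod (g z) \<le> B' * exp (A' * cmod z powr s)"
    using assms by (auto simp: R_ring_def)
  have "cmod (f z - g z) \<le> (B + B') * exp ((A + A') * cmod z powr s)" for z
  proof -
    have "cmod (f z - g z) \<le> B * exp (A * cmod z powr s) + B' * exp (A' * cmod z powr s)"
      using norm_triangle_ineq4[of "f z" "g z"] *(5,6)[of z] by linarith
    also have "\<dots> \<le> B * exp ((A + A') * cmod z powr s) + B' * exp ((A + A') * cmod z powr s)"
      using * by (intro add_mono mult_left_mono) (auto simp: algebra_simps)
    finally show ?thesis by (simp add: algebra_simps)
  qed
  moreover have "(\<lambda>z. f z - g z) holomorphic_on UNIV" using assms by (auto simp: R_ring_def intro: holomorphic_intros)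
  ultimately show ?thesis using * unfolding R_ring_def
    by (intro CollectI conjI exI[of _ "A + A'"] exI[of _ "B + B'"]) auto
qed

subsection \<open>Recovering the potential\<close>

text \<open>Henstock's lemma bounds the sum of |measure(k) h(x) - integral of h over k|. With all
  interval integrals zero this sum is exactly a Riemann sum of |h|, so |h| has integral 0.\<close>

lemma AE_zero_of_interval_integrals:
  fixes h :: "real \<Rightarrow> complex"
  assumes h: "h absolutely_integrable_on {p..r}"
    and zero: "\<And>x y. p \<le> x \<Longrightarrow> x \<le> y \<Longrightarrow> y \<le> r \<Longrightarrow> integral {x..y} h = 0"
  shows "AE x\<in>{p..r} in lebesgue. h x = 0"
proof -
  have hi: "h integrable_on cbox p r" using h by (simp add: absolutely_integrable_on_def)
  have "((\<lambda>x. cmod (h x)) has_integral 0) (cbox p r)"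
    unfolding has_integral
  proof (intro allI impI)
    fix e :: real assume "e > 0"
    obtain \<gamma> where \<gamma>: "gauge \<gamma>" "\<And>P. \<lbrakk>P tagged_partial_division_of (cbox p r); \<gamma> fine P\<rbrakk> \<Longrightarrow>
             sum (\<lambda>(x,k). norm(measure lborel k *\<^sub>R h x - integral k h)) P < e"
      using Henstock_lemma[OF hi \<open>e > 0\<close>] by blast
    show "\<exists>\<gamma>. gauge \<gamma> \<and> (\<forall>\<D>. \<D> tagged_division_of cbox p r \<and> \<gamma> fine \<D> \<longrightarrow>
        norm ((\<Sum>(x, k)\<in>\<D>. measure lborel k *\<^sub>R cmod (h x)) - 0) < e)"
    proof (intro exI conjI allI impI)
      fix P assume P: "P tagged_division_of cbox p r \<and> \<gamma> fine P"
      have "(\<Sum>(x, k)\<in>P. measure lborel k *\<^sub>R cmod (h x)) = (\<Sum>(x,k)\<in>P. norm(measure lborel k *\<^sub>R h x - integral k h))"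
      proof (rule sum.cong[OF refl], clarify)
        fix x k assume xk: "(x, k) \<in> P"
        obtain u v where k: "k = cbox u v" using P xk by blast
        have "k \<subseteq> cbox p r" "x \<in> k" using P xk by (auto dest: tagged_division_ofD)
        then have "integral k h = 0" using zero[of u v] by (auto simp: k)
        then show "measure lborel k *\<^sub>R cmod (h x) = norm (measure lborel k *\<^sub>R h x - integral k h)" by simp
      qed
      also have "\<dots> < e" using \<gamma>(2) P by (simp add: tagged_division_of_def)
      finally have "(\<Sum>(x, k)\<in>P. measure lborel k *\<^sub>R cmod (h x)) < e" .
      moreover have "(\<Sum>(x, k)\<in>P. measure lborel k *\<^sub>R cmod (h x)) \<ge> 0" by (intro sum_nonneg) auto
      ultimately show "norm ((\<Sum>(x, k)\<in>P. measure lborel k *\<^sub>R cmod (h x)) - 0) < e" by simp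
    qed (rule \<gamma>(1))
  qed
  then have "integral {p..r} (\<lambda>x. cmod (h x)) = 0" by (auto simp: integral_unique)
  moreover have hn: "set_integrable lebesgue {p..r} (\<lambda>x. cmod (h x))"
    using absolutely_integrable_norm[OF h] by (simp add: o_def)
  ultimately have "(LINT x:{p..r}|lebesgue. cmod (h x)) = 0"
    using set_lebesgue_integral_eq_integral(2)[OF hn] by simp
  then have "AE x in lebesgue. indicator {p..r} x *\<^sub>R cmod (h x) = 0"
    using hn unfolding set_lebesgue_integral_def set_integrable_def
    by (subst integral_nonneg_eq_0_iff_AE[symmetric]) auto
  then show ?thesis by eventually_elim (auto simp: indicator_def split: if_splits)
qed

text \<open>Countably many compact intervals exhaust the open one, so their exceptional null sets
  may be united.\<close>

lemma AE_open_interval: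
  fixes c d :: real
  assumes "\<And>p r. c < p \<Longrightarrow> p \<le> r \<Longrightarrow> r < d \<Longrightarrow> AE x\<in>{p..r} in M. P x"
  shows "AE x\<in>{c<..<d} in M. P x"
proof -
  have "AE x in M. \<forall>n. x \<in> {c + 1 / Suc n .. d - 1 / Suc n} \<longrightarrow> P x"
  proof (rule AE_all_countable[THEN iffD2], rule allI)
    fix n :: nat
    show "AE x in M. x \<in> {c + 1 / Suc n .. d - 1 / Suc n} \<longrightarrow> P x"
    proof (cases "c + 1 / Suc n \<le> d - 1 / Suc n")
      case True
      then show ?thesis using assms[OF _ True] by simp
    qed simp
  qed
  then show ?thesis
  proof eventually_elim
    case (elim x)
    show ?case
    proof
      assume x: "x \<in> {c<..<d}"
      then obtain n where "1 / Suc n < min (x - c) (d - x)"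
        using nat_approx_posE[of "min (x - c) (d - x)"] by auto
      then have "x \<in> {c + 1 / Suc n .. d - 1 / Suc n}" by (auto simp: min_def split: if_splits)
      with elim show "P x" by blast
    qed
  qed
qed

text \<open>Proportional solutions have proportional derivatives; in integrated form, (q1 - q0) u1
  has integral zero over every subinterval because the terms with z cancel. As u1 has no zeros, the
  potentials agree almost everywhere.\<close>

lemma potential_unique:
  assumes u0: "solution a b q0 z u0" and u1: "solution a b q1 z u1"
    and sub: "{c<..<d} \<subseteq> einterval a b"
    and pr_eq: "\<And>x. x \<in> {c<..<d} \<Longrightarrow> u1 x = \<sigma> * u0 x" and nz: "\<And>x. x \<in> {c<..<d} \<Longrightarrow> u1 x \<noteq> 0"
  shows "AE x\<in>{c<..<d} in lebesgue. q0 x = q1 x"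
proof (rule AE_open_interval)
  fix p r assume pr: "c < p" "p \<le> r" "r < d"
  have pin: "p \<in> einterval a b" and rin: "r \<in> einterval a b" and pr_sub: "{p..r} \<subseteq> {c<..<d}" using pr sub by auto
  note \<tau>0 = u0[unfolded solution_def] and \<tau>1 = u1[unfolded solution_def]
  note i0 = tau_rel_indef_integral_vderiv[OF \<tau>0 pin rin] and i1 = tau_rel_indef_integral_vderiv[OF \<tau>1 pin rin]
  have d: "vderiv u1 x = \<sigma> * vderiv u0 x" if x: "x \<in> {c<..<d}" for x
  proof -
    have "(u0 has_vector_derivative vderiv u0 x) (at x)" using tau_rel_vderiv[OF \<tau>0] x sub by auto
    then have "((\<lambda>x. \<sigma> * u0 x) has_vector_derivative \<sigma> * vderiv u0 x) (at x)"
      by (rule has_vector_derivative_mult_right)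
    then have "(u1 has_vector_derivative \<sigma> * vderiv u0 x) (at x)"
      by (rule has_vector_derivative_transform_within_open[of _ _ _ "{c<..<d}"]) (use x pr_eq in auto)
    then show ?thesis by (rule vector_derivative_at)
  qed
  define h where "h = (\<lambda>x. (of_real (q1 x) * u1 x - z * u1 x) + (-\<sigma>) * (of_real (q0 x) * u0 x - z * u0 x))"
  have ih: "indef_integral p r (\<lambda>x. vderiv u1 x + (-\<sigma>) * vderiv u0 x) h"
    unfolding h_def by (intro indef_integral_add indef_integral_cmult i0 i1)
  have "AE x\<in>{p..r} in lebesgue. h x = 0"
  proof (rule AE_zero_of_interval_integrals)
    show "h absolutely_integrable_on {p..r}" using ih by (simp add: indef_integral_def)
    fix x y assume xy: "p \<le> x" "x \<le> y" "y \<le> r"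
    have "x \<in> {c<..<d}" "y \<in> {c<..<d}" using xy pr by auto
    then show "integral {x..y} h = 0" using integral_unique[OF indef_integralD[OF ih xy]] d by simp
  qed
  then show "AE x\<in>{p..r} in lebesgue. q0 x = q1 x"
  proof eventually_elim
    case (elim x)
    show ?case
    proof
      assume x: "x \<in> {p..r}"
      then have xx: "x \<in> {c<..<d}" using pr_sub by auto
      have "of_real (q1 x) * u1 x - of_real (q0 x) * (\<sigma> * u0 x) - z * (u1 x - \<sigma> * u0 x) = h x"
        by (simp add: h_def algebra_simps)
      then have "of_real (q1 x) * u1 x = of_real (q0 x) * u1 x" using elim x pr_eq[OF xx] by simp
      then show "q0 x = q1 x" using nz[OF xx] by simp
    qed
  qed
qed

text \<open>The quotient v/u is continuous with values 1 and -1 only, hence constant on the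
  connected interval.\<close>

lemma continuous_square_eq_imp_proportional:
  fixes u v :: "real \<Rightarrow> complex"
  assumes cu: "continuous_on {c<..<d} u" and cv: "continuous_on {c<..<d} v"
    and nz: "\<And>x. x \<in> {c<..<d} \<Longrightarrow> u x \<noteq> 0" and sq: "\<And>x. x \<in> {c<..<d} \<Longrightarrow> (v x)\<^sup>2 = (u x)\<^sup>2"
  shows "\<exists>\<sigma>. \<forall>x\<in>{c<..<d}. v x = \<sigma> * u x"
proof -
  have "(\<lambda>x. v x / u x) constant_on {c<..<d}"
  proof (rule continuous_finite_range_constant)
    show "connected {c<..<d}" by simp
    show "continuous_on {c<..<d} (\<lambda>x. v x / u x)" using cu cv nz by (intro continuous_intros) auto
    have "(\<lambda>x. v x / u x) ` {c<..<d} \<subseteq> {1, -1}"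
    proof (rule image_subsetI)
      fix x assume x: "x \<in> {c<..<d}"
      have "(v x / u x)\<^sup>2 = 1" using sq[OF x] nz[OF x] by (simp add: power_divide)
      then show "v x / u x \<in> {1, -1}" by (simp add: power2_eq_1_iff)
    qed
    then show "finite ((\<lambda>x. v x / u x) ` {c<..<d})" by (rule finite_subset) simp
  qed
  then obtain \<sigma> where "\<And>x. x \<in> {c<..<d} \<Longrightarrow> v x / u x = \<sigma>" by (auto simp: constant_on_def)
  then have "v x = \<sigma> * u x" if "x \<in> {c<..<d}" for x using nz[OF that] that by (metis nonzero_eq_divide_eq)
  then show ?thesis by blast
qed

section \<open>Nonvanishing, sign conditions and comparison of solutions at nonreal energies\<close>

lemma integral_cmod_square_zero:
  assumes c: "continuous_on (einterval a b) u" and L2: "set_integrable lebesgue (einterval a b) (\<lambda>x. (cmod (u x))\<^sup>2)"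
    and zero: "(LINT x:einterval a b|lebesgue. (cmod (u x))\<^sup>2) = 0" and x: "x \<in> einterval a b"
  shows "u x = 0"
proof -
  obtain y where y: "y \<in> einterval a b" "x < y" using einterval_dense_right[OF x] .
  have sub: "{x..y} \<subseteq> einterval a b" by (rule einterval_Icc_subset[OF x y(1)])
  have i: "set_integrable lebesgue {x..y} (\<lambda>x. (cmod (u x))\<^sup>2)"
    by (rule set_integrable_subset[OF L2 _ sub]) simp
  have "integral {x..y} (\<lambda>x. (cmod (u x))\<^sup>2) \<le> integral (einterval a b) (\<lambda>x. (cmod (u x))\<^sup>2)"
    using set_lebesgue_integral_eq_integral(1)[OF i] set_lebesgue_integral_eq_integral(1)[OF L2] sub
    by (intro integral_subset_le) auto
  also have "\<dots> = 0" using set_lebesgue_integral_eq_integral(2)[OF L2] zero by simp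
  finally have "integral {x..y} (\<lambda>x. (cmod (u x))\<^sup>2) = 0"
    using integral_nonneg[OF set_lebesgue_integral_eq_integral(1)[OF i]] by auto
  then have "((\<lambda>x. (cmod (u x))\<^sup>2) has_integral 0) (cbox x y)"
    using set_lebesgue_integral_eq_integral(1)[OF i] by (metis box_real(2) integrable_integral)
  moreover have "continuous_on (cbox x y) (\<lambda>x. (cmod (u x))\<^sup>2)"
    using continuous_on_subset[OF c sub] by (auto intro!: continuous_intros)
  ultimately have "(cmod (u x))\<^sup>2 = 0"
    using y by (intro has_integral_0_cbox_imp_0[of x y "\<lambda>x. (cmod (u x))\<^sup>2" x]) auto
  then show ?thesis by simp
qed

text \<open>The sign follows from Im(-\<kappa>^2) = -2 Re \<kappa> Im \<kappa>. A zero of u at x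
  would remove the boundary term, so u would have no mass on (a,x) and vanish there, against the
  Wronskian being 1. In other words, a nonreal number is no Dirichlet eigenvalue on (a,x).\<close>

lemma herglotz_solution_left:
  assumes H: "separated_realization a b q v w H" and u: "solution a b q (- \<kappa>\<^sup>2) u"
    and dom: "in_domain_near_left a b q v u"
    and \<kappa>: "Re \<kappa> > 0" "Im \<kappa> \<noteq> 0" and W: "\<And>x. x \<in> einterval a b \<Longrightarrow> wronskian y u x = 1"
  shows "herglotz_solution a b q \<kappa> u"
  unfolding herglotz_solution_def
proof (intro conjI ballI u)
  note \<tau> = u[unfolded solution_def]
  fix x assume x: "x \<in> einterval a b"
  define I where "I = (LINT x:einterval a x|lebesgue. (cmod (u x))\<^sup>2)"
  have Im: "Im (cnj (u x) * vderiv u x) = 2 * Re \<kappa> * Im \<kappa> * I"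
    using Im_cnj_vderiv_left[OF H u dom x] by (simp add: I_def Im_power2)
  have "I \<ge> 0" unfolding I_def set_lebesgue_integral_def by (intro integral_nonneg_AE) auto
  then have "0 \<le> 2 * Re \<kappa> * I * (Im \<kappa>)\<^sup>2" using \<kappa>(1) by simp
  also have "\<dots> = 2 * Re \<kappa> * Im \<kappa> * I * Im \<kappa>" by (simp only: power2_eq_square mult_ac)
  finally show "Im (cnj (u x) * vderiv u x) * Im \<kappa> \<ge> 0" unfolding Im .
  show "u x \<noteq> 0"
  proof
    assume "u x = 0"
    then have I: "I = 0" using Im \<kappa> by simp
    have sub: "einterval a x \<subseteq> einterval a b" using einterval_split[OF x x order_refl] by auto
    have c: "continuous_on (einterval a x) u"
      by (rule continuous_on_subset[OF tau_rel_continuous(1)[OF \<tau>] sub])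
    have "u \<in> L2 a x"
      using dom x tau_rel_continuous(1)[OF \<tau>] by (intro L2_near_left_imp_L2) (auto simp: in_domain_near_left_def)
    then have z: "u t = 0" if "t \<in> einterval a x" for t
      using integral_cmod_square_zero[OF c _ I[unfolded I_def] that] by (simp add: L2_def)
    obtain t where t: "t \<in> einterval a b" "t < x" using einterval_dense_left[OF x] .
    then have t': "t \<in> einterval a x" by (simp add: einterval_def)
    have "((\<lambda>x. 0) has_vector_derivative 0) (at t)" by simp
    then have "(u has_vector_derivative 0) (at t)"
      by (rule has_vector_derivative_transform_within_open[of _ _ _ "einterval a x"]) (use t' z in \<open>auto simp: open_einterval\<close>)
    then have "vderiv u t = 0" by (rule vector_derivative_at)
    then show False using W[OF t(1)] z[OF t'] by (simp add: wronskian_def)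
  qed
qed

text \<open>Both solutions grow like exp(Re \<kappa> t) up to exp(K |s - t|) in either direction, so
  the rate Re \<kappa> cancels from the comparison. This transports bounds on a ratio of solutions
  from one point to another, uniformly in the energy; the product form avoids division.\<close>

lemma herglotz_ratio_bound:
  assumes u: "solution a b q z u" and v: "solution a b q' z v"
    and x: "{x1..x2} \<subseteq> einterval a b" "s \<in> {x1..x2}" "t \<in> {x1..x2}"
    and Ku: "\<And>x. x \<in> {x1..x2} \<Longrightarrow> cmod (vderiv u x - \<kappa> * u x) \<le> K * cmod (u x)"
    and Kv: "\<And>x. x \<in> {x1..x2} \<Longrightarrow> cmod (vderiv v x - \<kappa> * v x) \<le> K * cmod (v x)"
  shows "cmod (u s) * cmod (v t) \<le> exp (2 * K * \<bar>s - t\<bar>) * (cmod (v s) * cmod (u t))"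
proof (cases "t \<le> s")
  case True
  have i: "t \<in> einterval a b" "s \<in> einterval a b" using x by auto
  have "cmod (u s) * (exp ((Re \<kappa> - K) * (s - t)) * cmod (v t)) \<le> (exp ((Re \<kappa> + K) * (s - t)) * cmod (u t)) * cmod (v s)"
    using x Ku Kv by (intro mult_mono solution_growth(1)[OF u i True] solution_growth(2)[OF v i True]) auto
  then have "(cmod (u s) * cmod (v t)) * exp ((Re \<kappa> - K) * (s - t)) \<le>
     (exp (2 * K * (s - t)) * (cmod (v s) * cmod (u t))) * exp ((Re \<kappa> - K) * (s - t))"
    by (simp add: mult_ac mult_exp_exp) (simp add: algebra_simps)
  then show ?thesis using True by simp
next
  case False
  then have le: "s \<le> t" by simp
  have i: "t \<in> einterval a b" "s \<in> einterval a b" using x by auto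
  have "(exp ((Re \<kappa> - K) * (t - s)) * cmod (u s)) * cmod (v t) \<le> cmod (u t) * (exp ((Re \<kappa> + K) * (t - s)) * cmod (v s))"
    using x Ku Kv by (intro mult_mono solution_growth(1)[OF v i(2,1) le] solution_growth(2)[OF u i(2,1) le]) auto
  then have "(cmod (u s) * cmod (v t)) * exp ((Re \<kappa> - K) * (t - s)) \<le>
     (exp (2 * K * (t - s)) * (cmod (v s) * cmod (u t))) * exp ((Re \<kappa> - K) * (t - s))"
    by (simp add: mult_ac mult_exp_exp) (simp add: algebra_simps)
  then show ?thesis using le by simp
qed

text \<open>There are finitely many nonreal rays, so |Im z| \<ge> m |z| on them with m > 0. Since
  |Im z| = 2 Re \<kappa> |Im \<kappa>| and each factor is at most |\<kappa>|, each is also at least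
  m/2 |\<kappa>|.\<close>

lemma rays_csqrt:
  assumes "nonreal_rays_dissecting \<delta> R"
  obtains \<eta> where "\<eta> > 0"
    "\<And>z. z \<in> R \<Longrightarrow> Re (csqrt (- z)) \<ge> \<eta> * cmod (csqrt (- z)) \<and> \<bar>Im (csqrt (- z))\<bar> \<ge> \<eta> * cmod (csqrt (- z))"
    "\<And>z. z \<in> R \<Longrightarrow> z \<notin> \<real>"
proof -
  obtain n and \<alpha> :: "nat \<Rightarrow> real" where n: "\<alpha> n = \<alpha> 0 + 2 * pi" and \<alpha>: "\<And>i. i < n \<Longrightarrow> sin (\<alpha> i) \<noteq> 0"
    and Req: "R = {of_real t * cis (\<alpha> i) | t i. t > 0 \<and> i < n}"
    using assms unfolding nonreal_rays_dissecting_def by blast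
  have "n > 0" using n by (cases n) auto
  define m where "m = Min ((\<lambda>i. \<bar>sin (\<alpha> i)\<bar>) ` {..<n})"
  have m: "m > 0" unfolding m_def using \<alpha> \<open>n > 0\<close> by (subst Min_gr_iff) auto
  have Im_z: "\<bar>Im z\<bar> \<ge> m * cmod z" "Im z \<noteq> 0" if z: "z \<in> R" for z
  proof -
    obtain t i where ti: "z = of_real t * cis (\<alpha> i)" "t > 0" "i < n" using z unfolding Req by blast
    have "m \<le> \<bar>sin (\<alpha> i)\<bar>" unfolding m_def using ti by (intro Min_le) auto
    moreover have "\<bar>Im z\<bar> = t * \<bar>sin (\<alpha> i)\<bar>" "cmod z = t" using ti by (auto simp: abs_mult norm_mult)
    ultimately show "\<bar>Im z\<bar> \<ge> m * cmod z" using ti by (simp add: mult.commute)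
    show "Im z \<noteq> 0" using ti \<alpha> by auto
  qed
  show thesis
  proof (rule that[of "m / 2"])
    show "m / 2 > 0" using m by simp
    fix z assume z: "z \<in> R"
    show "z \<notin> \<real>" using Im_z(2)[OF z] by (auto simp: complex_is_Real_iff)
    define \<kappa> where "\<kappa> = csqrt (- z)"
    have zk: "z = - \<kappa>\<^sup>2" by (simp add: \<kappa>_def)
    have Re: "Re \<kappa> \<ge> 0" using csqrt_principal[of "-z"] by (auto simp: \<kappa>_def)
    have "\<kappa> \<noteq> 0" using Im_z(2)[OF z] zk by auto
    then have kp: "cmod \<kappa> > 0" by simp
    have "m * (cmod \<kappa>)\<^sup>2 \<le> 2 * (Re \<kappa> * \<bar>Im \<kappa>\<bar>)"
      using Im_z(1)[OF z] Re by (simp add: zk norm_power abs_mult Im_power2)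
    moreover have "Re \<kappa> * \<bar>Im \<kappa>\<bar> \<le> Re \<kappa> * cmod \<kappa>" "Re \<kappa> * \<bar>Im \<kappa>\<bar> \<le> cmod \<kappa> * \<bar>Im \<kappa>\<bar>"
      using Re abs_Im_le_cmod[of \<kappa>] complex_Re_le_cmod[of \<kappa>] by (auto intro: mult_left_mono mult_right_mono)
    ultimately have "(m / 2 * cmod \<kappa>) * cmod \<kappa> \<le> Re \<kappa> * cmod \<kappa>" "(m / 2 * cmod \<kappa>) * cmod \<kappa> \<le> \<bar>Im \<kappa>\<bar> * cmod \<kappa>"
      by (simp_all add: power2_eq_square mult_ac)
    then show "Re \<kappa> \<ge> m / 2 * cmod \<kappa> \<and> \<bar>Im \<kappa>\<bar> \<ge> m / 2 * cmod \<kappa>" using kp by simp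
  qed
qed

lemma csqrt_uminus_nonreal:
  assumes "z \<notin> \<real>"
  shows "Re (csqrt (- z)) > 0" "Im (csqrt (- z)) \<noteq> 0"
proof -
  have "Im ((csqrt (- z))\<^sup>2) \<noteq> 0" using assms by (simp add: complex_is_Real_iff)
  then have "Re (csqrt (- z)) \<noteq> 0" "Im (csqrt (- z)) \<noteq> 0" by (auto simp only: Im_power2)
  then show "Re (csqrt (- z)) > 0" "Im (csqrt (- z)) \<noteq> 0"
    using csqrt_principal[of "- z"] by auto
qed

text \<open>The sign is opposite to the one in \<open>herglotz_solution\<close>, as the mass now
  lies to the right of x. This is the input on the Weyl solution in
  \<open>green_function_bound\<close>.\<close>

lemma in_domain_near_right_Im:
  assumes H: "separated_realization a b q v w H" and u: "solution a b q (- \<kappa>\<^sup>2) u"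
    and dom: "in_domain_near_right a b q w u" and \<kappa>: "Re \<kappa> > 0" and x: "x \<in> einterval a b"
  shows "Im (cnj (u x) * vderiv u x) * Im \<kappa> \<le> 0"
proof -
  define I where "I = (LINT x:einterval x b|lebesgue. (cmod (u x))\<^sup>2)"
  have Im: "Im (cnj (u x) * vderiv u x) = - (2 * Re \<kappa> * Im \<kappa> * I)"
    using Im_cnj_vderiv_right[OF H u dom x] by (simp add: I_def Im_power2)
  have "I \<ge> 0" unfolding I_def set_lebesgue_integral_def by (intro integral_nonneg_AE) auto
  then have "0 \<le> 2 * Re \<kappa> * I * (Im \<kappa>)\<^sup>2" using \<kappa> by simp
  also have "\<dots> = - (- (2 * Re \<kappa> * Im \<kappa> * I) * Im \<kappa>)" by (simp add: power2_eq_square)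
  finally show ?thesis unfolding Im by simp
qed

lemma wronskian_add_cmult:
  assumes "solution a b q z u" "solution a b q z v" "x \<in> einterval a b"
  shows "wronskian (\<lambda>x. u x + C * v x) v x = wronskian u v x"
proof -
  have "((\<lambda>x. u x + C * v x) has_vector_derivative vderiv u x + C * vderiv v x) (at x)"
    using assms unfolding solution_def
    by (intro derivative_intros has_vector_derivative_mult_right) (auto intro: tau_rel_vderiv)
  then have "vderiv (\<lambda>x. u x + C * v x) x = vderiv u x + C * vderiv v x" by (rule vector_derivative_at)
  then show ?thesis by (simp add: wronskian_def algebra_simps)
qed

text \<open>The derivative of \<theta>/\<phi> is -W(\<theta>,\<phi>)/\<phi>^2 = -1/\<phi>^2, so a
  constant difference of the two quotients equates the inverse squares.\<close>

lemma inverse_square_eq_of_quotient_difference: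
  assumes \<phi>: "\<And>j. j \<in> {0, 1::nat} \<Longrightarrow> solution a b (q j) z (\<phi> j)"
    and \<theta>: "\<And>j. j \<in> {0, 1} \<Longrightarrow> solution a b (q j) z (\<theta> j)"
    and W: "\<And>j x. j \<in> {0, 1} \<Longrightarrow> x \<in> einterval a b \<Longrightarrow> wronskian (\<theta> j) (\<phi> j) x = 1"
    and nz: "\<And>j x. j \<in> {0, 1} \<Longrightarrow> x \<in> einterval a b \<Longrightarrow> \<phi> j x \<noteq> 0"
    and sub: "{l<..<r} \<subseteq> einterval a b"
    and eq: "\<And>x. x \<in> {l<..<r} \<Longrightarrow> \<theta> 0 x / \<phi> 0 x - \<theta> 1 x / \<phi> 1 x = C"
    and x: "x \<in> {l<..<r}"
  shows "(\<phi> 1 x)\<^sup>2 = (\<phi> 0 x)\<^sup>2"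
proof -
  have xin: "x \<in> einterval a b" using x sub by auto
  have d: "((\<lambda>x. \<theta> j x / \<phi> j x) has_vector_derivative - 1 / (\<phi> j x)\<^sup>2) (at x)" if j: "j \<in> {0, 1}" for j
  proof -
    note nzx = nz[OF j xin]
    have "(\<phi> j has_vector_derivative vderiv (\<phi> j) x) (at x)" "(\<theta> j has_vector_derivative vderiv (\<theta> j) x) (at x)"
      using \<phi>[OF j] \<theta>[OF j] xin by (auto simp: solution_def intro: tau_rel_vderiv)
    then have "((\<lambda>x. \<theta> j x / \<phi> j x) has_derivative (\<lambda>h. - \<theta> j x * (inverse (\<phi> j x) * (h *\<^sub>R vderiv (\<phi> j) x) * inverse (\<phi> j x))
        + h *\<^sub>R vderiv (\<theta> j) x / \<phi> j x)) (at x)"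
      unfolding has_vector_derivative_def by (intro has_derivative_divide nzx)
    then have "((\<lambda>x. \<theta> j x / \<phi> j x) has_vector_derivative
       - \<theta> j x * (inverse (\<phi> j x) * vderiv (\<phi> j) x * inverse (\<phi> j x)) + vderiv (\<theta> j) x / \<phi> j x) (at x)"
      unfolding has_vector_derivative_def
      by (rule has_derivative_eq_rhs) (simp add: fun_eq_iff scaleR_conv_of_real algebra_simps)
    moreover have "- \<theta> j x * (inverse (\<phi> j x) * vderiv (\<phi> j) x * inverse (\<phi> j x)) + vderiv (\<theta> j) x / \<phi> j x
       = - wronskian (\<theta> j) (\<phi> j) x / (\<phi> j x)\<^sup>2"
      using nzx by (simp add: wronskian_def field_simps power2_eq_square)
    ultimately show ?thesis by (simp add: W[OF j xin])
  qed
  have "((\<lambda>x. \<theta> 0 x / \<phi> 0 x - \<theta> 1 x / \<phi> 1 x) has_vector_derivative (- 1 / (\<phi> 0 x)\<^sup>2 - - 1 / (\<phi> 1 x)\<^sup>2)) (at x)"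
    by (intro derivative_intros d) auto
  moreover have "((\<lambda>x. \<theta> 0 x / \<phi> 0 x - \<theta> 1 x / \<phi> 1 x) has_vector_derivative 0) (at x)"
    by (rule has_vector_derivative_transform_within_open[of "\<lambda>x. C" _ _ "{l<..<r}"]) (use x eq in auto)
  ultimately have "- 1 / (\<phi> 0 x)\<^sup>2 - - 1 / (\<phi> 1 x)\<^sup>2 = 0" by (rule vector_derivative_unique_at)
  then show ?thesis using nz[of 0 x] nz[of 1 x] xin by (simp add: field_simps)
qed

theorem theorem7p2:
  fixes a :: real and b :: ereal and c s :: real
    and q :: "nat \<Rightarrow> real \<Rightarrow> real"
    and v w :: "nat \<Rightarrow> real \<Rightarrow> complex"
    and H :: "nat \<Rightarrow> L2_graph"
    and x0 :: "nat \<Rightarrow> real"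
    and \<mu> \<nu> :: "nat \<Rightarrow> nat \<Rightarrow> real"
    and \<phi> \<theta> :: "nat \<Rightarrow> complex \<Rightarrow> real \<Rightarrow> complex"
    and M :: "nat \<Rightarrow> complex \<Rightarrow> complex"
    and R :: "complex set"
    and f :: "complex \<Rightarrow> complex"
  assumes "ereal a < b"
    and q: "\<And>j. j \<in> {0, 1} \<Longrightarrow> L1_loc a b (q j)"
    and H: "\<And>j. j \<in> {0, 1} \<Longrightarrow> separated_realization a b (q j) (v j) (w j) (H j)"
    and x0: "\<And>j. j \<in> {0, 1} \<Longrightarrow> x0 j \<in> einterval a b"
    and spectra: "\<And>j. j \<in> {0, 1} \<Longrightarrow> discrete_spectra a b (q j) (v j) (x0 j) (\<mu> j) (\<nu> j)"
    and summ: "\<And>j \<sigma>. j \<in> {0, 1} \<Longrightarrow> \<sigma> > 1/2 \<Longrightarrow>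
                 summable (\<lambda>k. 1 / (1 + \<bar>\<mu> j (Suc k)\<bar> powr \<sigma>))"
    and gaps: "\<And>j. j \<in> {0, 1} \<Longrightarrow> \<exists>r>0. eventually (\<lambda>k.
                 \<mu> j k - \<nu> j (k - 1) \<ge> \<nu> j (k - 1) powr (- r) + \<mu> j k powr (- r) \<and>
                 \<nu> j k - \<mu> j k \<ge> \<nu> j k powr (- r) + \<mu> j k powr (- r)) sequentially"
    and c: "c \<in> einterval a b"
    and s: "s \<ge> 1/2"
    and \<phi>: "\<And>j. j \<in> {0, 1} \<Longrightarrow> real_entire_solution a b (q j) (\<phi> j)"
    and \<theta>: "\<And>j. j \<in> {0, 1} \<Longrightarrow> real_entire_solution a b (q j) (\<theta> j)"
    and \<phi>_growth: "\<And>j x. j \<in> {0, 1} \<Longrightarrow> x \<in> einterval a b \<Longrightarrow> (\<lambda>z. \<phi> j z x) \<in> R_ring s"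
    and \<theta>_growth: "\<And>j x. j \<in> {0, 1} \<Longrightarrow> x \<in> einterval a b \<Longrightarrow> (\<lambda>z. \<theta> j z x) \<in> R_ring s"
    and \<phi>_domain: "\<And>j z. j \<in> {0, 1} \<Longrightarrow> in_domain_near_left a b (q j) (v j) (\<phi> j z)"
    and wronskian: "\<And>j z x. j \<in> {0, 1} \<Longrightarrow> x \<in> einterval a b \<Longrightarrow> wronskian (\<theta> j z) (\<phi> j z) x = 1"
    and M: "\<And>j. j \<in> {0, 1} \<Longrightarrow> singular_weyl_m a b (q j) (w j) (\<phi> j) (\<theta> j) (M j)"
    and R: "nonreal_rays_dissecting (pi / s) R"
    and ratio: "\<exists>x\<in>{a<..<c}. ((\<lambda>z. \<phi> 1 z x / \<phi> 0 z x) \<longlongrightarrow> 1) (at_infinity_along R)"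
    and f: "f \<in> R_ring s"
    and M_diff: "\<And>\<epsilon>. 0 < \<epsilon> \<Longrightarrow> \<epsilon> < c - a \<Longrightarrow>
                   (\<lambda>z. M 1 z - M 0 z - f z) \<in> O[at_infinity_along R](\<lambda>z. 1 / (\<phi> 0 z (c - \<epsilon>))\<^sup>2)"
  shows "AE x\<in>{a<..<c} in lebesgue. q 0 x = q 1 x"
proof -
  define \<kappa> where "\<kappa> z = csqrt (- z)" for z :: complex
  have \<kappa>2: "- (\<kappa> z)\<^sup>2 = z" for z by (simp add: \<kappa>_def)
  have \<kappa>_norm: "cmod (\<kappa> z) = sqrt (cmod z)" for z
    by (rule real_sqrt_unique[symmetric]) (simp_all add: \<kappa>_def flip: norm_power)
  have \<phi>_sol: "solution a b (q j) z (\<phi> j z)" and \<theta>_sol: "solution a b (q j) z (\<theta> j z)" if "j \<in> {0, 1}" for j z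
    using \<phi>[OF that] \<theta>[OF that] by (auto simp: real_entire_solution_def)
  have herglotz: "herglotz_solution a b (q j) (\<kappa> z) (\<phi> j z)" if j: "j \<in> {0, 1}" and z: "z \<notin> \<real>" for j z
  proof (rule herglotz_solution_left[OF H[OF j] _ \<phi>_domain[OF j] _ _ wronskian[OF j]])
    show "solution a b (q j) (- (\<kappa> z)\<^sup>2) (\<phi> j z)" unfolding \<kappa>2 by (rule \<phi>_sol[OF j])
  qed (use csqrt_uminus_nonreal[OF z] in \<open>auto simp: \<kappa>_def\<close>)
  define \<psi> where "\<psi> j z x = \<theta> j z x + M j z * \<phi> j z x" for j z x
  \<comment> \<open>Here \<psi> is the Weyl solution at \<open>b\<close>; adding a multiple of
    \<phi> to \<theta> leaves the Wronskian unchanged. \<open>K\<close> is left free, to be chosen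
    uniformly along the rays.\<close>
  have green: "cmod (\<phi> j z x * \<psi> j z x) \<le> 1 / (\<bar>Im (\<kappa> z)\<bar> - K)"
    if j: "j \<in> {0, 1}" and z: "z \<notin> \<real>" and x: "x \<in> einterval a b" and K: "K < \<bar>Im (\<kappa> z)\<bar>"
      "cmod (vderiv (\<phi> j z) x - \<kappa> z * \<phi> j z x) \<le> K * cmod (\<phi> j z x)" for j z x K
  proof (rule green_function_bound[OF herglotz[OF j z] x K(2,1)])
    show "wronskian (\<psi> j z) (\<phi> j z) x = 1"
      unfolding \<psi>_def using wronskian_add_cmult[OF \<theta>_sol[OF j] \<phi>_sol[OF j] x] wronskian[OF j x] by simp
    show "Im (cnj (\<psi> j z x) * vderiv (\<psi> j z) x) * Im (\<kappa> z) \<le> 0"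
    proof (rule in_domain_near_right_Im[OF H[OF j] _ _ _ x])
      show "solution a b (q j) (- (\<kappa> z)\<^sup>2) (\<psi> j z)"
        unfolding \<psi>_def \<kappa>2 by (intro solution_cmult_add \<theta>_sol \<phi>_sol j)
      show "in_domain_near_right a b (q j) (w j) (\<psi> j z)"
        using M[OF j] z unfolding singular_weyl_m_def \<psi>_def by blast
      show "Re (\<kappa> z) > 0" using csqrt_uminus_nonreal[OF z] by (simp add: \<kappa>_def)
    qed
  qed
  have c_sub: "{a<..<c} \<subseteq> einterval a b"
    using c by (auto simp: einterval_def intro: less_trans[of _ "ereal c"])
  obtain \<eta> where \<eta>: "\<eta> > 0"
    and \<eta>_R: "\<And>z. z \<in> R \<Longrightarrow> Re (\<kappa> z) \<ge> \<eta> * cmod (\<kappa> z) \<and> \<bar>Im (\<kappa> z)\<bar> \<ge> \<eta> * cmod (\<kappa> z)"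
    and R_nonreal: "\<And>z. z \<in> R \<Longrightarrow> z \<notin> \<real>"
    using rays_csqrt[OF R] unfolding \<kappa>_def by blast
  obtain x1 where x1: "x1 \<in> {a<..<c}" and ratio1: "((\<lambda>z. \<phi> 1 z x1 / \<phi> 0 z x1) \<longlongrightarrow> 1) (at_infinity_along R)"
    using ratio by blast
  define F where "F x z = \<phi> 1 z x * \<theta> 0 z x - \<phi> 0 z x * \<theta> 1 z x - f z * (\<phi> 0 z x * \<phi> 1 z x)" for x z
  have F0: "F x z = 0" if x: "x \<in> {a<..<c}" for x z
  proof (rule R_ring_vanishing_on_rays[where F="F x" and z=z and R=R])
    have xin: "x \<in> einterval a b" using x c_sub by auto
    show "F x \<in> R_ring s"
      unfolding F_def by (intro R_ring_diff R_ring_mult f \<phi>_growth \<theta>_growth xin) auto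
    show "s > 0" using s by simp
    \<comment> \<open>The hypothesis on the Weyl functions is applied at y = c - \<epsilon>,
      strictly to the right of x, so that \<phi>(x)/\<phi>(y) decays.\<close>
    define y where "y = (x + c) / 2"
    have y: "x < y" "y \<in> {a<..<c}" using x by (auto simp: y_def)
    \<comment> \<open>One compact interval holds \<open>x1\<close>, x and y, so a single
      \<open>K\<close> serves both the transport of the ratio from \<open>x1\<close> to x and the
      growth from x to y.\<close>
    define l r where "l = min x x1" and "r = max y x1"
    have lr: "l \<in> einterval a b" "r \<in> einterval a b" using x x1 y c_sub by (auto simp: l_def r_def min_def max_def)
    note lr_sub = einterval_Icc_subset[OF lr]
    have mem: "x \<in> {l..r}" "y \<in> {l..r}" "x1 \<in> {l..r}" using y by (auto simp: l_def r_def)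
    have bnd: "\<exists>K r0. K \<ge> 0 \<and> (\<forall>z t. z \<in> R \<longrightarrow> cmod (\<kappa> z) \<ge> r0 \<longrightarrow> t \<in> {l..r} \<longrightarrow>
       cmod (vderiv (\<phi> j z) t - \<kappa> z * \<phi> j z t) \<le> K * cmod (\<phi> j z t))" if j: "j \<in> {0, 1}" for j
    proof -
      obtain K r0 where "K \<ge> 0"
        "\<And>\<kappa> u x. herglotz_solution a b (q j) \<kappa> u \<Longrightarrow> cmod \<kappa> \<ge> r0 \<Longrightarrow> Re \<kappa> \<ge> \<eta> * cmod \<kappa> \<Longrightarrow> \<bar>Im \<kappa>\<bar> \<ge> \<eta> * cmod \<kappa> \<Longrightarrow>
           x \<in> {l..r} \<Longrightarrow> cmod (vderiv u x - \<kappa> * u x) \<le> K * cmod (u x)"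
        using herglotz_solution_asymptotics[OF q[OF j] lr \<eta>] by metis
      then show ?thesis using herglotz[OF j R_nonreal] \<eta>_R by blast
    qed
    obtain K0 r0 where K0: "K0 \<ge> 0"
      "\<And>z t. z \<in> R \<Longrightarrow> cmod (\<kappa> z) \<ge> r0 \<Longrightarrow> t \<in> {l..r} \<Longrightarrow> cmod (vderiv (\<phi> 0 z) t - \<kappa> z * \<phi> 0 z t) \<le> K0 * cmod (\<phi> 0 z t)"
      using bnd[of 0] by blast
    obtain K1 r1 where K1: "K1 \<ge> 0"
      "\<And>z t. z \<in> R \<Longrightarrow> cmod (\<kappa> z) \<ge> r1 \<Longrightarrow> t \<in> {l..r} \<Longrightarrow> cmod (vderiv (\<phi> 1 z) t - \<kappa> z * \<phi> 1 z t) \<le> K1 * cmod (\<phi> 1 z t)"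
      using bnd[of 1] by blast
    define K where "K = max K0 K1"
    have K: "cmod (vderiv (\<phi> j z) t - \<kappa> z * \<phi> j z t) \<le> K * cmod (\<phi> j z t)"
      if "j \<in> {0, 1}" "z \<in> R" "cmod (\<kappa> z) \<ge> max r0 r1" "t \<in> {l..r}" for j z t
    proof -
      have "K0 * cmod (\<phi> 0 z t) \<le> K * cmod (\<phi> 0 z t)" "K1 * cmod (\<phi> 1 z t) \<le> K * cmod (\<phi> 1 z t)"
        by (auto simp: K_def intro: mult_right_mono)
      then show ?thesis using K0(2)[of z t] K1(2)[of z t] that by force
    qed
    obtain D where D: "D > 0" "eventually (\<lambda>z. cmod (M 1 z - M 0 z - f z) \<le> D * cmod (1 / (\<phi> 0 z y)\<^sup>2)) (at_infinity_along R)"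
      using M_diff[of "c - y"] y by (auto elim!: landau_o.bigE)
    \<comment> \<open>The factor 2 reflects that the ratio at \<open>x1\<close> finally lies between
      1/2 and 2 in modulus; the exponential is the cost of moving from \<open>x1\<close> to
      x.\<close>
    define C where "C = 2 * exp (2 * K * \<bar>x - x1\<bar>)"
    \<comment> \<open>A common lower bound for Re \<kappa> - K, the rate of growth, and |Im
      \<kappa>| - K, the denominator of the Green function bound.\<close>
    define X where "X z = - K + \<eta> * sqrt (cmod z)" for z
    \<comment> \<open>Two Green function terms, each with one solution exchanged for the other at
      the cost \<open>C\<close>, and the term with the Weyl functions.\<close>
    define g where "g z = 2 * (C / X z) + D * C * exp (- (2 * (y - x)) * X z)" for z
    have "filterlim (\<lambda>z. sqrt (cmod z)) at_top at_infinity"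
      by (rule filterlim_compose[OF sqrt_at_top filterlim_norm_at_top])
    then have sqrt_top: "filterlim (\<lambda>z. sqrt (cmod z)) at_top (at_infinity_along R)"
      unfolding at_infinity_along_def by (rule filterlim_mono) auto
    have X_top: "filterlim X at_top (at_infinity_along R)"
      unfolding X_def
      by (rule filterlim_tendsto_add_at_top[OF tendsto_const
            filterlim_tendsto_pos_mult_at_top[OF tendsto_const \<eta> sqrt_top]])
    have "((\<lambda>z. C / X z) \<longlongrightarrow> 0) (at_infinity_along R)"
      by (rule tendsto_divide_0[OF tendsto_const filterlim_at_top_imp_at_infinity[OF X_top]])
    moreover have "((\<lambda>z. exp (- (2 * (y - x)) * X z)) \<longlongrightarrow> 0) (at_infinity_along R)"
      using y(1) by (intro filterlim_compose[OF exp_at_bot] filterlim_tendsto_neg_mult_at_bot[OF tendsto_const _ X_top]) auto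
    ultimately have "(g \<longlongrightarrow> 2 * 0 + D * C * 0) (at_infinity_along R)"
      unfolding g_def by (intro tendsto_intros)
    then have g0: "(g \<longlongrightarrow> 0) (at_infinity_along R)" by simp
    have ev_ratio: "eventually (\<lambda>z. dist (\<phi> 1 z x1 / \<phi> 0 z x1) 1 < 1/2) (at_infinity_along R)"
      using tendstoD[OF ratio1, of "1/2"] by simp
    have ev_R: "eventually (\<lambda>z. z \<in> R) (at_infinity_along R)"
      by (auto simp: eventually_at_infinity_along)
    have "eventually (\<lambda>z. cmod (F x z) \<le> g z) (at_infinity_along R)"
      using ev_R ev_ratio D(2) filterlim_at_top[THEN iffD1, rule_format, OF sqrt_top, of "max r0 r1"]
        filterlim_at_top_dense[THEN iffD1, rule_format, OF X_top, of 0]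
    proof eventually_elim
      case (elim z)
      note z = R_nonreal[OF elim(1)]
      have Kz: "cmod (vderiv (\<phi> j z) t - \<kappa> z * \<phi> j z t) \<le> K * cmod (\<phi> j z t)"
        if "j \<in> {0, 1}" "t \<in> {l..r}" for j t
        using K[OF that(1) elim(1) _ that(2)] elim(4) by (simp add: \<kappa>_norm)
      have X_Re: "X z \<le> Re (\<kappa> z) - K" and X_Im: "X z \<le> \<bar>Im (\<kappa> z)\<bar> - K"
        using \<eta>_R[OF elim(1)] by (auto simp: X_def \<kappa>_norm)
      have nz: "\<phi> j z t \<noteq> 0" if "j \<in> {0, 1}" "t \<in> {l..r}" for j t
        using herglotz[OF that(1) z] that(2) lr_sub by (auto simp: herglotz_solution_def)
      define \<rho> where "\<rho> = cmod (\<phi> 1 z x1) / cmod (\<phi> 0 z x1)"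
      have "\<bar>\<rho> - 1\<bar> \<le> 1/2"
        using norm_triangle_ineq3[of "\<phi> 1 z x1 / \<phi> 0 z x1" 1] elim(2) by (simp add: \<rho>_def norm_divide dist_norm)
      then have \<rho>: "1/2 \<le> \<rho>" "\<rho> \<le> 2" by linarith+
      have \<rho>_eq: "cmod (\<phi> 1 z x1) = \<rho> * cmod (\<phi> 0 z x1)" using nz[of 0 x1] mem by (simp add: \<rho>_def)
      define E where "E = exp (2 * K * \<bar>x - x1\<bar>)"
      have "cmod (\<phi> 1 z x) * cmod (\<phi> 0 z x1) \<le> E * (cmod (\<phi> 0 z x) * cmod (\<phi> 1 z x1))"
        unfolding E_def using mem Kz
        by (intro herglotz_ratio_bound[OF \<phi>_sol \<phi>_sol lr_sub, where \<kappa>="\<kappa> z"]) auto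
      then have "cmod (\<phi> 1 z x) \<le> E * \<rho> * cmod (\<phi> 0 z x)"
        using nz[of 0 x1] mem unfolding \<rho>_eq by (simp add: mult_ac)
      also have "\<dots> \<le> E * 2 * cmod (\<phi> 0 z x)" using \<rho> by (intro mult_right_mono mult_left_mono) (auto simp: E_def)
      finally have r10: "cmod (\<phi> 1 z x) \<le> C * cmod (\<phi> 0 z x)" by (simp add: C_def E_def mult_ac)
      have "cmod (\<phi> 0 z x) * cmod (\<phi> 1 z x1) \<le> E * (cmod (\<phi> 1 z x) * cmod (\<phi> 0 z x1))"
        unfolding E_def using mem Kz
        by (intro herglotz_ratio_bound[OF \<phi>_sol \<phi>_sol lr_sub, where \<kappa>="\<kappa> z"]) auto
      then have "\<rho> * cmod (\<phi> 0 z x) \<le> E * cmod (\<phi> 1 z x)"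
        using nz[of 0 x1] mem unfolding \<rho>_eq by (simp add: mult_ac)
      moreover have "1/2 * cmod (\<phi> 0 z x) \<le> \<rho> * cmod (\<phi> 0 z x)" using \<rho> by (intro mult_right_mono) auto
      ultimately have r01: "cmod (\<phi> 0 z x) \<le> C * cmod (\<phi> 1 z x)" by (simp add: C_def E_def)
      have C0: "C \<ge> 0" by (simp add: C_def)
      have gr: "cmod (\<phi> j z x) * cmod (\<psi> j z x) \<le> 1 / X z" if j: "j \<in> {0, 1}" for j
      proof -
        have "cmod (\<phi> j z x * \<psi> j z x) \<le> 1 / (\<bar>Im (\<kappa> z)\<bar> - K)"
          using X_Im elim(5) by (intro green[OF j z xin] Kz j mem) auto
        also have "\<dots> \<le> 1 / X z" using X_Im elim(5) by (intro divide_left_mono) auto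
        finally show ?thesis by (simp add: norm_mult)
      qed
      have t1: "cmod (\<phi> 1 z x * \<psi> 0 z x) \<le> C / X z"
      proof -
        have "cmod (\<phi> 1 z x * \<psi> 0 z x) \<le> (C * cmod (\<phi> 0 z x)) * cmod (\<psi> 0 z x)"
          unfolding norm_mult by (intro mult_right_mono r10) auto
        also have "\<dots> \<le> C * (1 / X z)" using mult_left_mono[OF gr[of 0] C0] by (simp add: mult_ac)
        finally show ?thesis by simp
      qed
      have t2: "cmod (\<phi> 0 z x * \<psi> 1 z x) \<le> C / X z"
      proof -
        have "cmod (\<phi> 0 z x * \<psi> 1 z x) \<le> (C * cmod (\<phi> 1 z x)) * cmod (\<psi> 1 z x)"
          unfolding norm_mult by (intro mult_right_mono r01) auto
        also have "\<dots> \<le> C * (1 / X z)" using mult_left_mono[OF gr[of 1] C0] by (simp add: mult_ac)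
        finally show ?thesis by simp
      qed
      \<comment> \<open>The error term is at most \<open>D * C\<close> times
        |\<phi>(x)|^2/|\<phi>(y)|^2 for the solution with index 0, and the lower growth estimate
        from x to y makes this quotient exponentially small.\<close>
      have t3: "cmod ((M 1 z - M 0 z - f z) * (\<phi> 0 z x * \<phi> 1 z x)) \<le> D * C * exp (- (2 * (y - x)) * X z)"
      proof -
        have yin: "y \<in> einterval a b" using y c_sub by auto
        have "exp (X z * (y - x)) * cmod (\<phi> 0 z x) \<le> exp ((Re (\<kappa> z) - K) * (y - x)) * cmod (\<phi> 0 z x)"
          using X_Re y by (intro mult_right_mono) auto
        also have "\<dots> \<le> cmod (\<phi> 0 z y)"
          using y mem by (intro solution_growth(2)[OF \<phi>_sol xin yin] Kz) auto
        finally have "(exp (X z * (y - x)) * cmod (\<phi> 0 z x))\<^sup>2 \<le> (cmod (\<phi> 0 z y))\<^sup>2"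
          by (intro power_mono) auto
        then have "exp (2 * (y - x) * X z) * (cmod (\<phi> 0 z x))\<^sup>2 \<le> (cmod (\<phi> 0 z y))\<^sup>2"
          by (simp add: power_mult_distrib exp_double[symmetric] mult_ac)
        moreover have "A / B \<le> exp (- m)" if "exp m * A \<le> B" "B > 0" for A B m :: real
          using that by (simp add: exp_minus field_simps)
        ultimately have "(cmod (\<phi> 0 z x))\<^sup>2 / (cmod (\<phi> 0 z y))\<^sup>2 \<le> exp (- (2 * (y - x) * X z))"
          using nz[of 0 y] mem by simp
        then have q: "(cmod (\<phi> 0 z x))\<^sup>2 / (cmod (\<phi> 0 z y))\<^sup>2 \<le> exp (- (2 * (y - x)) * X z)"
          by (simp only: mult_minus_left)
        have "cmod ((M 1 z - M 0 z - f z) * (\<phi> 0 z x * \<phi> 1 z x)) \<le>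
            (D * cmod (1 / (\<phi> 0 z y)\<^sup>2)) * (cmod (\<phi> 0 z x) * (C * cmod (\<phi> 0 z x)))"
          unfolding norm_mult using D(1) by (intro mult_mono elim(3) r10) auto
        also have "\<dots> = D * C * ((cmod (\<phi> 0 z x))\<^sup>2 / (cmod (\<phi> 0 z y))\<^sup>2)"
          by (simp add: norm_divide norm_power norm_mult power2_eq_square)
        also have "\<dots> \<le> D * C * exp (- (2 * (y - x)) * X z)"
          using D(1) C0 by (intro mult_left_mono q) auto
        finally show ?thesis .
      qed
      have "F x z = \<phi> 1 z x * \<psi> 0 z x - \<phi> 0 z x * \<psi> 1 z x + (M 1 z - M 0 z - f z) * (\<phi> 0 z x * \<phi> 1 z x)"
        by (simp add: F_def \<psi>_def algebra_simps)
      then have "cmod (F x z) \<le> cmod (\<phi> 1 z x * \<psi> 0 z x) + cmod (\<phi> 0 z x * \<psi> 1 z x)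
          + cmod ((M 1 z - M 0 z - f z) * (\<phi> 0 z x * \<phi> 1 z x))"
        by (metis norm_triangle_ineq norm_triangle_ineq4 order_trans add_right_mono)
      then show ?case using t1 t2 t3 by (simp add: g_def)
    qed
    then show "(F x \<longlongrightarrow> 0) (at_infinity_along R)" by (rule Lim_null_comparison[OF _ g0])
  qed (rule R)
  \<comment> \<open>From here one fixed energy is enough; it is taken nonreal so that neither \<phi>
    has a zero in the interval.\<close>
  define z where "z = \<i>"
  have z: "z \<notin> \<real>" by (simp add: z_def complex_is_Real_iff)
  have nz: "\<phi> j z x \<noteq> 0" if "j \<in> {0, 1}" "x \<in> einterval a b" for j x
    using herglotz[OF that(1) z] that(2) by (auto simp: herglotz_solution_def)
  have quot: "\<theta> 0 z x / \<phi> 0 z x - \<theta> 1 z x / \<phi> 1 z x = f z" if "x \<in> {a<..<c}" for x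
    using F0[OF that, of z] nz[of 0 x] nz[of 1 x] that c_sub by (auto simp: F_def field_simps)
  have sq: "(\<phi> 1 z x)\<^sup>2 = (\<phi> 0 z x)\<^sup>2" if "x \<in> {a<..<c}" for x
    by (rule inverse_square_eq_of_quotient_difference[where q=q and \<phi>="\<lambda>j. \<phi> j z" and \<theta>="\<lambda>j. \<theta> j z",
          OF \<phi>_sol \<theta>_sol wronskian nz c_sub quot that])
  have cont: "continuous_on {a<..<c} (\<phi> j z)" if "j \<in> {0, 1}" for j
    using tau_rel_continuous(1) \<phi>_sol[OF that, of z] c_sub by (meson continuous_on_subset solution_def)
  have nz': "\<phi> 0 z x \<noteq> 0" "\<phi> 1 z x \<noteq> 0" if "x \<in> {a<..<c}" for x
    using nz[of 0 x] nz[of 1 x] c_sub that by blast+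
  have "\<exists>\<sigma>. \<forall>x\<in>{a<..<c}. \<phi> 1 z x = \<sigma> * \<phi> 0 z x"
    by (rule continuous_square_eq_imp_proportional[OF cont cont nz'(1) sq]) simp_all
  then obtain \<sigma> where \<sigma>: "\<And>x. x \<in> {a<..<c} \<Longrightarrow> \<phi> 1 z x = \<sigma> * \<phi> 0 z x" by blast
  show ?thesis
    by (rule potential_unique[OF \<phi>_sol \<phi>_sol c_sub \<sigma> nz'(2)]) simp_all
qed

end
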